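(* Let $p:(\mathcal D,K)\to(\mathcal C,J)$ be a continuous comorphism of sites. Then $\mathrm{Sh}(p)^*\simeq (C_p)_!:\widehat{\mathcal D}_K\to\widehat{\mathcal C}_J$ is a fibration if and only if, for every object $d$ of $\mathcal D$ and every arrow $f:c\to p(d)$ in $\mathcal C$, the functor $\pi_d^f:\mathcal D^{\mathbf{fact}}_{f,d}\to\mathcal C/c$ is $J$-cofinal.
   Context: Sites are such that their categories of sheaves are Grothendieck toposes. For a site $(\mathcal C,J)$: $\widehat{\mathcal C}_J$ is the topos of sheaves, $a_J$ is sheafification, $l_J:\mathcal C\to\widehat{\mathcal C}_J$ is Yoneda followed by $a_J$. A comorphism of sites $p:(\mathcal D,K)\to(\mathcal C,J)$ is a functor such that every $J$-covering sieve on $p(d)$ contains the image $p(R)$ of a $K$-covering sieve $R$ on $d$; it induces a geometric morphism $C_p:\widehat{\mathcal D}_K\to\widehat{\mathcal C}_J$ with $C_p^*(E)=a_K(E\circ p^{op})$. It is continuous if moreover precomposition with $p$ sends $J$-sheaves to $K$-sheaves; then $C_p^*=(-\circ p^{op})$ has a left adjoint $\mathrm{Sh}(p)^*=(C_p)_!:\widehat{\mathcal D}_K\to\widehat{\mathcal C}_J$ with $\mathrm{Sh}(p)^*l_K\simeq l_Jp$. For $f:c\to p(d)$, the category $\mathcal D^{\mathbf{fact}}_{f,d}$ has as objects the triples $(d',v',f')$ with $d'\in\mathcal D$, $v':p(d')\to c$, $f':d'\to d$ and $fv'=p(f')$; arrows $(d',v',f')\to(d'',v'',f'')$ are the arrows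 $u:d'\to d''$ with $v''p(u)=v'$ and $f''u=f'$. The functor $\pi^f_d$ sends $(d',v',f')$ to $(p(d'),v')$. Write $\pi_c:\mathcal C/c\to\mathcal C$ for the projection. The functor $\pi^f_d$ is called $J$-cofinal if the canonical arrow $\mathrm{colim}\,(l_J\,\pi_c\,\pi^f_d)\to l_J(c)\simeq\mathrm{colim}\,(l_J\,\pi_c)$ in $\widehat{\mathcal C}_J$ is an isomorphism. (Explicitly: the arrows $v'$ of objects $(d',v',f')$ generate a $J$-covering sieve on $c$; and for any objects $(d',v',f')$, $(d'',v'',f'')$ and arrows $x':\bar c\to p(d')$, $x'':\bar c\to p(d'')$ with $v'x'=v''x''$ there is a $J$-covering family $(w_i:c_i\to\bar c)_i$ such that for each $i$ the arrows $x'w_i$ and $x''w_i$ lie in the same connected component of the comma category $(c_i/\pi_c\pi_d^f)$.) Fibration means Street fibration: a functor $q:\mathcal A\to\mathcal B$ such that for every arrow $u:b\to q(a)$ there are a cartesian arrow $\widehat u:a'\to a$ and an isomorphism $\sigma:q(a')\simeq b$ with $q(\widehat u)=u\sigma$, where $v:a'\to a$ is cartesian if for all $g:a''\to a$ and $h:q(a'')\to q(a')$ with $q(v)h=q(g)$ there is a unique $h':a''\to a'$ with $q(h')=h$ and $vh'=g$. *)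

theory Defs
  imports "HOL-Library.FuncSet" "HOL-Library.Equipollence"
begin

section \<open>Categories and functors\<close>

record ('o, 'a) cat =
  Ob :: "'o set"
  Arr :: "'a set"
  Dom :: "'a \<Rightarrow> 'o"
  Cod :: "'a \<Rightarrow> 'o"
  Ide :: "'o \<Rightarrow> 'a"
  Comp :: "'a \<Rightarrow> 'a \<Rightarrow> 'a" (infixl "\<cdot>\<index>" 70)

definition hom :: "('o, 'a) cat \<Rightarrow> 'o \<Rightarrow> 'o \<Rightarrow> 'a set" where
  "hom C a b = {f \<in> Arr C. Dom C f = a \<and> Cod C f = b}"

locale category =
  fixes C :: "('o, 'a) cat" (structure)
  assumes Dom_in: "f \<in> Arr C \<Longrightarrow> Dom C f \<in> Ob C"
    and Cod_in: "f \<in> Arr C \<Longrightarrow> Cod C f \<in> Ob C"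
    and Ide_in: "a \<in> Ob C \<Longrightarrow> Ide C a \<in> hom C a a"
    and Comp_in: "\<lbrakk>f \<in> hom C a b; g \<in> hom C b c\<rbrakk> \<Longrightarrow> g \<cdot> f \<in> hom C a c"
    and Ide_left: "f \<in> hom C a b \<Longrightarrow> Ide C b \<cdot> f = f"
    and Ide_right: "f \<in> hom C a b \<Longrightarrow> f \<cdot> Ide C a = f"
    and Comp_assoc: "\<lbrakk>f \<in> hom C a b; g \<in> hom C b c; h \<in> hom C c d\<rbrakk>
      \<Longrightarrow> (h \<cdot> g) \<cdot> f = h \<cdot> (g \<cdot> f)"

definition is_iso :: "('o, 'a) cat \<Rightarrow> 'a \<Rightarrow> bool" where
  "is_iso C f \<longleftrightarrow> f \<in> Arr C \<and>
     (\<exists>g \<in> hom C (Cod C f) (Dom C f).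
        g \<cdot>\<^bsub>C\<^esub> f = Ide C (Dom C f) \<and> f \<cdot>\<^bsub>C\<^esub> g = Ide C (Cod C f))"

record ('o, 'a, 'p, 'b) funct =
  omap :: "'o \<Rightarrow> 'p"
  amap :: "'a \<Rightarrow> 'b"

definition is_functor :: "('o, 'a) cat \<Rightarrow> ('p, 'b) cat \<Rightarrow> ('o, 'a, 'p, 'b) funct \<Rightarrow> bool" where
  "is_functor A B F \<longleftrightarrow>
     (\<forall>a \<in> Ob A. omap F a \<in> Ob B) \<and>
     (\<forall>f \<in> Arr A. amap F f \<in> hom B (omap F (Dom A f)) (omap F (Cod A f))) \<and>
     (\<forall>a \<in> Ob A. amap F (Ide A a) = Ide B (omap F a)) \<and>
     (\<forall>f \<in> Arr A. \<forall>g \<in> Arr A. Cod A f = Dom A g \<longrightarrow>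
        amap F (g \<cdot>\<^bsub>A\<^esub> f) = amap F g \<cdot>\<^bsub>B\<^esub> amap F f)"

definition functor_comp ::
  "('p, 'b, 'q, 'c) funct \<Rightarrow> ('o, 'a, 'p, 'b) funct \<Rightarrow> ('o, 'a, 'q, 'c) funct" where
  "functor_comp G F = \<lparr>omap = omap G \<circ> omap F, amap = amap G \<circ> amap F\<rparr>"

text \<open>\<open>L\<close> is left adjoint to \<open>R\<close>: there is a natural unit \<open>\<eta>\<close> whose components are
  universal arrows to \<open>R\<close>.\<close>

definition left_adjoint :: "('o, 'a) cat \<Rightarrow> ('p, 'b) cat \<Rightarrow>
    ('o, 'a, 'p, 'b) funct \<Rightarrow> ('p, 'b, 'o, 'a) funct \<Rightarrow> bool" where
  "left_adjoint A B L R \<longleftrightarrow> is_functor A B L \<and> is_functor B A R \<and>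
     (\<exists>\<eta>. (\<forall>a \<in> Ob A. \<eta> a \<in> hom A a (omap R (omap L a))) \<and>
          (\<forall>f \<in> Arr A. \<eta> (Cod A f) \<cdot>\<^bsub>A\<^esub> f = amap R (amap L f) \<cdot>\<^bsub>A\<^esub> \<eta> (Dom A f)) \<and>
          (\<forall>a \<in> Ob A. \<forall>b \<in> Ob B. \<forall>f \<in> hom A a (omap R b).
             \<exists>!g. g \<in> hom B (omap L a) b \<and> amap R g \<cdot>\<^bsub>A\<^esub> \<eta> a = f))"

definition cocone :: "('i, 'j) cat \<Rightarrow> ('o, 'a) cat \<Rightarrow> ('i, 'j, 'o, 'a) funct \<Rightarrow>
    'o \<Rightarrow> ('i \<Rightarrow> 'a) \<Rightarrow> bool" where
  "cocone I E X L \<iota> \<longleftrightarrow> L \<in> Ob E \<and> (\<forall>i \<in> Ob I. \<iota> i \<in> hom E (omap X i) L) \<and>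
     (\<forall>u \<in> Arr I. \<iota> (Cod I u) \<cdot>\<^bsub>E\<^esub> amap X u = \<iota> (Dom I u))"

definition is_colimit :: "('i, 'j) cat \<Rightarrow> ('o, 'a) cat \<Rightarrow> ('i, 'j, 'o, 'a) funct \<Rightarrow>
    'o \<Rightarrow> ('i \<Rightarrow> 'a) \<Rightarrow> bool" where
  "is_colimit I E X L \<iota> \<longleftrightarrow> cocone I E X L \<iota> \<and>
     (\<forall>M \<kappa>. cocone I E X M \<kappa> \<longrightarrow>
        (\<exists>!m. m \<in> hom E L M \<and> (\<forall>i \<in> Ob I. m \<cdot>\<^bsub>E\<^esub> \<iota> i = \<kappa> i)))"

text \<open>An arrow of a slice category is recorded together with its source and target.\<close>

definition slice_cat ::
  "('o, 'a) cat \<Rightarrow> 'o \<Rightarrow> ('o \<times> 'a, ('o \<times> 'a) \<times> 'a \<times> ('o \<times> 'a)) cat" where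
  "slice_cat C c = \<lparr>
     Ob = {(b, v). v \<in> hom C b c},
     Arr = {((b, v), w, (b', v')). v \<in> hom C b c \<and> v' \<in> hom C b' c \<and>
              w \<in> hom C b b' \<and> v' \<cdot>\<^bsub>C\<^esub> w = v},
     Dom = (\<lambda>(x, w, y). x),
     Cod = (\<lambda>(x, w, y). y),
     Ide = (\<lambda>(b, v). ((b, v), Ide C b, (b, v))),
     Comp = (\<lambda>(y, w', z) (x, w, y'). (x, w' \<cdot>\<^bsub>C\<^esub> w, z))\<rparr>"

definition slice_proj :: "('o \<times> 'a, ('o \<times> 'a) \<times> 'a \<times> ('o \<times> 'a), 'o, 'a) funct" where
  "slice_proj = \<lparr>omap = (\<lambda>(b, v). b), amap = (\<lambda>(x, w, y). w)\<rparr>"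


section \<open>Street fibrations\<close>

definition cartesian_arrow ::
  "('o, 'a) cat \<Rightarrow> ('p, 'b) cat \<Rightarrow> ('o, 'a, 'p, 'b) funct \<Rightarrow> 'a \<Rightarrow> bool" where
  "cartesian_arrow A B q v \<longleftrightarrow> v \<in> Arr A \<and>
     (\<forall>g \<in> Arr A. \<forall>h. Cod A g = Cod A v \<and>
        h \<in> hom B (omap q (Dom A g)) (omap q (Dom A v)) \<and> amap q v \<cdot>\<^bsub>B\<^esub> h = amap q g \<longrightarrow>
        (\<exists>!h'. h' \<in> hom A (Dom A g) (Dom A v) \<and> amap q h' = h \<and> v \<cdot>\<^bsub>A\<^esub> h' = g))"

definition street_fibration ::
  "('o, 'a) cat \<Rightarrow> ('p, 'b) cat \<Rightarrow> ('o, 'a, 'p, 'b) funct \<Rightarrow> bool" where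
  "street_fibration A B q \<longleftrightarrow> is_functor A B q \<and>
     (\<forall>a \<in> Ob A. \<forall>b \<in> Ob B. \<forall>u \<in> hom B b (omap q a).
        \<exists>a' \<in> Ob A. \<exists>u' \<in> hom A a' a. \<exists>\<sigma> \<in> hom B (omap q a') b.
          cartesian_arrow A B q u' \<and> is_iso B \<sigma> \<and> amap q u' = u \<cdot>\<^bsub>B\<^esub> \<sigma>)"


section \<open>The category of sets\<close>

text \<open>The category of sets is modelled by a collection \<open>U\<close> of subsets of a type. It is closed
  under sets that inject into a member (hence under subsets and images) and under unions of
  families indexed by a member; disjoint sums and binary products come for free, since an infinite set is equipollent to its
  square. An index set \<open>A\<close> of any type is small when \<open>U\<close> is closed under powers with
  exponent \<open>A\<close>. If \<open>U\<close> is also closed under power sets (a Grothendieck universe), then the small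
  sets are exactly those equipollent to a member of \<open>U\<close>. Closure under power sets is not required,
  so that the collection of all subsets of the type is allowed too, whenever the type is infinite;
  a set \<open>A\<close> is then small if and only if the functions from \<open>A\<close> to the type inject into the type.\<close>

definition set_universe :: "'u set set \<Rightarrow> bool" where
  "set_universe U \<longleftrightarrow>
     (\<forall>X \<in> U. \<forall>Y. Y \<lesssim> X \<longrightarrow> Y \<in> U) \<and>
     (\<forall>X \<in> U. \<forall>F. (\<forall>x \<in> X. F x \<in> U) \<longrightarrow> (\<Union>x \<in> X. F x) \<in> U) \<and>
     (\<exists>X \<in> U. infinite X)"

definition small :: "'u set set \<Rightarrow> 'i set \<Rightarrow> bool" where
  "small U A \<longleftrightarrow> (\<forall>X \<in> U. \<exists>Z \<in> U. (A \<rightarrow>\<^sub>E X) \<lesssim> Z)"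


section \<open>Sites\<close>

definition sieve :: "('o, 'a) cat \<Rightarrow> 'o \<Rightarrow> 'a set \<Rightarrow> bool" where
  "sieve C c R \<longleftrightarrow> R \<subseteq> {f \<in> Arr C. Cod C f = c} \<and>
     (\<forall>f \<in> R. \<forall>g \<in> Arr C. Cod C g = Dom C f \<longrightarrow> f \<cdot>\<^bsub>C\<^esub> g \<in> R)"

definition pullback_sieve :: "('o, 'a) cat \<Rightarrow> 'a \<Rightarrow> 'a set \<Rightarrow> 'a set" where
  "pullback_sieve C g R = {h \<in> Arr C. Cod C h = Dom C g \<and> g \<cdot>\<^bsub>C\<^esub> h \<in> R}"

definition grothendieck_topology :: "('o, 'a) cat \<Rightarrow> ('o \<Rightarrow> 'a set set) \<Rightarrow> bool" where
  "grothendieck_topology C J \<longleftrightarrow>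
     (\<forall>c \<in> Ob C. \<forall>R \<in> J c. sieve C c R) \<and>
     (\<forall>c \<in> Ob C. {f \<in> Arr C. Cod C f = c} \<in> J c) \<and>
     (\<forall>g \<in> Arr C. \<forall>R \<in> J (Cod C g). pullback_sieve C g R \<in> J (Dom C g)) \<and>
     (\<forall>c \<in> Ob C. \<forall>S \<in> J c. \<forall>R. sieve C c R \<and>
        (\<forall>f \<in> S. pullback_sieve C f R \<in> J (Dom C f)) \<longrightarrow> R \<in> J c)"

text \<open>Sites need not be small, but they are small-generated: the category is locally small, and
  every object is covered by the arrows that factor through an object of some small set \<open>B\<close>. This
  is what makes the sheaves with values in \<open>U\<close> into a Grothendieck topos.\<close>

definition site :: "'u set set \<Rightarrow> ('o, 'a) cat \<Rightarrow> ('o \<Rightarrow> 'a set set) \<Rightarrow> bool" where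
  "site U C J \<longleftrightarrow> category C \<and> grothendieck_topology C J \<and>
     (\<forall>a \<in> Ob C. \<forall>b \<in> Ob C. small U (hom C a b)) \<and>
     (\<exists>B \<subseteq> Ob C. small U B \<and>
        (\<forall>c \<in> Ob C. {g \<cdot>\<^bsub>C\<^esub> f | g f. f \<in> Arr C \<and> g \<in> Arr C \<and> Cod C f = Dom C g \<and>
                       Dom C g \<in> B \<and> Cod C g = c} \<in> J c))"


section \<open>Presheaves and sheaves\<close>

text \<open>All functions in presheaves and natural transformations are extensional, so that HOL equality
  is equality of presheaves and of natural transformations.\<close>

record ('o, 'a, 'v) psh =
  val :: "'o \<Rightarrow> 'v set"
  res :: "'a \<Rightarrow> 'v \<Rightarrow> 'v"

definition presheaf :: "('o, 'a) cat \<Rightarrow> ('o, 'a, 'v) psh \<Rightarrow> bool" where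
  "presheaf C P \<longleftrightarrow>
     val P \<in> extensional (Ob C) \<and>
     res P \<in> (\<Pi>\<^sub>E f \<in> Arr C. val P (Cod C f) \<rightarrow>\<^sub>E val P (Dom C f)) \<and>
     (\<forall>c \<in> Ob C. \<forall>x \<in> val P c. res P (Ide C c) x = x) \<and>
     (\<forall>f \<in> Arr C. \<forall>g \<in> Arr C. Cod C g = Dom C f \<longrightarrow>
        (\<forall>x \<in> val P (Cod C f). res P (f \<cdot>\<^bsub>C\<^esub> g) x = res P g (res P f x)))"

definition nat_trans :: "('o, 'a) cat \<Rightarrow> ('o, 'a, 'v) psh \<Rightarrow> ('o, 'a, 'w) psh \<Rightarrow>
    ('o \<Rightarrow> 'v \<Rightarrow> 'w) \<Rightarrow> bool" where
  "nat_trans C P Q \<alpha> \<longleftrightarrow>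
     \<alpha> \<in> (\<Pi>\<^sub>E c \<in> Ob C. val P c \<rightarrow>\<^sub>E val Q c) \<and>
     (\<forall>f \<in> Arr C. \<forall>x \<in> val P (Cod C f).
        \<alpha> (Dom C f) (res P f x) = res Q f (\<alpha> (Cod C f) x))"

definition nt_comp :: "('o, 'a) cat \<Rightarrow> ('o, 'a, 'v) psh \<Rightarrow>
    ('o \<Rightarrow> 'w \<Rightarrow> 'x) \<Rightarrow> ('o \<Rightarrow> 'v \<Rightarrow> 'w) \<Rightarrow> 'o \<Rightarrow> 'v \<Rightarrow> 'x" where
  "nt_comp C P \<beta> \<alpha> = (\<lambda>c \<in> Ob C. \<lambda>x \<in> val P c. \<beta> c (\<alpha> c x))"

definition matching_family :: "('o, 'a) cat \<Rightarrow> ('o, 'a, 'v) psh \<Rightarrow> 'a set \<Rightarrow> ('a \<Rightarrow> 'v) \<Rightarrow> bool" where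
  "matching_family C P R x \<longleftrightarrow> (\<forall>f \<in> R. x f \<in> val P (Dom C f)) \<and>
     (\<forall>f \<in> R. \<forall>g \<in> Arr C. Cod C g = Dom C f \<longrightarrow> res P g (x f) = x (f \<cdot>\<^bsub>C\<^esub> g))"

definition sheaf :: "('o, 'a) cat \<Rightarrow> ('o \<Rightarrow> 'a set set) \<Rightarrow> ('o, 'a, 'v) psh \<Rightarrow> bool" where
  "sheaf C J P \<longleftrightarrow> presheaf C P \<and>
     (\<forall>c \<in> Ob C. \<forall>R \<in> J c. \<forall>x. matching_family C P R x \<longrightarrow>
        (\<exists>!y. y \<in> val P c \<and> (\<forall>f \<in> R. res P f y = x f)))"

definition sheaves :: "'u set set \<Rightarrow> ('o, 'a) cat \<Rightarrow> ('o \<Rightarrow> 'a set set) \<Rightarrow> ('o, 'a, 'u) psh set" where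
  "sheaves U C J = {F. sheaf C J F \<and> (\<forall>c \<in> Ob C. val F c \<in> U)}"

type_synonym ('o, 'a, 'u) sh_arr = "('o, 'a, 'u) psh \<times> ('o \<Rightarrow> 'u \<Rightarrow> 'u) \<times> ('o, 'a, 'u) psh"

definition Sh :: "'u set set \<Rightarrow> ('o, 'a) cat \<Rightarrow> ('o \<Rightarrow> 'a set set) \<Rightarrow>
    (('o, 'a, 'u) psh, ('o, 'a, 'u) sh_arr) cat" where
  "Sh U C J = \<lparr>
     Ob = sheaves U C J,
     Arr = {(F, \<alpha>, G). F \<in> sheaves U C J \<and> G \<in> sheaves U C J \<and> nat_trans C F G \<alpha>},
     Dom = (\<lambda>(F, \<alpha>, G). F),
     Cod = (\<lambda>(F, \<alpha>, G). G),
     Ide = (\<lambda>F. (F, \<lambda>c \<in> Ob C. \<lambda>x \<in> val F c. x, F)),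
     Comp = (\<lambda>(G, \<beta>, H) (F, \<alpha>, G'). (F, nt_comp C F \<beta> \<alpha>, H))\<rparr>"

text \<open>Sheafification is the reflection into sheaves, given by its universal property. The presheaf
  \<open>P\<close> may take values in any type, so that it applies directly to the representable presheaves.\<close>

definition is_sheafification :: "'u set set \<Rightarrow> ('o, 'a) cat \<Rightarrow> ('o \<Rightarrow> 'a set set) \<Rightarrow>
    ('o, 'a, 'v) psh \<Rightarrow> ('o, 'a, 'u) psh \<Rightarrow> ('o \<Rightarrow> 'v \<Rightarrow> 'u) \<Rightarrow> bool" where
  "is_sheafification U C J P F \<eta> \<longleftrightarrow> F \<in> sheaves U C J \<and> nat_trans C P F \<eta> \<and>
     (\<forall>G \<in> sheaves U C J. \<forall>\<alpha>. nat_trans C P G \<alpha> \<longrightarrow>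
        (\<exists>!\<beta>. nat_trans C F G \<beta> \<and> nt_comp C P \<beta> \<eta> = \<alpha>))"

definition sheafification :: "'u set set \<Rightarrow> ('o, 'a) cat \<Rightarrow> ('o \<Rightarrow> 'a set set) \<Rightarrow>
    ('o, 'a, 'v) psh \<Rightarrow> ('o, 'a, 'u) psh \<times> ('o \<Rightarrow> 'v \<Rightarrow> 'u)" where
  "sheafification U C J P = (SOME (F, \<eta>). is_sheafification U C J P F \<eta>)"

definition sh_obj :: "'u set set \<Rightarrow> ('o, 'a) cat \<Rightarrow> ('o \<Rightarrow> 'a set set) \<Rightarrow>
    ('o, 'a, 'v) psh \<Rightarrow> ('o, 'a, 'u) psh" where
  "sh_obj U C J P = fst (sheafification U C J P)"

definition sh_unit :: "'u set set \<Rightarrow> ('o, 'a) cat \<Rightarrow> ('o \<Rightarrow> 'a set set) \<Rightarrow>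
    ('o, 'a, 'v) psh \<Rightarrow> 'o \<Rightarrow> 'v \<Rightarrow> 'u" where
  "sh_unit U C J P = snd (sheafification U C J P)"

definition sh_map :: "'u set set \<Rightarrow> ('o, 'a) cat \<Rightarrow> ('o \<Rightarrow> 'a set set) \<Rightarrow>
    ('o, 'a, 'v) psh \<Rightarrow> ('o, 'a, 'w) psh \<Rightarrow> ('o \<Rightarrow> 'v \<Rightarrow> 'w) \<Rightarrow> ('o, 'a, 'u) sh_arr" where
  "sh_map U C J P Q \<alpha> = (sh_obj U C J P,
     THE \<beta>. nat_trans C (sh_obj U C J P) (sh_obj U C J Q) \<beta> \<and>
            nt_comp C P \<beta> (sh_unit U C J P) = nt_comp C P (sh_unit U C J Q) \<alpha>,
     sh_obj U C J Q)"

definition yoneda_obj :: "('o, 'a) cat \<Rightarrow> 'o \<Rightarrow> ('o, 'a, 'a) psh" where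
  "yoneda_obj C c = \<lparr>
     val = (\<lambda>b \<in> Ob C. hom C b c),
     res = (\<lambda>f \<in> Arr C. \<lambda>g \<in> hom C (Cod C f) c. g \<cdot>\<^bsub>C\<^esub> f)\<rparr>"

definition yoneda_arr :: "('o, 'a) cat \<Rightarrow> 'a \<Rightarrow> 'o \<Rightarrow> 'a \<Rightarrow> 'a" where
  "yoneda_arr C h = (\<lambda>b \<in> Ob C. \<lambda>g \<in> hom C b (Dom C h). h \<cdot>\<^bsub>C\<^esub> g)"

text \<open>The functor \<open>l\<^sub>J\<close>.\<close>

definition l_functor :: "'u set set \<Rightarrow> ('o, 'a) cat \<Rightarrow> ('o \<Rightarrow> 'a set set) \<Rightarrow>
    ('o, 'a, ('o, 'a, 'u) psh, ('o, 'a, 'u) sh_arr) funct" where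
  "l_functor U C J = \<lparr>
     omap = (\<lambda>c. sh_obj U C J (yoneda_obj C c)),
     amap = (\<lambda>h. sh_map U C J (yoneda_obj C (Dom C h)) (yoneda_obj C (Cod C h)) (yoneda_arr C h))\<rparr>"


section \<open>Continuous comorphisms of sites\<close>

definition comorphism :: "('d, 'b) cat \<Rightarrow> ('d \<Rightarrow> 'b set set) \<Rightarrow> ('o, 'a) cat \<Rightarrow>
    ('o \<Rightarrow> 'a set set) \<Rightarrow> ('d, 'b, 'o, 'a) funct \<Rightarrow> bool" where
  "comorphism D K C J p \<longleftrightarrow> is_functor D C p \<and>
     (\<forall>d \<in> Ob D. \<forall>S \<in> J (omap p d). \<exists>R \<in> K d. amap p ` R \<subseteq> S)"

definition precomp_obj :: "('d, 'b) cat \<Rightarrow> ('d, 'b, 'o, 'a) funct \<Rightarrow>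
    ('o, 'a, 'u) psh \<Rightarrow> ('d, 'b, 'u) psh" where
  "precomp_obj D p F = \<lparr>
     val = (\<lambda>d \<in> Ob D. val F (omap p d)),
     res = (\<lambda>f \<in> Arr D. res F (amap p f))\<rparr>"

definition precomp :: "('d, 'b) cat \<Rightarrow> ('d, 'b, 'o, 'a) funct \<Rightarrow>
    (('o, 'a, 'u) psh, ('o, 'a, 'u) sh_arr, ('d, 'b, 'u) psh, ('d, 'b, 'u) sh_arr) funct" where
  "precomp D p = \<lparr>
     omap = precomp_obj D p,
     amap = (\<lambda>(F, \<alpha>, G).
       (precomp_obj D p F, \<lambda>d \<in> Ob D. \<alpha> (omap p d), precomp_obj D p G))\<rparr>"

definition continuous_comorphism :: "'u set set \<Rightarrow> ('d, 'b) cat \<Rightarrow> ('d \<Rightarrow> 'b set set) \<Rightarrow>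
    ('o, 'a) cat \<Rightarrow> ('o \<Rightarrow> 'a set set) \<Rightarrow> ('d, 'b, 'o, 'a) funct \<Rightarrow> bool" where
  "continuous_comorphism U D K C J p \<longleftrightarrow> comorphism D K C J p \<and>
     (\<forall>F \<in> sheaves U C J. precomp_obj D p F \<in> sheaves U D K)"

text \<open>For a continuous comorphism the presheaf \<open>E \<circ> p\<^sup>o\<^sup>p\<close> is already a sheaf, so the
  inverse image functor of the geometric morphism \<open>C\<^sub>p\<close> is precomposition with \<open>p\<close>. Its left
  adjoint \<open>Sh(p)\<^sup>*\<close>, also written \<open>(C\<^sub>p)\<^sub>!\<close>, is determined up to isomorphism only, hence a predicate.\<close>

definition is_C_shriek :: "'u set set \<Rightarrow> ('d, 'b) cat \<Rightarrow> ('d \<Rightarrow> 'b set set) \<Rightarrow>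
    ('o, 'a) cat \<Rightarrow> ('o \<Rightarrow> 'a set set) \<Rightarrow> ('d, 'b, 'o, 'a) funct \<Rightarrow>
    (('d, 'b, 'u) psh, ('d, 'b, 'u) sh_arr, ('o, 'a, 'u) psh, ('o, 'a, 'u) sh_arr) funct \<Rightarrow> bool" where
  "is_C_shriek U D K C J p S \<longleftrightarrow> left_adjoint (Sh U D K) (Sh U C J) S (precomp D p)"


section \<open>Factorizations and cofinality\<close>

text \<open>The object \<open>c\<close> is the domain of \<open>f : c \<rightarrow> p d\<close>.\<close>

definition fact_obs :: "('d, 'b) cat \<Rightarrow> ('o, 'a) cat \<Rightarrow> ('d, 'b, 'o, 'a) funct \<Rightarrow>
    'a \<Rightarrow> 'd \<Rightarrow> ('d \<times> 'a \<times> 'b) set" where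
  "fact_obs D C p f d = {(d', v', f'). d' \<in> Ob D \<and> v' \<in> hom C (omap p d') (Dom C f) \<and>
     f' \<in> hom D d' d \<and> f \<cdot>\<^bsub>C\<^esub> v' = amap p f'}"

definition fact_cat :: "('d, 'b) cat \<Rightarrow> ('o, 'a) cat \<Rightarrow> ('d, 'b, 'o, 'a) funct \<Rightarrow> 'a \<Rightarrow> 'd \<Rightarrow>
    ('d \<times> 'a \<times> 'b, ('d \<times> 'a \<times> 'b) \<times> 'b \<times> ('d \<times> 'a \<times> 'b)) cat" where
  "fact_cat D C p f d = \<lparr>
     Ob = fact_obs D C p f d,
     Arr = {((d1, v1, f1), u, (d2, v2, f2)).
              (d1, v1, f1) \<in> fact_obs D C p f d \<and> (d2, v2, f2) \<in> fact_obs D C p f d \<and>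
              u \<in> hom D d1 d2 \<and> v2 \<cdot>\<^bsub>C\<^esub> amap p u = v1 \<and> f2 \<cdot>\<^bsub>D\<^esub> u = f1},
     Dom = (\<lambda>(x, u, y). x),
     Cod = (\<lambda>(x, u, y). y),
     Ide = (\<lambda>(d', v', f'). ((d', v', f'), Ide D d', (d', v', f'))),
     Comp = (\<lambda>(y, u', z) (x, u, y'). (x, u' \<cdot>\<^bsub>D\<^esub> u, z))\<rparr>"

definition fact_proj :: "('d, 'b, 'o, 'a) funct \<Rightarrow>
    ('d \<times> 'a \<times> 'b, ('d \<times> 'a \<times> 'b) \<times> 'b \<times> ('d \<times> 'a \<times> 'b),
     'o \<times> 'a, ('o \<times> 'a) \<times> 'a \<times> ('o \<times> 'a)) funct" where
  "fact_proj p = \<lparr>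
     omap = (\<lambda>(d', v', f'). (omap p d', v')),
     amap = (\<lambda>((d1, v1, f1), u, (d2, v2, f2)). ((omap p d1, v1), amap p u, (omap p d2, v2)))\<rparr>"

text \<open>A functor \<open>G : I \<rightarrow> C/c\<close> is \<open>J\<close>-cofinal when \<open>l\<^sub>J \<circ> \<pi>\<^sub>c \<circ> G\<close> has a colimit and
  the canonical arrow \<open>m\<close> from it to \<open>l\<^sub>J c\<close> is an isomorphism; \<open>m\<close> is
  determined by its composites with the colimit injections, which are the images under \<open>l\<^sub>J\<close>
  of the structure arrows \<open>snd (omap G i)\<close> to \<open>c\<close>.\<close>

definition J_cofinal :: "'u set set \<Rightarrow> ('o, 'a) cat \<Rightarrow> ('o \<Rightarrow> 'a set set) \<Rightarrow> 'o \<Rightarrow>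
    ('i, 'j) cat \<Rightarrow> ('i, 'j, 'o \<times> 'a, ('o \<times> 'a) \<times> 'a \<times> ('o \<times> 'a)) funct \<Rightarrow> bool" where
  "J_cofinal U C J c I G \<longleftrightarrow> is_functor I (slice_cat C c) G \<and>
     (\<exists>L \<iota> m.
        is_colimit I (Sh U C J)
          (functor_comp (l_functor U C J) (functor_comp slice_proj G)) L \<iota> \<and>
        m \<in> hom (Sh U C J) L (omap (l_functor U C J) c) \<and>
        (\<forall>i \<in> Ob I. m \<cdot>\<^bsub>Sh U C J\<^esub> \<iota> i = amap (l_functor U C J) (snd (omap G i))) \<and>
        is_iso (Sh U C J) m)"

end

theory Submission
  imports Defs
begin

text \<open>Write \<open>R\<close> for precomposition with \<open>p\<close>, \<open>S\<close> for its left adjoint and \<open>\<eta>\<close> for the unit. By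
  adjointness an arrow \<open>A \<rightarrow> P\<close> is cartesian for \<open>S\<close> exactly when the naturality square of \<open>\<eta>\<close> at it
  is a pullback. A cartesian lift of \<open>u : E \<rightarrow> S P\<close> can therefore only be the projection to \<open>P\<close> of
  the fibre product of \<open>P\<close> and \<open>R E\<close> over \<open>R (S P)\<close>, and it is one if and only if the other
  projection, transposed to an arrow from \<open>S\<close> of the fibre product to \<open>E\<close>, is an isomorphism. Tested
  against the sheaves \<open>F\<close> on \<open>C\<close>, this says that every natural map from the fibre product to \<open>R F\<close>
  comes from a unique map \<open>E \<rightarrow> F\<close>. This condition is called \<open>descent\<close>; the lemmas
  \<open>descent_of_fibration\<close> and \<open>fibration_of_descent\<close> identify it with the fibration property.

  Cofinality is tested in the same way. An arrow from \<open>l\<^sub>J b\<close> to \<open>F\<close> is an element of \<open>F b\<close>, so the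
  functor of the factorizations of \<open>f : c \<rightarrow> p d\<close> is \<open>J\<close>-cofinal if and only if every family of
  elements of \<open>F\<close>, one at \<open>p d'\<close> for each factorization \<open>(d', v', f')\<close> and compatible with the arrows
  between these, is the family of restrictions of a unique element of \<open>F c\<close> (\<open>J_cofinal_iff\<close>,
  \<open>unique_amalgamation\<close>).

  Take first \<open>P = l\<^sub>K d\<close> and \<open>E = l\<^sub>J c\<close>. Then \<open>S P\<close> is \<open>l\<^sub>J (p d)\<close>, and \<open>f\<close> gives an arrow
  \<open>u : E \<rightarrow> S P\<close>. The maps from the representable presheaves to their sheafifications are locally
  injective and locally surjective, and coverings lift along the comorphism \<open>p\<close>, so locally an element
  of the fibre product is a factorization of \<open>f\<close>. Descent for this \<open>u\<close> is unique amalgamation for \<open>f\<close>.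

  Conversely let \<open>P\<close>, \<open>E\<close> and \<open>u\<close> be arbitrary. The sheaf \<open>S P\<close> is the sheafification of the presheaf
  of triples \<open>(d, x, f)\<close> with \<open>x\<close> in \<open>P d\<close> and \<open>f : c \<rightarrow> p d\<close>, where \<open>(d, P(k) x, f)\<close> and
  \<open>(d', x, p(k) f)\<close> are identified for \<open>k : d \<rightarrow> d'\<close> (\<open>free_presentation\<close>). So an element \<open>e\<close> of \<open>E\<close>
  lies locally over such a triple, unique amalgamation along \<open>f\<close> turns a map out of the fibre
  product into a value of \<open>F\<close> at \<open>e\<close>, the identifications do not change this value, and the local
  values glue. This amounts to the stability of colimits under pullback. The explicit presentation
  replaces the usual argument by exponentials, which need not exist, since \<open>U\<close> need not be closed
  under powers with exponents in \<open>U\<close>.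

  The sheaves have their values in \<open>U\<close>. A sheafification is first constructed with sets of pairs as
  values and then coded in \<open>U\<close>, which is possible because a section is determined by its local
  preimages along the arrows from a small set of generators (\<open>sheaf_usmall\<close>).\<close>

section \<open>Sets of bounded size\<close>

text \<open>The condition \<open>small\<close> bounds a set as an exponent. The following one bounds it as a set of
  values: it can be replaced by a member of the universe.\<close>

definition usmall :: "'u set set \<Rightarrow> 'i set \<Rightarrow> bool" where
  "usmall U A \<longleftrightarrow> (\<exists>Z \<in> U. A \<lesssim> Z)"

lemma usmall_lepoll: "usmall U B \<Longrightarrow> A \<lesssim> B \<Longrightarrow> usmall U A"
  unfolding usmall_def using lepoll_trans by blast

lemma usmall_subset: "usmall U B \<Longrightarrow> A \<subseteq> B \<Longrightarrow> usmall U A"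
  using usmall_lepoll subset_imp_lepoll by blast

lemma usmall_image:
  fixes U :: "'u set set" and g :: "'i \<Rightarrow> 'j"
  shows "usmall U A \<Longrightarrow> usmall U (g ` A)"
  using usmall_lepoll image_lepoll by blast

lemma usmall_member: "Z \<in> U \<Longrightarrow> usmall U Z"
  unfolding usmall_def by blast

context
  fixes U :: "'u set set"
  assumes univ: "set_universe U"
begin

lemma universe_lepoll: "X \<in> U \<Longrightarrow> Y \<lesssim> X \<Longrightarrow> Y \<in> U"
  using univ unfolding set_universe_def by blast

lemma universe_UN: "X \<in> U \<Longrightarrow> (\<And>x. x \<in> X \<Longrightarrow> F x \<in> U) \<Longrightarrow> (\<Union>x \<in> X. F x) \<in> U"
  using univ unfolding set_universe_def by blast

lemma universe_UN_usmall:
  assumes I: "usmall U I" and F: "\<And>i. i \<in> I \<Longrightarrow> F i \<in> U"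
  shows "(\<Union>i \<in> I. F i) \<in> U"
proof -
  obtain Z e where Z: "Z \<in> U" "inj_on e I" "e ` I \<subseteq> Z"
    using I unfolding usmall_def lepoll_def by blast
  have "e ` I \<in> U" using universe_lepoll[OF Z(1)] Z(3) subset_imp_lepoll by blast
  then have "(\<Union>x \<in> e ` I. F (the_inv_into I e x)) \<in> U"
    by (rule universe_UN) (auto simp: the_inv_into_f_f[OF Z(2)] F)
  then show ?thesis by (simp add: the_inv_into_f_f[OF Z(2)])
qed

lemma universe_infinite_superset:
  assumes "X \<in> U"
  obtains W where "W \<in> U" "infinite W" "X \<subseteq> W"
proof -
  obtain I where I: "I \<in> U" "infinite I" using univ unfolding set_universe_def by blast
  obtain a b where ab: "a \<in> I" "b \<in> I" "a \<noteq> b"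
    using I(2) by (metis finite.simps finite_subset insertI1 subsetI)
  have "{a, b} \<in> U" using universe_lepoll[OF I(1)] ab subset_imp_lepoll[of "{a,b}" I] by blast
  then have "(\<Union>x \<in> {a, b}. if x = a then X else I) \<in> U"
    using I(1) assms by (intro universe_UN) auto
  then have "X \<union> I \<in> U" using ab by (auto simp: Un_commute)
  then show ?thesis using that I(2) by blast
qed

text \<open>Base and fibres embed into one infinite member, which absorbs its square.\<close>

lemma usmall_Sigma:
  assumes I: "usmall U I" and F: "\<And>i. i \<in> I \<Longrightarrow> usmall U (F i)"
  shows "usmall U (Sigma I F)"
proof -
  obtain X where X: "X \<in> U" "I \<lesssim> X" using I unfolding usmall_def by blast
  obtain Z where Z: "\<And>i. i \<in> I \<Longrightarrow> Z i \<in> U \<and> F i \<lesssim> Z i" using F unfolding usmall_def by metis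
  have V: "(\<Union>i \<in> I. Z i) \<in> U" (is "?V \<in> U") by (rule universe_UN_usmall[OF I]) (use Z in blast)
  obtain V' where V': "V' \<in> U" "infinite V'" "?V \<subseteq> V'"
    using universe_infinite_superset[OF V] by blast
  obtain X' where X': "X' \<in> U" "infinite X'" "X \<subseteq> X'"
    using universe_infinite_superset[OF X(1)] by blast
  have "X' \<lesssim> V' \<or> V' \<lesssim> X'"
    unfolding lepoll_def card_of_ordLeq by (rule ordLeq_total) (rule card_of_Well_order)+
  then obtain W where W: "W \<in> U" "infinite W" "X' \<lesssim> W" "V' \<lesssim> W"
    using V' X' lepoll_refl by metis
  have "Sigma I F \<lesssim> X' \<times> V'"
  proof -
    obtain e where e: "inj_on e I" "e ` I \<subseteq> X'"
      using X X' unfolding lepoll_def by (meson order_trans)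
    have "\<And>i. i \<in> I \<Longrightarrow> \<exists>h. inj_on h (F i) \<and> h ` F i \<subseteq> V'"
      using Z V' unfolding lepoll_def by (meson UN_subset_iff order_trans)
    then obtain h where h: "\<And>i. i \<in> I \<Longrightarrow> inj_on (h i) (F i) \<and> h i ` F i \<subseteq> V'" by metis
    have "inj_on (\<lambda>(i, x). (e i, h i x)) (Sigma I F)"
      using e h by (auto simp: inj_on_def)
    moreover have "(\<lambda>(i, x). (e i, h i x)) ` Sigma I F \<subseteq> X' \<times> V'" using e h by fastforce
    ultimately show ?thesis unfolding lepoll_def by blast
  qed
  also have "\<dots> \<lesssim> W \<times> W" by (rule times_lepoll_mono) (use W in auto)
  also have "\<dots> \<approx> W" using card_of_Times_same_infinite[OF W(2)] eqpoll_iff_card_of_ordIso by blast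
  finally show ?thesis using W(1) unfolding usmall_def by blast
qed

lemma usmall_Times: "usmall U A \<Longrightarrow> usmall U B \<Longrightarrow> usmall U (A \<times> B)"
  by (rule usmall_Sigma)

lemma usmall_UN:
  assumes "usmall U I" "\<And>i. i \<in> I \<Longrightarrow> usmall U (F i)"
  shows "usmall U (\<Union>i \<in> I. F i)"
proof -
  have "usmall U (snd ` Sigma I F)" by (rule usmall_image) (rule usmall_Sigma[OF assms])
  moreover have "snd ` Sigma I F = (\<Union>i \<in> I. F i)" by force
  ultimately show ?thesis by simp
qed

lemma usmall_Some: 
  assumes "usmall U A" shows "usmall U (insert None (Some ` A))"
proof -
  obtain X where X: "X \<in> U" "A \<lesssim> X" using assms unfolding usmall_def by blast
  obtain W where W: "W \<in> U" "infinite W" "X \<subseteq> W" using universe_infinite_superset[OF X(1)] by blast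
  have "Some ` A \<lesssim> A" by (rule image_lepoll)
  also have "A \<lesssim> X" by fact
  also have "X \<lesssim> W" using W subset_imp_lepoll by blast
  finally have "Some ` A \<lesssim> W" .
  have "insert None (Some ` A) \<lesssim> W"
  proof (cases "finite A")
    case True then show ?thesis using W(2) by (simp add: finite_lepoll_infinite)
  next
    case False
    then have "infinite (Some ` A)" by (simp add: finite_image_iff)
    then show ?thesis
      using lepoll_trans1[OF infinite_insert_eqpoll \<open>Some ` A \<lesssim> W\<close>] by blast
  qed
  then show ?thesis using W(1) unfolding usmall_def by blast
qed

text \<open>The characteristic functions of the points embed \<open>A\<close> into a power with exponent \<open>A\<close>.\<close>

lemma small_imp_usmall:
  assumes "small U A" shows "usmall U A"
proof -
  obtain I where I: "I \<in> U" "infinite I" using univ unfolding set_universe_def by blast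
  obtain a b where ab: "a \<in> I" "b \<in> I" "a \<noteq> b"
    using I(2) by (metis finite.simps finite_subset insertI1 subsetI)
  obtain Z where Z: "Z \<in> U" "(A \<rightarrow>\<^sub>E I) \<lesssim> Z" using assms I(1) unfolding small_def by blast
  have "inj_on (\<lambda>x. \<lambda>y \<in> A. if y = x then a else b) A"
  proof (rule inj_onI)
    fix x x' assume x: "x \<in> A" and eq: "(\<lambda>y \<in> A. if y = x then a else b) = (\<lambda>y \<in> A. if y = x' then a else b)"
    show "x = x'" using fun_cong[OF eq, of x] x ab(3) by (cases "x = x'") simp_all
  qed
  moreover have "(\<lambda>x. \<lambda>y \<in> A. if y = x then a else b) ` A \<subseteq> (A \<rightarrow>\<^sub>E I)" using ab by auto
  ultimately have "A \<lesssim> (A \<rightarrow>\<^sub>E I)" unfolding lepoll_def by blast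
  then show ?thesis using Z lepoll_trans unfolding usmall_def by blast
qed

lemma usmall_funcset:
  assumes "small U A" "usmall U X"
  shows "usmall U (A \<rightarrow>\<^sub>E X)"
proof -
  obtain Z where Z: "Z \<in> U" "X \<lesssim> Z" using assms unfolding usmall_def by blast
  obtain Z' where "Z' \<in> U" "(A \<rightarrow>\<^sub>E Z) \<lesssim> Z'" using assms(1) Z(1) unfolding small_def by blast
  moreover have "(A \<rightarrow>\<^sub>E X) \<lesssim> (A \<rightarrow>\<^sub>E Z)" by (rule lepoll_funcset_right[OF Z(2)])
  ultimately show ?thesis using lepoll_trans unfolding usmall_def by blast
qed

text \<open>A function on the union is determined by the \<open>B\<close>-indexed family of its restrictions, and
  these all lie in one bounded set.\<close>

lemma small_UN:
  assumes B: "small U B" and H: "\<And>b. b \<in> B \<Longrightarrow> small U (H b)"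
  shows "small U (\<Union>b \<in> B. H b)"
  unfolding small_def
proof
  fix X assume X: "X \<in> U"
  let ?A = "\<Union>b \<in> B. H b"
  let ?V = "\<Union>b \<in> B. (H b \<rightarrow>\<^sub>E X)"
  have V: "usmall U ?V"
    by (rule usmall_UN) (use small_imp_usmall[OF B] usmall_funcset[OF H usmall_member[OF X]] in auto)
  have "inj_on (\<lambda>t. \<lambda>b \<in> B. restrict t (H b)) (?A \<rightarrow>\<^sub>E X)"
  proof (rule inj_onI)
    fix t t' assume t: "t \<in> ?A \<rightarrow>\<^sub>E X" "t' \<in> ?A \<rightarrow>\<^sub>E X"
      and eq: "(\<lambda>b \<in> B. restrict t (H b)) = (\<lambda>b \<in> B. restrict t' (H b))"
    show "t = t'"
    proof (rule PiE_ext[OF t])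
      fix x assume "x \<in> ?A"
      then obtain b where b: "b \<in> B" "x \<in> H b" by blast
      have "restrict t (H b) = restrict t' (H b)" using fun_cong[OF eq, of b] b by simp
      from fun_cong[OF this, of x] show "t x = t' x" using b by simp
    qed
  qed
  moreover have "(\<lambda>t. \<lambda>b \<in> B. restrict t (H b)) ` (?A \<rightarrow>\<^sub>E X) \<subseteq> (B \<rightarrow>\<^sub>E ?V)"
  proof (rule image_subsetI)
    fix t assume t: "t \<in> ?A \<rightarrow>\<^sub>E X"
    have "restrict t (H b) \<in> H b \<rightarrow>\<^sub>E X" if "b \<in> B" for b
      using t that by (force intro: restrict_PiE)
    then show "(\<lambda>b \<in> B. restrict t (H b)) \<in> (B \<rightarrow>\<^sub>E ?V)" by (simp add: PiE_iff) blast
  qed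
  ultimately have "(?A \<rightarrow>\<^sub>E X) \<lesssim> (B \<rightarrow>\<^sub>E ?V)" unfolding lepoll_def by blast
  then show "\<exists>Z \<in> U. (?A \<rightarrow>\<^sub>E X) \<lesssim> Z"
    using usmall_lepoll[OF usmall_funcset[OF B V]] unfolding usmall_def by blast
qed

lemma usmall_code:
  assumes "usmall U A"
  obtains e where "inj_on e A" "e ` A \<in> U"
proof -
  obtain Z e where Z: "Z \<in> U" "inj_on e A" "e ` A \<subseteq> Z"
    using assms unfolding usmall_def lepoll_def by blast
  then show ?thesis using universe_lepoll[OF Z(1)] subset_imp_lepoll that by blast
qed

end

section \<open>Local truth on a site\<close>

text \<open>The arrows satisfying \<open>Q\<close> need not form a sieve: it suffices that they contain a covering one.
  In this form the axioms of a topology become rules for a modality, and covering sieves disappear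
  from most arguments.\<close>

definition locally :: "('o, 'a) cat \<Rightarrow> ('o \<Rightarrow> 'a set set) \<Rightarrow> 'o \<Rightarrow> ('a \<Rightarrow> bool) \<Rightarrow> bool" where
  "locally C J c Q \<longleftrightarrow> (\<exists>R \<in> J c. \<forall>f \<in> R. Q f)"

text \<open>Naturality without the extensionality that \<open>nat_trans\<close> imposes, so that composites are plain
  lambda terms; \<open>ext_nat\<close> turns such a map into a natural transformation.\<close>

definition natural :: "('o, 'a) cat \<Rightarrow> ('o, 'a, 'v) psh \<Rightarrow> ('o, 'a, 'w) psh \<Rightarrow>
    ('o \<Rightarrow> 'v \<Rightarrow> 'w) \<Rightarrow> bool" where
  "natural C P Q \<alpha> \<longleftrightarrow>
     (\<forall>c \<in> Ob C. \<forall>x \<in> val P c. \<alpha> c x \<in> val Q c) \<and>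
     (\<forall>f \<in> Arr C. \<forall>x \<in> val P (Cod C f). \<alpha> (Dom C f) (res P f x) = res Q f (\<alpha> (Cod C f) x))"

definition ext_nat :: "('o, 'a) cat \<Rightarrow> ('o, 'a, 'v) psh \<Rightarrow> ('o \<Rightarrow> 'v \<Rightarrow> 'w) \<Rightarrow> 'o \<Rightarrow> 'v \<Rightarrow> 'w" where
  "ext_nat C P \<alpha> = (\<lambda>c \<in> Ob C. \<lambda>x \<in> val P c. \<alpha> c x)"

text \<open>These are the maps that sheafification turns into isomorphisms.\<close>

definition locally_bijective :: "('o, 'a) cat \<Rightarrow> ('o \<Rightarrow> 'a set set) \<Rightarrow>
    ('o, 'a, 'v) psh \<Rightarrow> ('o, 'a, 'w) psh \<Rightarrow> ('o \<Rightarrow> 'v \<Rightarrow> 'w) \<Rightarrow> bool" where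
  "locally_bijective C J P F \<eta> \<longleftrightarrow> natural C P F \<eta> \<and>
     (\<forall>c \<in> Ob C. \<forall>x \<in> val P c. \<forall>y \<in> val P c. \<eta> c x = \<eta> c y \<longrightarrow>
        locally C J c (\<lambda>f. res P f x = res P f y)) \<and>
     (\<forall>c \<in> Ob C. \<forall>s \<in> val F c. locally C J c (\<lambda>f. \<exists>x \<in> val P (Dom C f). res F f s = \<eta> (Dom C f) x))"

lemma naturalI:
  assumes "\<And>c x. c \<in> Ob C \<Longrightarrow> x \<in> val P c \<Longrightarrow> \<alpha> c x \<in> val Q c"
    and "\<And>f x. f \<in> Arr C \<Longrightarrow> x \<in> val P (Cod C f) \<Longrightarrow> \<alpha> (Dom C f) (res P f x) = res Q f (\<alpha> (Cod C f) x)"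
  shows "natural C P Q \<alpha>"
  using assms unfolding natural_def by blast

lemma natural_val: "natural C P Q \<alpha> \<Longrightarrow> c \<in> Ob C \<Longrightarrow> x \<in> val P c \<Longrightarrow> \<alpha> c x \<in> val Q c"
  unfolding natural_def by blast

lemma natural_res: "natural C P Q \<alpha> \<Longrightarrow> f \<in> Arr C \<Longrightarrow> x \<in> val P (Cod C f) \<Longrightarrow>
    \<alpha> (Dom C f) (res P f x) = res Q f (\<alpha> (Cod C f) x)"
  unfolding natural_def by blast

lemma nat_trans_natural: "nat_trans C P Q \<alpha> \<Longrightarrow> natural C P Q \<alpha>"
  unfolding nat_trans_def natural_def by (auto dest!: PiE_mem)

lemma nat_trans_ext:
  assumes "nat_trans C P Q \<alpha>" "nat_trans C P Q' \<beta>"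
    and "\<And>c x. c \<in> Ob C \<Longrightarrow> x \<in> val P c \<Longrightarrow> \<alpha> c x = \<beta> c x"
  shows "\<alpha> = \<beta>"
proof (rule extensionalityI)
  have 1: "\<alpha> \<in> (\<Pi>\<^sub>E c \<in> Ob C. val P c \<rightarrow>\<^sub>E val Q c)" using assms(1) unfolding nat_trans_def by blast
  have 2: "\<beta> \<in> (\<Pi>\<^sub>E c \<in> Ob C. val P c \<rightarrow>\<^sub>E val Q' c)" using assms(2) unfolding nat_trans_def by blast
  show "\<alpha> \<in> extensional (Ob C)" "\<beta> \<in> extensional (Ob C)" using 1 2 unfolding PiE_def by blast+
  fix c assume c: "c \<in> Ob C"
  show "\<alpha> c = \<beta> c"
  proof (rule extensionalityI)
    show "\<alpha> c \<in> extensional (val P c)" "\<beta> c \<in> extensional (val P c)"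
      using PiE_mem[OF 1 c] PiE_mem[OF 2 c] unfolding PiE_def by blast+
    fix x assume "x \<in> val P c" then show "\<alpha> c x = \<beta> c x" using assms(3) c by blast
  qed
qed

lemma ext_nat_apply [simp]: "c \<in> Ob C \<Longrightarrow> x \<in> val P c \<Longrightarrow> ext_nat C P \<alpha> c x = \<alpha> c x"
  unfolding ext_nat_def by simp

lemma nt_comp_apply [simp]: "c \<in> Ob C \<Longrightarrow> x \<in> val P c \<Longrightarrow> nt_comp C P \<beta> \<alpha> c x = \<beta> c (\<alpha> c x)"
  unfolding nt_comp_def by simp

lemma nt_comp_ext_nat: "nt_comp C P \<beta> \<alpha> = ext_nat C P (\<lambda>c x. \<beta> c (\<alpha> c x))"
  unfolding ext_nat_def nt_comp_def ..

lemma matching_familyI: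
  assumes "\<And>f. f \<in> R \<Longrightarrow> x f \<in> val P (Dom C f)"
    and "\<And>f g. f \<in> R \<Longrightarrow> g \<in> Arr C \<Longrightarrow> Cod C g = Dom C f \<Longrightarrow> res P g (x f) = x (f \<cdot>\<^bsub>C\<^esub> g)"
  shows "matching_family C P R x"
  using assms unfolding matching_family_def by blast

locale plain_cat =
  fixes C :: "('o, 'a) cat"
  assumes cat: "category C"
begin

lemma Dom_Ob [simp]: "f \<in> Arr C \<Longrightarrow> Dom C f \<in> Ob C"
  and Cod_Ob [simp]: "f \<in> Arr C \<Longrightarrow> Cod C f \<in> Ob C"
  using category.Dom_in[OF cat] category.Cod_in[OF cat] by blast+

lemma Ide_Arr [simp]: "c \<in> Ob C \<Longrightarrow> Ide C c \<in> Arr C"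
  and Dom_Ide [simp]: "c \<in> Ob C \<Longrightarrow> Dom C (Ide C c) = c"
  and Cod_Ide [simp]: "c \<in> Ob C \<Longrightarrow> Cod C (Ide C c) = c"
  using category.Ide_in[OF cat] unfolding hom_def by blast+

lemma comp_Arr [simp]: "f \<in> Arr C \<Longrightarrow> g \<in> Arr C \<Longrightarrow> Cod C g = Dom C f \<Longrightarrow> f \<cdot>\<^bsub>C\<^esub> g \<in> Arr C"
  and Dom_comp [simp]: "f \<in> Arr C \<Longrightarrow> g \<in> Arr C \<Longrightarrow> Cod C g = Dom C f \<Longrightarrow> Dom C (f \<cdot>\<^bsub>C\<^esub> g) = Dom C g"
  and Cod_comp [simp]: "f \<in> Arr C \<Longrightarrow> g \<in> Arr C \<Longrightarrow> Cod C g = Dom C f \<Longrightarrow> Cod C (f \<cdot>\<^bsub>C\<^esub> g) = Cod C f"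
  using category.Comp_in[OF cat, of g "Dom C g" "Dom C f" f "Cod C f"] unfolding hom_def by auto

lemma comp_Ide [simp]: "f \<in> Arr C \<Longrightarrow> c = Dom C f \<Longrightarrow> f \<cdot>\<^bsub>C\<^esub> Ide C c = f"
  and Ide_comp [simp]: "f \<in> Arr C \<Longrightarrow> c = Cod C f \<Longrightarrow> Ide C c \<cdot>\<^bsub>C\<^esub> f = f"
  using category.Ide_right[OF cat, of f "Dom C f" "Cod C f"]
    category.Ide_left[OF cat, of f "Dom C f" "Cod C f"] unfolding hom_def by auto

lemma comp_assoc [simp]: "f \<in> Arr C \<Longrightarrow> g \<in> Arr C \<Longrightarrow> h \<in> Arr C \<Longrightarrow> Cod C g = Dom C f \<Longrightarrow>
    Cod C h = Dom C g \<Longrightarrow> (f \<cdot>\<^bsub>C\<^esub> g) \<cdot>\<^bsub>C\<^esub> h = f \<cdot>\<^bsub>C\<^esub> (g \<cdot>\<^bsub>C\<^esub> h)"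
  using category.Comp_assoc[OF cat, of h "Dom C h" "Cod C h" g "Cod C g" f "Cod C f"]
  unfolding hom_def by auto

lemma natural_ext: "natural C P Q \<alpha> \<Longrightarrow> (\<And>f x. f \<in> Arr C \<Longrightarrow> x \<in> val P (Cod C f) \<Longrightarrow> res P f x \<in> val P (Dom C f)) 
   \<Longrightarrow> nat_trans C P Q (ext_nat C P \<alpha>)"
  unfolding nat_trans_def natural_def ext_nat_def by auto

lemma natural_o: "natural C P Q \<alpha> \<Longrightarrow> natural C Q R \<beta> \<Longrightarrow> natural C P R (\<lambda>c x. \<beta> c (\<alpha> c x))"
  unfolding natural_def using Cod_Ob by metis

context
  fixes P :: "('o, 'a, 'v) psh"
  assumes P: "presheaf C P"
begin

lemma res_val [simp]: "f \<in> Arr C \<Longrightarrow> x \<in> val P (Cod C f) \<Longrightarrow> c = Dom C f \<Longrightarrow> res P f x \<in> val P c"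
  using P unfolding presheaf_def by (auto dest!: PiE_mem)

lemma res_Ide [simp]: "c \<in> Ob C \<Longrightarrow> x \<in> val P c \<Longrightarrow> res P (Ide C c) x = x"
  using P unfolding presheaf_def by blast

lemma res_comp: "f \<in> Arr C \<Longrightarrow> g \<in> Arr C \<Longrightarrow> Cod C g = Dom C f \<Longrightarrow> x \<in> val P (Cod C f) \<Longrightarrow>
    res P (f \<cdot>\<^bsub>C\<^esub> g) x = res P g (res P f x)"
  using P unfolding presheaf_def by blast

lemma natural_nat_trans: "natural C P Q \<alpha> \<Longrightarrow> nat_trans C P Q (ext_nat C P \<alpha>)"
  by (rule natural_ext) simp_all

end

lemma presheaf_mk:
  assumes "\<And>f x. f \<in> Arr C \<Longrightarrow> x \<in> V (Cod C f) \<Longrightarrow> r f x \<in> V (Dom C f)"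
    and "\<And>c x. c \<in> Ob C \<Longrightarrow> x \<in> V c \<Longrightarrow> r (Ide C c) x = x"
    and "\<And>f g x. f \<in> Arr C \<Longrightarrow> g \<in> Arr C \<Longrightarrow> Cod C g = Dom C f \<Longrightarrow> x \<in> V (Cod C f) \<Longrightarrow>
       r (f \<cdot>\<^bsub>C\<^esub> g) x = r g (r f x)"
  shows "presheaf C \<lparr>val = \<lambda>c \<in> Ob C. V c, res = \<lambda>f \<in> Arr C. \<lambda>x \<in> V (Cod C f). r f x\<rparr>"
  unfolding presheaf_def using assms by auto

end

locale topology = plain_cat C for C :: "('o, 'a) cat" +
  fixes J :: "'o \<Rightarrow> 'a set set"
  assumes top: "grothendieck_topology C J"
begin

lemma J_sieve: "c \<in> Ob C \<Longrightarrow> R \<in> J c \<Longrightarrow> sieve C c R"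
  using top unfolding grothendieck_topology_def by blast

lemma J_Arr: "c \<in> Ob C \<Longrightarrow> R \<in> J c \<Longrightarrow> f \<in> R \<Longrightarrow> f \<in> Arr C \<and> Cod C f = c"
  using J_sieve unfolding sieve_def by blast

lemma J_closed: "c \<in> Ob C \<Longrightarrow> R \<in> J c \<Longrightarrow> f \<in> R \<Longrightarrow> g \<in> Arr C \<Longrightarrow> Cod C g = Dom C f \<Longrightarrow>
    f \<cdot>\<^bsub>C\<^esub> g \<in> R"
  using J_sieve unfolding sieve_def by blast

lemma J_max: "c \<in> Ob C \<Longrightarrow> {f \<in> Arr C. Cod C f = c} \<in> J c"
  using top unfolding grothendieck_topology_def by blast

lemma J_pull: "g \<in> Arr C \<Longrightarrow> R \<in> J (Cod C g) \<Longrightarrow> pullback_sieve C g R \<in> J (Dom C g)"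
  using top unfolding grothendieck_topology_def by blast

lemma J_trans: "c \<in> Ob C \<Longrightarrow> S \<in> J c \<Longrightarrow> sieve C c R \<Longrightarrow>
    (\<And>f. f \<in> S \<Longrightarrow> pullback_sieve C f R \<in> J (Dom C f)) \<Longrightarrow> R \<in> J c"
  using top unfolding grothendieck_topology_def by blast

lemma sieve_pullback:
  assumes S: "sieve C c S" and f: "f \<in> Arr C" "Cod C f = c"
  shows "sieve C (Dom C f) (pullback_sieve C f S)"
  unfolding sieve_def
proof (intro conjI subsetI ballI impI)
  fix g h assume g: "g \<in> pullback_sieve C f S" and h: "h \<in> Arr C" "Cod C h = Dom C g"
  have g': "g \<in> Arr C" "Cod C g = Dom C f" "f \<cdot>\<^bsub>C\<^esub> g \<in> S" using g unfolding pullback_sieve_def by auto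
  have "(f \<cdot>\<^bsub>C\<^esub> g) \<cdot>\<^bsub>C\<^esub> h \<in> S"
    by (rule bspec[OF bspec[OF conjunct2[OF S[unfolded sieve_def]] g'(3)], rule_format])
      (use g' h f in simp_all)
  then show "g \<cdot>\<^bsub>C\<^esub> h \<in> pullback_sieve C f S" using g' h f unfolding pullback_sieve_def by simp
qed (simp add: pullback_sieve_def)

lemma J_mono:
  assumes "c \<in> Ob C" "S \<in> J c" "S \<subseteq> R" "sieve C c R"
  shows "R \<in> J c"
proof (rule J_trans[OF assms(1,2,4)])
  fix f assume f: "f \<in> S"
  have fA: "f \<in> Arr C" "Cod C f = c" using J_Arr[OF assms(1,2) f] by auto
  have "pullback_sieve C f R = {g \<in> Arr C. Cod C g = Dom C f}"
    using f assms J_closed[OF assms(1,2) f] unfolding pullback_sieve_def by blast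
  then show "pullback_sieve C f R \<in> J (Dom C f)" using J_max fA by simp
qed

lemma locally_always:
  "c \<in> Ob C \<Longrightarrow> (\<And>f. f \<in> Arr C \<Longrightarrow> Cod C f = c \<Longrightarrow> Q f) \<Longrightarrow> locally C J c Q"
  unfolding locally_def by (rule bexI[OF _ J_max]) simp_all

text \<open>The composites \<open>f \<cdot> g\<close> of the two layers of covering arrows form a sieve, which covers by the
  local character of the topology.\<close>

lemma locally_trans:
  assumes c: "c \<in> Ob C" and Q: "locally C J c Q"
    and step: "\<And>f. f \<in> Arr C \<Longrightarrow> Cod C f = c \<Longrightarrow> Q f \<Longrightarrow> locally C J (Dom C f) (\<lambda>g. Q' (f \<cdot>\<^bsub>C\<^esub> g))"
  shows "locally C J c Q'"
proof -
  obtain R where R: "R \<in> J c" "\<And>f. f \<in> R \<Longrightarrow> Q f" using Q unfolding locally_def by blast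
  have RA: "\<And>f. f \<in> R \<Longrightarrow> f \<in> Arr C \<and> Cod C f = c" using J_Arr[OF c R(1)] .
  have "\<forall>f \<in> R. \<exists>T \<in> J (Dom C f). \<forall>g \<in> T. Q' (f \<cdot>\<^bsub>C\<^esub> g)"
    using step R RA unfolding locally_def by blast
  then obtain T where T: "\<And>f. f \<in> R \<Longrightarrow> T f \<in> J (Dom C f)"
    "\<And>f g. f \<in> R \<Longrightarrow> g \<in> T f \<Longrightarrow> Q' (f \<cdot>\<^bsub>C\<^esub> g)" by metis
  have TA: "\<And>f g. f \<in> R \<Longrightarrow> g \<in> T f \<Longrightarrow> g \<in> Arr C \<and> Cod C g = Dom C f"
    using J_Arr T(1) RA Dom_Ob by blast
  let ?S = "{f \<cdot>\<^bsub>C\<^esub> g | f g. f \<in> R \<and> g \<in> T f}"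
  have S: "sieve C c ?S" unfolding sieve_def
  proof (intro conjI ballI impI subsetI)
    fix x assume "x \<in> ?S" then show "x \<in> {f \<in> Arr C. Cod C f = c}" using RA TA by auto
  next
    fix x h assume x: "x \<in> ?S" and h: "h \<in> Arr C" "Cod C h = Dom C x"
    then obtain f g where fg: "f \<in> R" "g \<in> T f" "x = f \<cdot>\<^bsub>C\<^esub> g" by blast
    have "g \<cdot>\<^bsub>C\<^esub> h \<in> T f" using J_closed[OF _ T(1)[OF fg(1)] fg(2) h(1)] h fg RA TA by auto
    moreover have "x \<cdot>\<^bsub>C\<^esub> h = f \<cdot>\<^bsub>C\<^esub> (g \<cdot>\<^bsub>C\<^esub> h)" using fg h RA TA by auto
    ultimately show "x \<cdot>\<^bsub>C\<^esub> h \<in> ?S" using fg by blast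
  qed
  have "?S \<in> J c"
  proof (rule J_trans[OF c R(1) S])
    fix f assume f: "f \<in> R"
    have fA: "f \<in> Arr C" "Cod C f = c" using RA f by auto
    show "pullback_sieve C f ?S \<in> J (Dom C f)"
    proof (rule J_mono[OF _ T(1)[OF f]])
      show "T f \<subseteq> pullback_sieve C f ?S" using TA f unfolding pullback_sieve_def by blast
      show "sieve C (Dom C f) (pullback_sieve C f ?S)"
        by (rule sieve_pullback[OF S fA])
    qed (use fA in simp)
  qed
  moreover have "\<forall>x \<in> ?S. Q' x" using T(2) by blast
  ultimately show ?thesis unfolding locally_def by (rule bexI[rotated])
qed

lemma locally_mono:
  assumes c: "c \<in> Ob C" and Q: "locally C J c Q"
    and imp: "\<And>f. f \<in> Arr C \<Longrightarrow> Cod C f = c \<Longrightarrow> Q f \<Longrightarrow> Q' f"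
  shows "locally C J c Q'"
proof -
  obtain R where R: "R \<in> J c" "\<And>f. f \<in> R \<Longrightarrow> Q f" using Q unfolding locally_def by blast
  have "\<forall>f \<in> R. Q' f" using R imp J_Arr[OF c R(1)] by blast
  then show ?thesis using R(1) unfolding locally_def by blast
qed

lemma locally_pull:
  assumes g: "g \<in> Arr C" and Q: "locally C J (Cod C g) Q"
  shows "locally C J (Dom C g) (\<lambda>h. Q (g \<cdot>\<^bsub>C\<^esub> h))"
proof -
  obtain R where R: "R \<in> J (Cod C g)" "\<forall>f \<in> R. Q f" using Q unfolding locally_def by blast
  then have "\<forall>h \<in> pullback_sieve C g R. Q (g \<cdot>\<^bsub>C\<^esub> h)" unfolding pullback_sieve_def by simp
  then show ?thesis unfolding locally_def by (rule bexI) (rule J_pull[OF g R(1)])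
qed

lemma locally_conj:
  assumes "c \<in> Ob C" "locally C J c Q" "locally C J c Q'"
  shows "locally C J c (\<lambda>f. Q f \<and> Q' f)"
proof -
  have "locally C J c (\<lambda>f. Q f \<and> (\<forall>g \<in> Arr C. Cod C g = Dom C f \<longrightarrow> Q (f \<cdot>\<^bsub>C\<^esub> g)))"
  proof -
    obtain R where R: "R \<in> J c" "\<And>f. f \<in> R \<Longrightarrow> Q f" using assms(2) unfolding locally_def by blast
    then show ?thesis using J_closed[OF assms(1) R(1)] unfolding locally_def by (intro bexI[of _ R]) auto
  qed
  then show ?thesis
  proof (rule locally_trans[OF assms(1)])
    fix f assume f: "f \<in> Arr C" "Cod C f = c"
      "Q f \<and> (\<forall>g \<in> Arr C. Cod C g = Dom C f \<longrightarrow> Q (f \<cdot>\<^bsub>C\<^esub> g))"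
    have "locally C J (Dom C f) (\<lambda>h. Q' (f \<cdot>\<^bsub>C\<^esub> h))" using locally_pull f assms(3) by simp
    then show "locally C J (Dom C f) (\<lambda>h. Q (f \<cdot>\<^bsub>C\<^esub> h) \<and> Q' (f \<cdot>\<^bsub>C\<^esub> h))"
      by (rule locally_mono[rotated]) (use f in auto)
  qed
qed

lemma locally_sieve:
  assumes "c \<in> Ob C" "locally C J c Q"
    "\<And>f g. f \<in> Arr C \<Longrightarrow> Cod C f = c \<Longrightarrow> g \<in> Arr C \<Longrightarrow> Cod C g = Dom C f \<Longrightarrow> Q f \<Longrightarrow> Q (f \<cdot>\<^bsub>C\<^esub> g)"
  shows "{f \<in> Arr C. Cod C f = c \<and> Q f} \<in> J c"
proof -
  obtain R where R: "R \<in> J c" "\<And>f. f \<in> R \<Longrightarrow> Q f" using assms(2) unfolding locally_def by blast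
  show ?thesis
  proof (rule J_mono[OF assms(1) R(1)])
    show "R \<subseteq> {f \<in> Arr C. Cod C f = c \<and> Q f}" using R J_Arr assms(1) by blast
    show "sieve C c {f \<in> Arr C. Cod C f = c \<and> Q f}" unfolding sieve_def using assms(3) by auto
  qed
qed

lemma sheaf_presheaf: "sheaf C J F \<Longrightarrow> presheaf C F"
  unfolding sheaf_def by blast

lemma sheaf_amalgam:
  assumes "sheaf C J F" "c \<in> Ob C" "R \<in> J c" "matching_family C F R x"
  obtains y where "y \<in> val F c" "\<forall>f \<in> R. res F f y = x f"
  using assms unfolding sheaf_def by blast

lemma sheaf_separated:
  assumes F: "sheaf C J F" and c: "c \<in> Ob C" and x: "x \<in> val F c" "y \<in> val F c"
    and eq: "locally C J c (\<lambda>f. res F f x = res F f y)"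
  shows "x = y"
proof -
  have P: "presheaf C F" using F sheaf_presheaf by blast
  obtain R where R: "R \<in> J c" "\<And>f. f \<in> R \<Longrightarrow> res F f x = res F f y"
    using eq unfolding locally_def by blast
  have RA: "\<And>f. f \<in> R \<Longrightarrow> f \<in> Arr C \<and> Cod C f = c" using J_Arr[OF c R(1)] .
  have "matching_family C F R (\<lambda>f. res F f x)"
    by (rule matching_familyI) (use RA x P in \<open>auto simp: res_comp\<close>)
  then have "\<exists>!z. z \<in> val F c \<and> (\<forall>f \<in> R. res F f z = res F f x)"
    using F c R(1) unfolding sheaf_def by blast
  then show ?thesis using x R(2) by metis
qed

text \<open>Most matching families below come from values that can be chosen, and are unique, only
  locally. A relation between arrows and values records them without making a choice.\<close>

lemma sheaf_glue:
  assumes F: "sheaf C J F" and c: "c \<in> Ob C"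
    and ex: "locally C J c (\<lambda>f. \<exists>z. Rel f z)"
    and val: "\<And>f z. f \<in> Arr C \<Longrightarrow> Cod C f = c \<Longrightarrow> Rel f z \<Longrightarrow> z \<in> val F (Dom C f)"
    and stable: "\<And>f g z. f \<in> Arr C \<Longrightarrow> Cod C f = c \<Longrightarrow> g \<in> Arr C \<Longrightarrow> Cod C g = Dom C f \<Longrightarrow> Rel f z \<Longrightarrow>
       Rel (f \<cdot>\<^bsub>C\<^esub> g) (res F g z)"
    and uniq: "\<And>f z z'. f \<in> Arr C \<Longrightarrow> Cod C f = c \<Longrightarrow> Rel f z \<Longrightarrow> Rel f z' \<Longrightarrow> z = z'"
  obtains z where "z \<in> val F c" "\<And>f z'. f \<in> Arr C \<Longrightarrow> Cod C f = c \<Longrightarrow> Rel f z' \<Longrightarrow> res F f z = z'"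
proof -
  have P: "presheaf C F" using F sheaf_presheaf by blast
  let ?R = "{f \<in> Arr C. Cod C f = c \<and> (\<exists>z. Rel f z)}"
  have R: "?R \<in> J c" by (rule locally_sieve[OF c ex]) (use stable in blast)
  have THE: "\<And>f z. f \<in> Arr C \<Longrightarrow> Cod C f = c \<Longrightarrow> Rel f z \<Longrightarrow> (THE z. Rel f z) = z"
    using uniq by blast
  have "matching_family C F ?R (\<lambda>f. THE z. Rel f z)"
  proof (rule matching_familyI)
    fix f assume "f \<in> ?R" then show "(THE z. Rel f z) \<in> val F (Dom C f)" using THE val by auto
  next
    fix f g assume f: "f \<in> ?R" and g: "g \<in> Arr C" "Cod C g = Dom C f"
    then obtain z where "f \<in> Arr C" "Cod C f = c" "Rel f z" by blast
    then show "res F g (THE z. Rel f z) = (THE z. Rel (f \<cdot>\<^bsub>C\<^esub> g) z)"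
      using THE[of f z] THE[of "f \<cdot>\<^bsub>C\<^esub> g" "res F g z"] stable[of f g z] g by simp
  qed
  then obtain z where z: "z \<in> val F c" "\<forall>f \<in> ?R. res F f z = (THE z. Rel f z)"
    by (rule sheaf_amalgam[OF F c R])
  show ?thesis
  proof (rule that[OF z(1)])
    fix f z' assume f: "f \<in> Arr C" "Cod C f = c" and r: "Rel f z'"
    have "f \<in> ?R" using f r by blast
    then have "res F f z = (THE z. Rel f z)" using z(2) by blast
    then show "res F f z = z'" using THE[OF f r] by simp
  qed
qed

lemma sheafI:
  assumes P: "presheaf C F"
    and sep: "\<And>c R x y. c \<in> Ob C \<Longrightarrow> R \<in> J c \<Longrightarrow> x \<in> val F c \<Longrightarrow> y \<in> val F c \<Longrightarrow>
      (\<And>f. f \<in> R \<Longrightarrow> res F f x = res F f y) \<Longrightarrow> x = y"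
    and glue: "\<And>c R x. c \<in> Ob C \<Longrightarrow> R \<in> J c \<Longrightarrow> matching_family C F R x \<Longrightarrow>
      \<exists>y \<in> val F c. \<forall>f \<in> R. res F f y = x f"
  shows "sheaf C J F"
  unfolding sheaf_def
proof (intro conjI ballI allI impI P)
  fix c R x assume a: "c \<in> Ob C" "R \<in> J c" "matching_family C F R x"
  obtain y where y: "y \<in> val F c" "\<forall>f \<in> R. res F f y = x f" using glue[OF a] by blast
  show "\<exists>!y. y \<in> val F c \<and> (\<forall>f \<in> R. res F f y = x f)"
    by (rule ex1I[of _ y]) (use y sep[OF a(1,2)] in auto)
qed

lemma locally_bijectiveD:
  assumes "locally_bijective C J P F \<eta>"
  shows "natural C P F \<eta>"
    and "\<And>c x y. c \<in> Ob C \<Longrightarrow> x \<in> val P c \<Longrightarrow> y \<in> val P c \<Longrightarrow> \<eta> c x = \<eta> c y \<Longrightarrow>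
      locally C J c (\<lambda>f. res P f x = res P f y)"
    and "\<And>c s. c \<in> Ob C \<Longrightarrow> s \<in> val F c \<Longrightarrow>
      locally C J c (\<lambda>f. \<exists>x \<in> val P (Dom C f). res F f s = \<eta> (Dom C f) x)"
  using assms unfolding locally_bijective_def by blast+

lemma locally_surj_unique:
  assumes \<eta>: "\<And>c s. c \<in> Ob C \<Longrightarrow> s \<in> val F c \<Longrightarrow>
      locally C J c (\<lambda>f. \<exists>x \<in> val P (Dom C f). res F f s = \<eta> (Dom C f) x)"
    and G: "sheaf C J G" and F: "presheaf C F" and \<beta>: "natural C F G \<beta>" "natural C F G \<beta>'"
    and eq: "\<And>c x. c \<in> Ob C \<Longrightarrow> x \<in> val P c \<Longrightarrow> \<eta> c x \<in> val F c \<Longrightarrow> \<beta> c (\<eta> c x) = \<beta>' c (\<eta> c x)"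
    and c: "c \<in> Ob C" and s: "s \<in> val F c"
  shows "\<beta> c s = \<beta>' c s"
proof (rule sheaf_separated[OF G c])
  show "\<beta> c s \<in> val G c" "\<beta>' c s \<in> val G c" using \<beta> c s natural_val by fast+
  show "locally C J c (\<lambda>f. res G f (\<beta> c s) = res G f (\<beta>' c s))"
  proof (rule locally_mono[OF c \<eta>[OF c s]])
    fix f assume f: "f \<in> Arr C" "Cod C f = c" "\<exists>x \<in> val P (Dom C f). res F f s = \<eta> (Dom C f) x"
    then obtain x where x: "x \<in> val P (Dom C f)" "res F f s = \<eta> (Dom C f) x" by blast
    have "res F f s \<in> val F (Dom C f)" using F f s by simp
    then have "\<beta> (Dom C f) (res F f s) = \<beta>' (Dom C f) (res F f s)" using eq[of "Dom C f" x] x f by simp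
    then show "res G f (\<beta> c s) = res G f (\<beta>' c s)"
      using natural_res[OF \<beta>(1) f(1)] natural_res[OF \<beta>(2) f(1)] f s by simp
  qed
qed

text \<open>Gluing at all elements of a presheaf at once. The relation respects restriction of the
  element, so the glued values agree locally with those demanded by naturality.\<close>

lemma glue_natural:
  assumes G: "sheaf C J G" and A: "presheaf C A"
    and ex: "\<And>c s. c \<in> Ob C \<Longrightarrow> s \<in> val A c \<Longrightarrow> locally C J c (\<lambda>f. \<exists>z. Rel c s f z)"
    and val: "\<And>c s f z. c \<in> Ob C \<Longrightarrow> s \<in> val A c \<Longrightarrow> f \<in> Arr C \<Longrightarrow> Cod C f = c \<Longrightarrow> Rel c s f z \<Longrightarrow>
      z \<in> val G (Dom C f)"
    and stable: "\<And>c s f g z. c \<in> Ob C \<Longrightarrow> s \<in> val A c \<Longrightarrow> f \<in> Arr C \<Longrightarrow> Cod C f = c \<Longrightarrow> g \<in> Arr C \<Longrightarrow>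
      Cod C g = Dom C f \<Longrightarrow> Rel c s f z \<Longrightarrow> Rel c s (f \<cdot>\<^bsub>C\<^esub> g) (res G g z)"
    and uniq: "\<And>c s f z z'. c \<in> Ob C \<Longrightarrow> s \<in> val A c \<Longrightarrow> f \<in> Arr C \<Longrightarrow> Cod C f = c \<Longrightarrow>
      Rel c s f z \<Longrightarrow> Rel c s f z' \<Longrightarrow> z = z'"
    and along: "\<And>w s f z. w \<in> Arr C \<Longrightarrow> s \<in> val A (Cod C w) \<Longrightarrow> f \<in> Arr C \<Longrightarrow> Cod C f = Dom C w \<Longrightarrow>
      Rel (Dom C w) (res A w s) f z \<Longrightarrow> Rel (Cod C w) s (w \<cdot>\<^bsub>C\<^esub> f) z"
  obtains \<psi> where "natural C A G \<psi>"
    "\<And>c s f z. c \<in> Ob C \<Longrightarrow> s \<in> val A c \<Longrightarrow> f \<in> Arr C \<Longrightarrow> Cod C f = c \<Longrightarrow> Rel c s f z \<Longrightarrow> res G f (\<psi> c s) = z"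
proof -
  have GP: "presheaf C G" using G sheaf_presheaf by blast
  have "\<exists>z \<in> val G c. \<forall>f z'. f \<in> Arr C \<and> Cod C f = c \<and> Rel c s f z' \<longrightarrow> res G f z = z'"
    if c: "c \<in> Ob C" and s: "s \<in> val A c" for c s
  proof -
    obtain z where "z \<in> val G c" "\<And>f z'. f \<in> Arr C \<Longrightarrow> Cod C f = c \<Longrightarrow> Rel c s f z' \<Longrightarrow> res G f z = z'"
    proof (rule sheaf_glue[OF G c, of "Rel c s"])
      show "locally C J c (\<lambda>f. \<exists>z. Rel c s f z)" by (rule ex[OF c s])
      show "z \<in> val G (Dom C f)" if "f \<in> Arr C" "Cod C f = c" "Rel c s f z" for f z by (rule val[OF c s that])
      show "Rel c s (f \<cdot>\<^bsub>C\<^esub> g) (res G g z)"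
        if "f \<in> Arr C" "Cod C f = c" "g \<in> Arr C" "Cod C g = Dom C f" "Rel c s f z" for f g z
        by (rule stable[OF c s that])
      show "z = z'" if "f \<in> Arr C" "Cod C f = c" "Rel c s f z" "Rel c s f z'" for f z z'
          by (rule uniq[OF c s that])
    qed (rule that)
    then show ?thesis by blast
  qed
  then obtain \<psi> where \<psi>: "\<And>c s. c \<in> Ob C \<Longrightarrow> s \<in> val A c \<Longrightarrow> \<psi> c s \<in> val G c"
    "\<And>c s f z'. c \<in> Ob C \<Longrightarrow> s \<in> val A c \<Longrightarrow> f \<in> Arr C \<Longrightarrow> Cod C f = c \<Longrightarrow> Rel c s f z' \<Longrightarrow> res G f (\<psi> c s) = z'"
    by metis
  show ?thesis
  proof (rule that[OF naturalI[OF \<psi>(1)] \<psi>(2)])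
    fix w s assume w: "w \<in> Arr C" and s: "s \<in> val A (Cod C w)"
    have d: "Dom C w \<in> Ob C" "Cod C w \<in> Ob C" using w by simp_all
    have ws: "res A w s \<in> val A (Dom C w)" using A w s by simp
    show "\<psi> (Dom C w) (res A w s) = res G w (\<psi> (Cod C w) s)"
    proof (rule sheaf_separated[OF G d(1) \<psi>(1)[OF d(1) ws]])
      show "res G w (\<psi> (Cod C w) s) \<in> val G (Dom C w)" using \<psi>(1)[OF d(2) s] GP w by simp
      show "locally C J (Dom C w) (\<lambda>f. res G f (\<psi> (Dom C w) (res A w s)) = res G f (res G w (\<psi> (Cod C w) s)))"
      proof (rule locally_mono[OF d(1) ex[OF d(1) ws]])
        fix f assume f: "f \<in> Arr C" "Cod C f = Dom C w" and "\<exists>z. Rel (Dom C w) (res A w s) f z"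
        then obtain z where z: "Rel (Dom C w) (res A w s) f z" by blast
        have "res G (w \<cdot>\<^bsub>C\<^esub> f) (\<psi> (Cod C w) s) = z"
          by (rule \<psi>(2)[OF d(2) s _ _ along[OF w s f z]]) (use w f in simp_all)
        then show "res G f (\<psi> (Dom C w) (res A w s)) = res G f (res G w (\<psi> (Cod C w) s))"
          using \<psi>(2)[OF d(1) ws f z] res_comp[OF GP w f] \<psi>(1)[OF d(2) s] by simp
      qed
    qed
  qed
qed

text \<open>An element \<open>s\<close> of \<open>F\<close> is locally of the form \<open>\<eta> x\<close>, and \<open>\<alpha> x\<close> depends only on \<open>\<eta> x\<close>,
  since \<open>\<eta>\<close> is locally injective and \<open>G\<close> is separated. These values glue to \<open>\<beta> s\<close>.\<close>

lemma locally_bijective_universal: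
  assumes lb: "locally_bijective C J P F \<eta>" and P: "presheaf C P" and F: "presheaf C F"
    and G: "sheaf C J G" and \<alpha>: "natural C P G \<alpha>"
  obtains \<beta> where "natural C F G \<beta>" "\<And>c x. c \<in> Ob C \<Longrightarrow> x \<in> val P c \<Longrightarrow> \<beta> c (\<eta> c x) = \<alpha> c x"
proof -
  note \<eta> = locally_bijectiveD[OF lb]
  define Rel where "Rel c s f z \<longleftrightarrow> (\<exists>x \<in> val P (Dom C f). res F f s = \<eta> (Dom C f) x \<and> z = \<alpha> (Dom C f) x)"
    for c :: 'o and s f z
  have uniq: "\<alpha> c x = \<alpha> c y" if "c \<in> Ob C" "x \<in> val P c" "y \<in> val P c" "\<eta> c x = \<eta> c y" for c x y
  proof (rule sheaf_separated[OF G that(1)])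
    show "\<alpha> c x \<in> val G c" "\<alpha> c y \<in> val G c" using \<alpha> that natural_val by fast+
    show "locally C J c (\<lambda>f. res G f (\<alpha> c x) = res G f (\<alpha> c y))"
      by (rule locally_mono[OF that(1) \<eta>(2)[OF that]])
        (use natural_res[OF \<alpha>] that in metis)
  qed
  obtain \<beta> where \<beta>: "natural C F G \<beta>"
    "\<And>c s f z. c \<in> Ob C \<Longrightarrow> s \<in> val F c \<Longrightarrow> f \<in> Arr C \<Longrightarrow> Cod C f = c \<Longrightarrow> Rel c s f z \<Longrightarrow> res G f (\<beta> c s) = z"
  proof (rule glue_natural[OF G F, of Rel])
    show "locally C J c (\<lambda>f. \<exists>z. Rel c s f z)" if c: "c \<in> Ob C" and s: "s \<in> val F c" for c s
      by (rule locally_mono[OF c \<eta>(3)[OF c s]]) (auto simp: Rel_def)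
    show "z \<in> val G (Dom C f)" if "f \<in> Arr C" "Rel c s f z" for c s f z
      using \<alpha> natural_val that unfolding Rel_def by fastforce
    show "z = z'" if "f \<in> Arr C" "Rel c s f z" "Rel c s f z'" for c s f z z'
      using that uniq unfolding Rel_def by (metis Dom_Ob)
    show "Rel c s (f \<cdot>\<^bsub>C\<^esub> g) (res G g z)"
      if s: "s \<in> val F c" and f: "f \<in> Arr C" "Cod C f = c" and g: "g \<in> Arr C" "Cod C g = Dom C f"
          and r: "Rel c s f z"
      for c s f g z
    proof -
      obtain x where x: "x \<in> val P (Dom C f)" "res F f s = \<eta> (Dom C f) x" "z = \<alpha> (Dom C f) x"
        using r unfolding Rel_def by blast
      show ?thesis unfolding Rel_def
        by (rule bexI[of _ "res P g x"])
          (use F P f g x s natural_res[OF \<eta>(1) g(1)] natural_res[OF \<alpha> g(1)] in \<open>simp_all add: res_comp\<close>)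
    qed
    show "Rel (Cod C w) s (w \<cdot>\<^bsub>C\<^esub> f) z"
      if "w \<in> Arr C" "s \<in> val F (Cod C w)" "f \<in> Arr C" "Cod C f = Dom C w" "Rel (Dom C w) (res F w s) f z"
          for w s f z
      using that F unfolding Rel_def by (simp add: res_comp)
  qed (rule that)
  show ?thesis
  proof (rule that[OF \<beta>(1)])
    fix c x assume c: "c \<in> Ob C" and x: "x \<in> val P c"
    have "\<eta> c x \<in> val F c" using \<eta>(1) c x natural_val by fast
    then show "\<beta> c (\<eta> c x) = \<alpha> c x"
      using \<beta>(2)[of c "\<eta> c x" "Ide C c" "\<alpha> c x"] natural_val[OF \<beta>(1) c] c x F sheaf_presheaf[OF G]
      unfolding Rel_def by auto
  qed
qed

definition image_closure :: "('o, 'a, 'v) psh \<Rightarrow> ('o, 'a, 'w) psh \<Rightarrow> ('o \<Rightarrow> 'v \<Rightarrow> 'w) \<Rightarrow> ('o, 'a, 'w) psh" where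
  "image_closure P F \<eta> =
     (let V = (\<lambda>c. {s \<in> val F c. locally C J c (\<lambda>f. \<exists>x \<in> val P (Dom C f). res F f s = \<eta> (Dom C f) x)})
      in \<lparr>val = \<lambda>c \<in> Ob C. V c, res = \<lambda>f \<in> Arr C. \<lambda>x \<in> V (Cod C f). res F f x\<rparr>)"

text \<open>Elements that are locally in the image and match glue in \<open>F\<close>, and the result is again locally
  in the image, because covering is transitive. The sheafification will be cut out of a larger sheaf
  in this way.\<close>

lemma image_closure:
  assumes F: "sheaf C J F" and P: "presheaf C P" and \<eta>: "natural C P F \<eta>"
  shows "sheaf C J (image_closure P F \<eta>)"
    and "natural C P (image_closure P F \<eta>) \<eta>"
    and "c \<in> Ob C \<Longrightarrow> s \<in> val (image_closure P F \<eta>) c \<Longrightarrow>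
      locally C J c (\<lambda>f. \<exists>x \<in> val P (Dom C f). res (image_closure P F \<eta>) f s = \<eta> (Dom C f) x)"
    and "natural C (image_closure P F \<eta>) F (\<lambda>c s. s)"
proof -
  have FP: "presheaf C F" using F sheaf_presheaf by blast
  define V where "V c = {s \<in> val F c. locally C J c (\<lambda>f. \<exists>x \<in> val P (Dom C f). res F f s = \<eta> (Dom C f) x)}"
      for c
  let ?I = "image_closure P F \<eta>"
  have I: "?I = \<lparr>val = \<lambda>c \<in> Ob C. V c, res = \<lambda>f \<in> Arr C. \<lambda>x \<in> V (Cod C f). res F f x\<rparr>"
    unfolding image_closure_def V_def Let_def ..
  have valI: "val ?I c = V c" if "c \<in> Ob C" for c using that unfolding I by simp
  have resI: "res ?I f s = res F f s" if "f \<in> Arr C" "s \<in> V (Cod C f)" for f s using that unfolding I by simp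
  have VF: "s \<in> V c \<Longrightarrow> s \<in> val F c" for s c unfolding V_def by blast
  have Vres: "res F f s \<in> V (Dom C f)" if "f \<in> Arr C" "s \<in> V (Cod C f)" for f s
  proof -
    have "locally C J (Cod C f) (\<lambda>f. \<exists>x \<in> val P (Dom C f). res F f s = \<eta> (Dom C f) x)"
      using that unfolding V_def by blast
    from locally_pull[OF that(1) this]
    have "locally C J (Dom C f) (\<lambda>g. \<exists>x \<in> val P (Dom C g). res F g (res F f s) = \<eta> (Dom C g) x)"
    proof (rule locally_mono[rotated])
      fix g assume g: "g \<in> Arr C" "Cod C g = Dom C f"
        and "\<exists>x \<in> val P (Dom C (f \<cdot>\<^bsub>C\<^esub> g)). res F (f \<cdot>\<^bsub>C\<^esub> g) s = \<eta> (Dom C (f \<cdot>\<^bsub>C\<^esub> g)) x"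
      then show "\<exists>x \<in> val P (Dom C g). res F g (res F f s) = \<eta> (Dom C g) x"
        using that VF[OF that(2)] by (simp add: res_comp[OF FP])
    qed (use that in simp)
    moreover have "res F f s \<in> val F (Dom C f)" using that VF FP by simp
    ultimately show ?thesis unfolding V_def by simp
  qed
  show IP: "sheaf C J ?I"
  proof (rule sheafI)
    show pI: "presheaf C ?I"
      unfolding I by (rule presheaf_mk) (use VF Vres FP in \<open>auto simp: res_comp\<close>)
    fix c R assume c: "c \<in> Ob C" and R: "R \<in> J c"
    have RA: "\<And>f. f \<in> R \<Longrightarrow> f \<in> Arr C \<and> Cod C f = c" using J_Arr[OF c R] .
    show "x = y" if "x \<in> val ?I c" "y \<in> val ?I c" "\<And>f. f \<in> R \<Longrightarrow> res ?I f x = res ?I f y" for x y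
      by (rule sheaf_separated[OF F c])
        (use that VF valI resI RA c R in \<open>auto simp: locally_def intro!: bexI[of _ R]\<close>)
    fix x assume m: "matching_family C ?I R x"
    have xV: "x f \<in> V (Dom C f)" if "f \<in> R" for f
      using m that RA valI unfolding matching_family_def by auto
    have "matching_family C F R x"
      by (rule matching_familyI)
        (use m xV VF resI in \<open>auto simp: matching_family_def\<close>)
    then obtain y where y: "y \<in> val F c" "\<And>f. f \<in> R \<Longrightarrow> res F f y = x f"
      using F c R unfolding sheaf_def by blast
    have "locally C J c (\<lambda>f. \<exists>x \<in> val P (Dom C f). res F f y = \<eta> (Dom C f) x)"
    proof (rule locally_trans[OF c])
      show "locally C J c (\<lambda>f. f \<in> R)" using R unfolding locally_def by blast
      fix f assume f: "f \<in> Arr C" "Cod C f = c" "f \<in> R"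
      have "locally C J (Dom C f) (\<lambda>g. \<exists>z \<in> val P (Dom C g). res F g (x f) = \<eta> (Dom C g) z)"
        using xV[OF f(3)] unfolding V_def by blast
      then show "locally C J (Dom C f) (\<lambda>g. \<exists>x \<in> val P (Dom C (f \<cdot>\<^bsub>C\<^esub> g)). res F (f \<cdot>\<^bsub>C\<^esub> g) y = \<eta> (Dom C (f \<cdot>\<^bsub>C\<^esub> g))
          x)"
        by (rule locally_mono[rotated]) (use f y FP in \<open>auto simp: res_comp\<close>)
    qed
    then have "y \<in> V c" using y unfolding V_def by blast
    then show "\<exists>y \<in> val ?I c. \<forall>f \<in> R. res ?I f y = x f"
      using y(2) valI[OF c] resI RA by auto
  qed
  show "natural C ?I F (\<lambda>c s. s)"
    by (rule naturalI) (use valI resI VF in auto)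
  have \<eta>V: "\<eta> c x \<in> V c" if c: "c \<in> Ob C" and x: "x \<in> val P c" for c x
  proof -
    have "locally C J c (\<lambda>f. \<exists>y \<in> val P (Dom C f). res F f (\<eta> c x) = \<eta> (Dom C f) y)"
    proof (rule locally_always[OF c])
      fix f assume f: "f \<in> Arr C" "Cod C f = c"
      show "\<exists>y \<in> val P (Dom C f). res F f (\<eta> c x) = \<eta> (Dom C f) y"
        by (rule bexI[of _ "res P f x"]) (use natural_res[OF \<eta> f(1)] f x P in simp_all)
    qed
    then show ?thesis using natural_val[OF \<eta> c x] unfolding V_def by blast
  qed
  show "natural C P ?I \<eta>"
    by (rule naturalI) (use \<eta>V natural_res[OF \<eta>] valI resI in auto)
  show "locally C J c (\<lambda>f. \<exists>x \<in> val P (Dom C f). res ?I f s = \<eta> (Dom C f) x)"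
    if c: "c \<in> Ob C" and s: "s \<in> val ?I c" for c s
  proof -
    have "s \<in> V c" using s valI[OF c] by blast
    then have "locally C J c (\<lambda>f. \<exists>x \<in> val P (Dom C f). res F f s = \<eta> (Dom C f) x)" unfolding V_def by blast
    then show ?thesis by (rule locally_mono[OF c]) (use resI \<open>s \<in> V c\<close> in auto)
  qed
qed

end

section \<open>Sheafification\<close>

context topology
begin

text \<open>The \<open>J\<close>-closed subpresheaves of the product of the representable \<open>y c\<close> with \<open>P\<close>, each given as
  a set of pairs \<open>(f, x)\<close> with \<open>f : b \<rightarrow> c\<close> and \<open>x\<close> in \<open>P b\<close>. For varying \<open>c\<close> they form the
  exponential of the sheaf of closed sieves by \<open>P\<close>. The closure of the graph of an element of \<open>P\<close> is
  its singleton. The singleton map is locally injective, so the elements locally in its image form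
  the sheafification of \<open>P\<close>.\<close>

definition closed_sub :: "('o, 'a, 'v) psh \<Rightarrow> 'o \<Rightarrow> ('a \<times> 'v) set set" where
  "closed_sub P c = {s.
     (\<forall>f x. (f, x) \<in> s \<longrightarrow> f \<in> Arr C \<and> Cod C f = c \<and> x \<in> val P (Dom C f)) \<and>
     (\<forall>f x. \<forall>g \<in> Arr C. (f, x) \<in> s \<longrightarrow> Cod C g = Dom C f \<longrightarrow> (f \<cdot>\<^bsub>C\<^esub> g, res P g x) \<in> s) \<and>
     (\<forall>f \<in> Arr C. \<forall>x \<in> val P (Dom C f). Cod C f = c \<longrightarrow>
        locally C J (Dom C f) (\<lambda>g. (f \<cdot>\<^bsub>C\<^esub> g, res P g x) \<in> s) \<longrightarrow> (f, x) \<in> s)}"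

definition sub_res :: "'a \<Rightarrow> ('a \<times> 'v) set \<Rightarrow> ('a \<times> 'v) set" where
  "sub_res f s = {(g, x). g \<in> Arr C \<and> Cod C g = Dom C f \<and> (f \<cdot>\<^bsub>C\<^esub> g, x) \<in> s}"

definition closed_sub_psh :: "('o, 'a, 'v) psh \<Rightarrow> ('o, 'a, ('a \<times> 'v) set) psh" where
  "closed_sub_psh P = \<lparr>val = \<lambda>c \<in> Ob C. closed_sub P c,
     res = \<lambda>f \<in> Arr C. \<lambda>s \<in> closed_sub P (Cod C f). sub_res f s\<rparr>"

definition graph_closure :: "('o, 'a, 'v) psh \<Rightarrow> 'o \<Rightarrow> 'v \<Rightarrow> ('a \<times> 'v) set" where
  "graph_closure P c x = {(f, y). f \<in> Arr C \<and> Cod C f = c \<and> y \<in> val P (Dom C f) \<and>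
     locally C J (Dom C f) (\<lambda>g. res P g y = res P (f \<cdot>\<^bsub>C\<^esub> g) x)}"

lemma closed_subD:
  assumes "s \<in> closed_sub P c"
  shows "(f, x) \<in> s \<Longrightarrow> f \<in> Arr C" "(f, x) \<in> s \<Longrightarrow> Cod C f = c" "(f, x) \<in> s \<Longrightarrow> x \<in> val P (Dom C f)"
    and "(f, x) \<in> s \<Longrightarrow> g \<in> Arr C \<Longrightarrow> Cod C g = Dom C f \<Longrightarrow> (f \<cdot>\<^bsub>C\<^esub> g, res P g x) \<in> s"
    and "f \<in> Arr C \<Longrightarrow> Cod C f = c \<Longrightarrow> x \<in> val P (Dom C f) \<Longrightarrow>
        locally C J (Dom C f) (\<lambda>g. (f \<cdot>\<^bsub>C\<^esub> g, res P g x) \<in> s) \<Longrightarrow> (f, x) \<in> s"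
  using assms unfolding closed_sub_def by blast+

lemma sub_res_iff: "(g, x) \<in> sub_res f s \<longleftrightarrow> g \<in> Arr C \<and> Cod C g = Dom C f \<and> (f \<cdot>\<^bsub>C\<^esub> g, x) \<in> s"
  unfolding sub_res_def by simp

lemma closed_subI:
  assumes "\<And>f x. (f, x) \<in> s \<Longrightarrow> f \<in> Arr C \<and> Cod C f = c \<and> x \<in> val P (Dom C f)"
    and "\<And>f x g. (f, x) \<in> s \<Longrightarrow> g \<in> Arr C \<Longrightarrow> Cod C g = Dom C f \<Longrightarrow> (f \<cdot>\<^bsub>C\<^esub> g, res P g x) \<in> s"
    and "\<And>f x. f \<in> Arr C \<Longrightarrow> Cod C f = c \<Longrightarrow> x \<in> val P (Dom C f) \<Longrightarrow>
        locally C J (Dom C f) (\<lambda>g. (f \<cdot>\<^bsub>C\<^esub> g, res P g x) \<in> s) \<Longrightarrow> (f, x) \<in> s"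
  shows "s \<in> closed_sub P c"
  unfolding closed_sub_def mem_Collect_eq
proof (intro conjI allI ballI impI)
  fix f x assume a: "(f, x) \<in> s"
  show "f \<in> Arr C" "Cod C f = c" "x \<in> val P (Dom C f)" using assms(1)[OF a] by blast+
qed (rule assms(2,3), assumption+)+

lemma sub_res_closed:
  assumes s: "s \<in> closed_sub P (Cod C f)" and f: "f \<in> Arr C"
  shows "sub_res f s \<in> closed_sub P (Dom C f)"
proof (rule closed_subI)
  fix g x assume "(g, x) \<in> sub_res f s"
  then have g: "g \<in> Arr C" "Cod C g = Dom C f" "(f \<cdot>\<^bsub>C\<^esub> g, x) \<in> s" unfolding sub_res_iff by auto
  show "g \<in> Arr C \<and> Cod C g = Dom C f \<and> x \<in> val P (Dom C g)"
    using closed_subD(3)[OF s g(3)] g f by simp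
  fix h assume h: "h \<in> Arr C" "Cod C h = Dom C g"
  show "(g \<cdot>\<^bsub>C\<^esub> h, res P h x) \<in> sub_res f s"
    using closed_subD(4)[OF s g(3) h(1)] g h f unfolding sub_res_iff by simp
next
  fix g x assume g: "g \<in> Arr C" "Cod C g = Dom C f" "x \<in> val P (Dom C g)"
    and l: "locally C J (Dom C g) (\<lambda>h. (g \<cdot>\<^bsub>C\<^esub> h, res P h x) \<in> sub_res f s)"
  have "(f \<cdot>\<^bsub>C\<^esub> g, x) \<in> s"
  proof (rule closed_subD(5)[OF s])
    show "locally C J (Dom C (f \<cdot>\<^bsub>C\<^esub> g)) (\<lambda>h. ((f \<cdot>\<^bsub>C\<^esub> g) \<cdot>\<^bsub>C\<^esub> h, res P h x) \<in> s)"
      using locally_mono[OF _ l, of "\<lambda>h. ((f \<cdot>\<^bsub>C\<^esub> g) \<cdot>\<^bsub>C\<^esub> h, res P h x) \<in> s"] f g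
      by (simp add: sub_res_iff)
  qed (use f g in simp_all)
  then show "(g, x) \<in> sub_res f s" using g unfolding sub_res_iff by simp
qed

text \<open>A pair belongs to the amalgamation of a matching family of closed sets if, on a covering sieve,
  its restrictions belong to the members of the family; closedness leaves no other choice.\<close>

lemma closed_sub_sheaf:
  assumes P: "presheaf C P"
  shows "sheaf C J (closed_sub_psh P)"
proof (rule sheafI)
  let ?F = "closed_sub_psh P"
  have valF: "val ?F c = closed_sub P c" if "c \<in> Ob C" for c using that unfolding closed_sub_psh_def by simp
  have resF: "res ?F f s = sub_res f s" if "f \<in> Arr C" "s \<in> closed_sub P (Cod C f)" for f s
    using that unfolding closed_sub_psh_def by simp
  show "presheaf C ?F" unfolding closed_sub_psh_def
  proof (rule presheaf_mk)
    show "\<And>f x. f \<in> Arr C \<Longrightarrow> x \<in> closed_sub P (Cod C f) \<Longrightarrow> sub_res f x \<in> closed_sub P (Dom C f)"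
      by (rule sub_res_closed)
    fix c s assume c: "c \<in> Ob C" and s: "s \<in> closed_sub P c"
    show "sub_res (Ide C c) s = s"
    proof (rule set_eqI, rule prod.induct)
      fix f x show "(f, x) \<in> sub_res (Ide C c) s \<longleftrightarrow> (f, x) \<in> s"
        unfolding sub_res_iff using closed_subD(1,2)[OF s, of f x] c by (metis Dom_Ide Ide_comp)
    qed
  next
    fix f g s assume "f \<in> Arr C" "g \<in> Arr C" "Cod C g = Dom C f" "s \<in> closed_sub P (Cod C f)"
    then show "sub_res (f \<cdot>\<^bsub>C\<^esub> g) s = sub_res g (sub_res f s)"
      by (auto simp: sub_res_iff)
  qed
  fix c R assume c: "c \<in> Ob C" and R: "R \<in> J c"
  have RA: "\<And>f. f \<in> R \<Longrightarrow> f \<in> Arr C \<and> Cod C f = c" using J_Arr[OF c R] .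
  have locR: "locally C J (Dom C f) (\<lambda>g. f \<cdot>\<^bsub>C\<^esub> g \<in> R)" if "f \<in> Arr C" "Cod C f = c" for f
    using locally_pull[OF that(1), of "\<lambda>f. f \<in> R"] that R unfolding locally_def by blast
  have sub: "s \<subseteq> t" if s: "s \<in> val ?F c" and t: "t \<in> val ?F c"
    and eq: "\<And>f. f \<in> R \<Longrightarrow> res ?F f s = res ?F f t" for s t
  proof (rule subrelI)
    fix f x assume fx: "(f, x) \<in> s"
    have s': "s \<in> closed_sub P c" and t': "t \<in> closed_sub P c" using s t valF c by auto
    note f = closed_subD(1-3)[OF s' fx]
    show "(f, x) \<in> t"
    proof (rule closed_subD(5)[OF t' f])
      show "locally C J (Dom C f) (\<lambda>g. (f \<cdot>\<^bsub>C\<^esub> g, res P g x) \<in> t)"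
      proof (rule locally_mono[OF _ locR[OF f(1,2)]])
        fix g assume g: "g \<in> Arr C" "Cod C g = Dom C f" "f \<cdot>\<^bsub>C\<^esub> g \<in> R"
        have "(Ide C (Dom C g), res P g x) \<in> sub_res (f \<cdot>\<^bsub>C\<^esub> g) s"
          using closed_subD(4)[OF s' fx g(1,2)] f g unfolding sub_res_iff by simp
        then have "(Ide C (Dom C g), res P g x) \<in> sub_res (f \<cdot>\<^bsub>C\<^esub> g) t"
          using eq[OF g(3)] resF[of "f \<cdot>\<^bsub>C\<^esub> g"] s' t' RA[OF g(3)] by simp
        then show "(f \<cdot>\<^bsub>C\<^esub> g, res P g x) \<in> t" using f g unfolding sub_res_iff by simp
      qed (use f in simp)
    qed
  qed
  show "s = t" if "s \<in> val ?F c" "t \<in> val ?F c" "\<And>f. f \<in> R \<Longrightarrow> res ?F f s = res ?F f t" for s t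
    using sub[OF that] sub[OF that(2,1)] that(3) by auto
  fix x assume m: "matching_family C ?F R x"
  have xc: "x f \<in> closed_sub P (Dom C f)" if "f \<in> R" for f
    using m that RA valF unfolding matching_family_def by auto
  have xr: "sub_res g (x f) = x (f \<cdot>\<^bsub>C\<^esub> g)" if "f \<in> R" "g \<in> Arr C" "Cod C g = Dom C f" for f g
    using m that xc[OF that(1)] resF[OF that(2), of "x f"] unfolding matching_family_def by auto
  let ?Q = "\<lambda>h z. h \<in> R \<and> (Ide C (Dom C h), z) \<in> x h"
  (* the identity in ?Q turns membership of x h into a condition on elements over the domain of h *)
  define s where "s = {(f, y). f \<in> Arr C \<and> Cod C f = c \<and> y \<in> val P (Dom C f) \<and>
     locally C J (Dom C f) (\<lambda>g. ?Q (f \<cdot>\<^bsub>C\<^esub> g) (res P g y))}"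
  have sI: "(f, y) \<in> s \<longleftrightarrow> f \<in> Arr C \<and> Cod C f = c \<and> y \<in> val P (Dom C f) \<and>
     locally C J (Dom C f) (\<lambda>g. ?Q (f \<cdot>\<^bsub>C\<^esub> g) (res P g y))" for f y
    unfolding s_def by simp
  have s: "s \<in> closed_sub P c"
  proof (rule closed_subI)
    show "f \<in> Arr C \<and> Cod C f = c \<and> y \<in> val P (Dom C f)" if "(f, y) \<in> s" for f y
      using that unfolding sI by blast
    fix f y g assume fy: "(f, y) \<in> s" and g: "g \<in> Arr C" "Cod C g = Dom C f"
    have f: "f \<in> Arr C" "Cod C f = c" "y \<in> val P (Dom C f)" using fy sI by blast+
    have l: "locally C J (Cod C g) (\<lambda>h. ?Q (f \<cdot>\<^bsub>C\<^esub> h) (res P h y))" using fy g sI by simp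
    have "locally C J (Dom C g) (\<lambda>h. ?Q ((f \<cdot>\<^bsub>C\<^esub> g) \<cdot>\<^bsub>C\<^esub> h) (res P h (res P g y)))"
      by (rule locally_mono[OF _ locally_pull[OF g(1) l]]) (use f g in \<open>simp_all add: res_comp[OF P]\<close>)
    then show "(f \<cdot>\<^bsub>C\<^esub> g, res P g y) \<in> s" unfolding sI using f g P by simp
  next
    fix f y assume f: "f \<in> Arr C" "Cod C f = c" "y \<in> val P (Dom C f)"
      and l: "locally C J (Dom C f) (\<lambda>g. (f \<cdot>\<^bsub>C\<^esub> g, res P g y) \<in> s)"
    have "locally C J (Dom C f) (\<lambda>g. ?Q (f \<cdot>\<^bsub>C\<^esub> g) (res P g y))"
    proof (rule locally_trans[OF _ l])
      fix g assume g: "g \<in> Arr C" "Cod C g = Dom C f" "(f \<cdot>\<^bsub>C\<^esub> g, res P g y) \<in> s"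
      have "locally C J (Dom C g) (\<lambda>h. ?Q ((f \<cdot>\<^bsub>C\<^esub> g) \<cdot>\<^bsub>C\<^esub> h) (res P h (res P g y)))"
        using g f unfolding sI by simp
      then show "locally C J (Dom C g) (\<lambda>h. ?Q (f \<cdot>\<^bsub>C\<^esub> (g \<cdot>\<^bsub>C\<^esub> h)) (res P (g \<cdot>\<^bsub>C\<^esub> h) y))"
        by (rule locally_mono[rotated]) (use f g in \<open>simp_all add: res_comp[OF P]\<close>)
    qed (use f in simp)
    then show "(f, y) \<in> s" using f sI by blast
  qed
  have "sub_res f s = x f" if f: "f \<in> R" for f
  proof (rule set_eqI, rule prod.induct)
    fix g y
    have fA: "f \<in> Arr C" "Cod C f = c" using RA[OF f] by auto
    have xg: "x (f \<cdot>\<^bsub>C\<^esub> (g \<cdot>\<^bsub>C\<^esub> h)) = sub_res (g \<cdot>\<^bsub>C\<^esub> h) (x f)" "f \<cdot>\<^bsub>C\<^esub> (g \<cdot>\<^bsub>C\<^esub> h) \<in> R"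
      if "g \<in> Arr C" "Cod C g = Dom C f" "h \<in> Arr C" "Cod C h = Dom C g" for h
      using xr[OF f, of "g \<cdot>\<^bsub>C\<^esub> h"] J_closed[OF c R f, of "g \<cdot>\<^bsub>C\<^esub> h"] that by simp_all
    have Q: "?Q ((f \<cdot>\<^bsub>C\<^esub> g) \<cdot>\<^bsub>C\<^esub> h) z \<longleftrightarrow> (g \<cdot>\<^bsub>C\<^esub> h, z) \<in> x f"
      if "g \<in> Arr C" "Cod C g = Dom C f" "h \<in> Arr C" "Cod C h = Dom C g" for h z
      using that fA xg[OF that] by (simp add: sub_res_iff)
    show "(g, y) \<in> sub_res f s \<longleftrightarrow> (g, y) \<in> x f"
    proof
      assume "(g, y) \<in> sub_res f s"
      then have g: "g \<in> Arr C" "Cod C g = Dom C f" and "(f \<cdot>\<^bsub>C\<^esub> g, y) \<in> s" unfolding sub_res_iff by auto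
      then have y: "y \<in> val P (Dom C g)"
        and l: "locally C J (Dom C g) (\<lambda>h. ?Q ((f \<cdot>\<^bsub>C\<^esub> g) \<cdot>\<^bsub>C\<^esub> h) (res P h y))"
        unfolding sI using fA by auto
      have "locally C J (Dom C g) (\<lambda>h. (g \<cdot>\<^bsub>C\<^esub> h, res P h y) \<in> x f)"
        by (rule locally_mono[OF _ l]) (use Q[OF g] g in \<open>simp, blast\<close>)
      then show "(g, y) \<in> x f" by (rule closed_subD(5)[OF xc[OF f] g y])
    next
      assume gy: "(g, y) \<in> x f"
      note g = closed_subD(1-3)[OF xc[OF f] gy]
      have "locally C J (Dom C g) (\<lambda>h. ?Q ((f \<cdot>\<^bsub>C\<^esub> g) \<cdot>\<^bsub>C\<^esub> h) (res P h y))"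
        by (rule locally_always) (use Q[OF g(1,2)] closed_subD(4)[OF xc[OF f] gy] g in auto)
      then show "(g, y) \<in> sub_res f s" unfolding sub_res_iff sI using g fA by simp
    qed
  qed
  then show "\<exists>y \<in> val ?F c. \<forall>f \<in> R. res ?F f y = x f"
    using s valF[OF c] resF RA by (intro bexI[of _ s]) auto
qed

lemma graph_closure_iff: "(f, y) \<in> graph_closure P c x \<longleftrightarrow> f \<in> Arr C \<and> Cod C f = c \<and> y \<in> val P (Dom C f) \<and>
     locally C J (Dom C f) (\<lambda>g. res P g y = res P (f \<cdot>\<^bsub>C\<^esub> g) x)"
  unfolding graph_closure_def by simp

lemma graph_closure_natural:
  assumes P: "presheaf C P"
  shows "natural C P (closed_sub_psh P) (graph_closure P)"
proof (rule naturalI)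
  have 1: "graph_closure P c x \<in> closed_sub P c" if c: "c \<in> Ob C" and x: "x \<in> val P c" for c x
  proof (rule closed_subI)
    show "f \<in> Arr C \<and> Cod C f = c \<and> y \<in> val P (Dom C f)" if "(f, y) \<in> graph_closure P c x" for f y
      using that unfolding graph_closure_iff by blast
    fix f y g assume fy: "(f, y) \<in> graph_closure P c x" and g: "g \<in> Arr C" "Cod C g = Dom C f"
    then have f: "f \<in> Arr C" "Cod C f = c" "y \<in> val P (Dom C f)"
      and l: "locally C J (Cod C g) (\<lambda>g. res P g y = res P (f \<cdot>\<^bsub>C\<^esub> g) x)"
      unfolding graph_closure_iff by auto
    have "locally C J (Dom C g) (\<lambda>h. res P h (res P g y) = res P ((f \<cdot>\<^bsub>C\<^esub> g) \<cdot>\<^bsub>C\<^esub> h) x)"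
      by (rule locally_mono[OF _ locally_pull[OF g(1) l]]) (use f g in \<open>simp_all add: res_comp[OF P]\<close>)
    then show "(f \<cdot>\<^bsub>C\<^esub> g, res P g y) \<in> graph_closure P c x"
      unfolding graph_closure_iff using f g P by simp
  next
    fix f y assume f: "f \<in> Arr C" "Cod C f = c" "y \<in> val P (Dom C f)"
      and l: "locally C J (Dom C f) (\<lambda>g. (f \<cdot>\<^bsub>C\<^esub> g, res P g y) \<in> graph_closure P c x)"
    have "locally C J (Dom C f) (\<lambda>g. res P g y = res P (f \<cdot>\<^bsub>C\<^esub> g) x)"
    proof (rule locally_trans[OF _ l])
      fix g assume g: "g \<in> Arr C" "Cod C g = Dom C f" "(f \<cdot>\<^bsub>C\<^esub> g, res P g y) \<in> graph_closure P c x"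
      then have "locally C J (Dom C g) (\<lambda>h. res P h (res P g y) = res P ((f \<cdot>\<^bsub>C\<^esub> g) \<cdot>\<^bsub>C\<^esub> h) x)"
        unfolding graph_closure_iff using f by simp
      then show "locally C J (Dom C g) (\<lambda>h. res P (g \<cdot>\<^bsub>C\<^esub> h) y = res P (f \<cdot>\<^bsub>C\<^esub> (g \<cdot>\<^bsub>C\<^esub> h)) x)"
        by (rule locally_mono[rotated]) (use f g in \<open>simp_all add: res_comp[OF P]\<close>)
    qed (use f in simp)
    then show "(f, y) \<in> graph_closure P c x" unfolding graph_closure_iff using f by simp
  qed
  show "graph_closure P c x \<in> val (closed_sub_psh P) c" if "c \<in> Ob C" "x \<in> val P c" for c x
    using 1[OF that] that unfolding closed_sub_psh_def by simp
  fix f x assume f: "f \<in> Arr C" and x: "x \<in> val P (Cod C f)"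
  have "graph_closure P (Dom C f) (res P f x) = sub_res f (graph_closure P (Cod C f) x)"
  proof (rule set_eqI, rule prod.induct)
    fix g y
    have "locally C J (Dom C g) (\<lambda>h. res P h y = res P (g \<cdot>\<^bsub>C\<^esub> h) (res P f x)) \<longleftrightarrow>
      locally C J (Dom C g) (\<lambda>h. res P h y = res P ((f \<cdot>\<^bsub>C\<^esub> g) \<cdot>\<^bsub>C\<^esub> h) x)"
      if g: "g \<in> Arr C" "Cod C g = Dom C f"
      by (intro iffI; rule locally_mono[rotated], assumption)
        (use f g x in \<open>simp_all add: res_comp[OF P]\<close>)
    then show "(g, y) \<in> graph_closure P (Dom C f) (res P f x) \<longleftrightarrow>
        (g, y) \<in> sub_res f (graph_closure P (Cod C f) x)"
      unfolding sub_res_iff graph_closure_iff using f by auto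
  qed
  then show "graph_closure P (Dom C f) (res P f x) =
      res (closed_sub_psh P) f (graph_closure P (Cod C f) x)"
    using 1[of "Cod C f" x] f x unfolding closed_sub_psh_def by simp
qed

text \<open>If \<open>x\<close> and \<open>y\<close> have the same singleton, then \<open>x\<close>, taken at the identity, belongs to the
  singleton of \<open>y\<close>, which says that \<open>x\<close> and \<open>y\<close> are locally equal.\<close>

lemma ex_locally_bijective:
  fixes P :: "('o, 'a, 'v) psh"
  assumes P: "presheaf C P"
  obtains F :: "('o, 'a, ('a \<times> 'v) set) psh" and \<eta> where "sheaf C J F" "locally_bijective C J P F \<eta>"
proof -
  note S = closed_sub_sheaf[OF P] and N = graph_closure_natural[OF P]
  note I = image_closure[OF S P N]
  have "locally C J c (\<lambda>f. res P f x = res P f y)"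
    if c: "c \<in> Ob C" and x: "x \<in> val P c" and y: "y \<in> val P c"
      and eq: "graph_closure P c x = graph_closure P c y" for c x y
  proof -
    have "locally C J c (\<lambda>f. res P f x = res P (Ide C c \<cdot>\<^bsub>C\<^esub> f) x)"
      by (rule locally_always) (use c in simp_all)
    then have "(Ide C c, x) \<in> graph_closure P c x" unfolding graph_closure_iff using c x by simp
    then have "locally C J c (\<lambda>f. res P f x = res P (Ide C c \<cdot>\<^bsub>C\<^esub> f) y)"
      unfolding eq graph_closure_iff using c by simp
    then show ?thesis by (rule locally_mono[OF c]) simp
  qed
  then have "locally_bijective C J P (image_closure P (closed_sub_psh P) (graph_closure P)) (graph_closure P)"
    unfolding locally_bijective_def using I(2,3) by blast
  then show ?thesis by (rule that[OF I(1)])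
qed

lemma sheaf_iso:
  assumes F: "sheaf C J F" and F': "presheaf C F'" and \<alpha>: "natural C F F' \<alpha>" and \<alpha>': "natural C F' F \<alpha>'"
    and inv: "\<And>c x. c \<in> Ob C \<Longrightarrow> x \<in> val F' c \<Longrightarrow> \<alpha> c (\<alpha>' c x) = x"
  shows "sheaf C J F'"
proof (rule sheafI[OF F'])
  fix c R assume c: "c \<in> Ob C" and R: "R \<in> J c"
  have RA: "\<And>f. f \<in> R \<Longrightarrow> f \<in> Arr C \<and> Cod C f = c" using J_Arr[OF c R] .
  show "x = y" if x: "x \<in> val F' c" "y \<in> val F' c" and eq: "\<And>f. f \<in> R \<Longrightarrow> res F' f x = res F' f y" for x y
  proof -
    have "\<alpha>' c x = \<alpha>' c y"
    proof (rule sheaf_separated[OF F c])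
      show "\<alpha>' c x \<in> val F c" "\<alpha>' c y \<in> val F c" using natural_val[OF \<alpha>' c] x by blast+
      have "\<forall>f \<in> R. res F f (\<alpha>' c x) = res F f (\<alpha>' c y)"
        using natural_res[OF \<alpha>'] RA x eq by metis
      then show "locally C J c (\<lambda>f. res F f (\<alpha>' c x) = res F f (\<alpha>' c y))"
        using R unfolding locally_def by blast
    qed
    then show ?thesis using inv[OF c] x by metis
  qed
  fix x assume m: "matching_family C F' R x"
  then have m': "\<And>f. f \<in> R \<Longrightarrow> x f \<in> val F' (Dom C f)"
    "\<And>f g. f \<in> R \<Longrightarrow> g \<in> Arr C \<Longrightarrow> Cod C g = Dom C f \<Longrightarrow> res F' g (x f) = x (f \<cdot>\<^bsub>C\<^esub> g)"
    unfolding matching_family_def by blast+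
  have "matching_family C F R (\<lambda>f. \<alpha>' (Dom C f) (x f))"
  proof (rule matching_familyI)
    fix f assume f: "f \<in> R"
    show "\<alpha>' (Dom C f) (x f) \<in> val F (Dom C f)" using natural_val[OF \<alpha>'] m'(1)[OF f] RA[OF f] by simp
    fix g assume g: "g \<in> Arr C" "Cod C g = Dom C f"
    show "res F g (\<alpha>' (Dom C f) (x f)) = \<alpha>' (Dom C (f \<cdot>\<^bsub>C\<^esub> g)) (x (f \<cdot>\<^bsub>C\<^esub> g))"
      using natural_res[OF \<alpha>' g(1), of "x f"] m'(1)[OF f] m'(2)[OF f g] RA[OF f] g by simp
  qed
  then obtain y where y: "y \<in> val F c" "\<forall>f \<in> R. res F f y = \<alpha>' (Dom C f) (x f)"
    by (rule sheaf_amalgam[OF F c R])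
  have "res F' f (\<alpha> c y) = x f" if f: "f \<in> R" for f
    using natural_res[OF \<alpha>, of f y] RA[OF f] y f inv[of "Dom C f" "x f"] m'(1)[OF f] by auto
  moreover have "\<alpha> c y \<in> val F' c" using natural_val[OF \<alpha> c y(1)] .
  ultimately show "\<exists>y \<in> val F' c. \<forall>f \<in> R. res F' f y = x f" by blast
qed

end

locale small_site = topology C J for C :: "('o, 'a) cat" and J +
  fixes U :: "'u set set"
  assumes univ: "set_universe U" and site: "site U C J"
begin

lemma ex_generators:
  obtains B where "B \<subseteq> Ob C" "small U B"
    "\<And>c. c \<in> Ob C \<Longrightarrow> locally C J c (\<lambda>h. \<exists>g f. f \<in> Arr C \<and> g \<in> Arr C \<and> Cod C f = Dom C g \<and>
        Dom C g \<in> B \<and> Cod C g = c \<and> h = g \<cdot>\<^bsub>C\<^esub> f)"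
proof -
  obtain B where B: "B \<subseteq> Ob C" "small U B"
    "\<And>c. c \<in> Ob C \<Longrightarrow> {g \<cdot>\<^bsub>C\<^esub> f | g f. f \<in> Arr C \<and> g \<in> Arr C \<and> Cod C f = Dom C g \<and>
                       Dom C g \<in> B \<and> Cod C g = c} \<in> J c"
    using site unfolding site_def by blast
  show ?thesis
    by (rule that[OF B(1,2)]) (unfold locally_def, rule bexI[OF _ B(3)], blast+)
qed

lemma hom_small: "a \<in> Ob C \<Longrightarrow> b \<in> Ob C \<Longrightarrow> small U (hom C a b)"
  using site unfolding site_def by blast

text \<open>A section \<open>s\<close> of \<open>F\<close> is coded by a function on the arrows from the generators: at each of them
  it records a preimage of the restriction of \<open>s\<close>, or that there is none. Wherever \<open>s\<close> has a preimage,
  the code determines its restrictions along all arrows through a generator, and these cover. So two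
  sections with the same code are locally equal.\<close>

lemma sheaf_usmall:
  assumes F: "sheaf C J F" and P: "presheaf C P" and \<eta>: "natural C P F \<eta>"
    and surj: "\<And>c s. c \<in> Ob C \<Longrightarrow> s \<in> val F c \<Longrightarrow>
      locally C J c (\<lambda>f. \<exists>x \<in> val P (Dom C f). res F f s = \<eta> (Dom C f) x)"
    and us: "\<And>c. c \<in> Ob C \<Longrightarrow> usmall U (val P c)" and c: "c \<in> Ob C"
  shows "usmall U (val F c)"
proof -
  have FP: "presheaf C F" using F sheaf_presheaf by blast
  obtain B where B: "B \<subseteq> Ob C" "small U B"
    "\<And>c. c \<in> Ob C \<Longrightarrow> locally C J c (\<lambda>h. \<exists>g f. f \<in> Arr C \<and> g \<in> Arr C \<and> Cod C f = Dom C g \<and>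
        Dom C g \<in> B \<and> Cod C g = c \<and> h = g \<cdot>\<^bsub>C\<^esub> f)" by (rule ex_generators) (rule that)
  let ?A = "\<Union>b \<in> B. hom C b c"
  have A: "small U ?A" by (rule small_UN[OF univ B(2)]) (use hom_small B(1) c in blast)
  have X: "usmall U (\<Union>b \<in> B. val P b)" (is "usmall U ?X")
    by (rule usmall_UN[OF univ small_imp_usmall[OF univ B(2)]]) (use us B(1) in blast)
  let ?O = "insert None (Some ` ?X)"
  (* an arbitrary choice of preimages, with None where there is none *)
  define t where "t s = (\<lambda>f \<in> ?A. if \<exists>x \<in> val P (Dom C f). res F f s = \<eta> (Dom C f) x
     then Some (SOME x. x \<in> val P (Dom C f) \<and> res F f s = \<eta> (Dom C f) x) else None)" for s
  have tS: "\<exists>x \<in> val P (Dom C f). t s f = Some x \<and> res F f s = \<eta> (Dom C f) x"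
    if "f \<in> ?A" "\<exists>x \<in> val P (Dom C f). res F f s = \<eta> (Dom C f) x" for f s
  proof -
    have "\<exists>x. x \<in> val P (Dom C f) \<and> res F f s = \<eta> (Dom C f) x" using that(2) by blast
    from someI_ex[OF this] show ?thesis unfolding t_def using that by auto
  qed
  have tD: "res F f s = \<eta> (Dom C f) x" if "f \<in> ?A" "t s f = Some x" for f s x
  proof -
    have ex: "\<exists>x. x \<in> val P (Dom C f) \<and> res F f s = \<eta> (Dom C f) x"
      using that unfolding t_def by (auto split: if_splits)
    from someI_ex[OF this] show ?thesis using that unfolding t_def by (auto split: if_splits)
  qed
  have "inj_on t (val F c)"
  proof (rule inj_onI)
    fix s s' assume s: "s \<in> val F c" "s' \<in> val F c" and eq: "t s = t s'"
    show "s = s'"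
    proof (rule sheaf_separated[OF F c s])
      show "locally C J c (\<lambda>f. res F f s = res F f s')"
      proof (rule locally_trans[OF c surj[OF c s(1)]])
        fix w assume w: "w \<in> Arr C" "Cod C w = c" and "\<exists>x \<in> val P (Dom C w). res F w s = \<eta> (Dom C w) x"
        then obtain x where x: "x \<in> val P (Dom C w)" "res F w s = \<eta> (Dom C w) x" by blast
        show "locally C J (Dom C w) (\<lambda>h. res F (w \<cdot>\<^bsub>C\<^esub> h) s = res F (w \<cdot>\<^bsub>C\<^esub> h) s')"
        proof (rule locally_mono[OF _ B(3)])
          fix h assume "\<exists>g f. f \<in> Arr C \<and> g \<in> Arr C \<and> Cod C f = Dom C g \<and>
             Dom C g \<in> B \<and> Cod C g = Dom C w \<and> h = g \<cdot>\<^bsub>C\<^esub> f"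
          then obtain g f where h: "f \<in> Arr C" "g \<in> Arr C" "Cod C f = Dom C g" "Dom C g \<in> B"
            "Cod C g = Dom C w" "h = g \<cdot>\<^bsub>C\<^esub> f" by blast
          have wg: "w \<cdot>\<^bsub>C\<^esub> g \<in> ?A" using h w unfolding hom_def by auto
          have "res F (w \<cdot>\<^bsub>C\<^esub> g) s = \<eta> (Dom C g) (res P g x)"
            using h w x s natural_res[OF \<eta> h(2), of x] by (simp add: res_comp[OF FP])
          then have "\<exists>x \<in> val P (Dom C (w \<cdot>\<^bsub>C\<^esub> g)). res F (w \<cdot>\<^bsub>C\<^esub> g) s = \<eta> (Dom C (w \<cdot>\<^bsub>C\<^esub> g)) x"
            using h w x P by (intro bexI[of _ "res P g x"]) simp_all
          from tS[OF wg this] obtain y where y: "t s (w \<cdot>\<^bsub>C\<^esub> g) = Some y"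
            "res F (w \<cdot>\<^bsub>C\<^esub> g) s = \<eta> (Dom C (w \<cdot>\<^bsub>C\<^esub> g)) y" by blast
          have "res F (w \<cdot>\<^bsub>C\<^esub> g) s' = \<eta> (Dom C (w \<cdot>\<^bsub>C\<^esub> g)) y" by (rule tD[OF wg]) (use y eq in simp)
          with y have "res F (w \<cdot>\<^bsub>C\<^esub> g) s = res F (w \<cdot>\<^bsub>C\<^esub> g) s'" by simp
          then have "res F ((w \<cdot>\<^bsub>C\<^esub> g) \<cdot>\<^bsub>C\<^esub> f) s = res F ((w \<cdot>\<^bsub>C\<^esub> g) \<cdot>\<^bsub>C\<^esub> f) s'"
            using res_comp[OF FP, of "w \<cdot>\<^bsub>C\<^esub> g" f] h w s by (simp del: comp_assoc)
          then show "res F (w \<cdot>\<^bsub>C\<^esub> h) s = res F (w \<cdot>\<^bsub>C\<^esub> h) s'" using h w by simp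
        qed (use w in simp_all)
      qed
    qed
  qed
  moreover have "t ` val F c \<subseteq> (?A \<rightarrow>\<^sub>E ?O)"
  proof (rule image_subsetI)
    fix s
    show "t s \<in> ?A \<rightarrow>\<^sub>E ?O"
    proof (rule PiE_I)
      fix f assume f: "f \<in> ?A"
      have "Dom C f \<in> B" using f unfolding hom_def by auto
      show "t s f \<in> ?O"
      proof (cases "\<exists>x \<in> val P (Dom C f). res F f s = \<eta> (Dom C f) x")
        case True
        from tS[OF f this] show ?thesis using \<open>Dom C f \<in> B\<close> by auto
      next
        case False then show ?thesis unfolding t_def using f by simp
      qed
    next
      fix f assume "f \<notin> ?A" then show "t s f = undefined" unfolding t_def
          by (rule restrict_apply[THEN trans, OF if_not_P])
    qed
  qed
  ultimately have "val F c \<lesssim> (?A \<rightarrow>\<^sub>E ?O)" unfolding lepoll_def by blast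
  then show ?thesis by (rule usmall_lepoll[OF usmall_funcset[OF univ A usmall_Some[OF univ X]]])
qed

lemma ex_sheaf_code:
  assumes F: "sheaf C J F" and us: "\<And>c. c \<in> Ob C \<Longrightarrow> usmall U (val F c)"
  obtains F' \<alpha> \<alpha>' where "F' \<in> sheaves U C J" "natural C F F' \<alpha>" "natural C F' F \<alpha>'"
    "\<And>c x. c \<in> Ob C \<Longrightarrow> x \<in> val F c \<Longrightarrow> \<alpha>' c (\<alpha> c x) = x"
    "\<And>c x. c \<in> Ob C \<Longrightarrow> x \<in> val F' c \<Longrightarrow> \<alpha> c (\<alpha>' c x) = x"
proof -
  have FP: "presheaf C F" using F sheaf_presheaf by blast
  have "\<forall>c \<in> Ob C. \<exists>e. inj_on e (val F c) \<and> e ` val F c \<in> U"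
    using usmall_code[OF univ us] by metis
  then obtain e where e: "\<And>c. c \<in> Ob C \<Longrightarrow> inj_on (e c) (val F c)" "\<And>c. c \<in> Ob C \<Longrightarrow> e c ` val F c \<in> U"
    by metis
  let ?V = "\<lambda>c. e c ` val F c"
  define d where "d c = the_inv_into (val F c) (e c)" for c
  have de: "d c (e c x) = x" if "c \<in> Ob C" "x \<in> val F c" for c x
    unfolding d_def using the_inv_into_f_f[OF e(1)] that by blast
  define F' where "F' = \<lparr>val = \<lambda>c \<in> Ob C. ?V c,
     res = \<lambda>f \<in> Arr C. \<lambda>x \<in> ?V (Cod C f). e (Dom C f) (res F f (d (Cod C f) x))\<rparr>"
  have valF': "val F' c = ?V c" if "c \<in> Ob C" for c using that unfolding F'_def by simp
  have resF': "res F' f (e (Cod C f) x) = e (Dom C f) (res F f x)" if "f \<in> Arr C" "x \<in> val F (Cod C f)" for f x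
    using that de unfolding F'_def by simp
  have P': "presheaf C F'" unfolding F'_def
    by (rule presheaf_mk) (use de FP in \<open>auto simp: res_comp[OF FP]\<close>)
  have n: "natural C F F' e" by (rule naturalI) (use valF' resF' in auto)
  have n': "natural C F' F d" by (rule naturalI) (use valF' resF' de FP in auto)
  have ed: "e c (d c x) = x" if "c \<in> Ob C" "x \<in> val F' c" for c x using that valF' de by auto
  have "F' \<in> sheaves U C J"
    unfolding sheaves_def using sheaf_iso[OF F P' n n' ed] valF' e(2) by simp
  then show ?thesis by (rule that[OF _ n n' de ed])
qed

lemma sheavesD: "F \<in> sheaves U C J \<Longrightarrow> sheaf C J F" "F \<in> sheaves U C J \<Longrightarrow> presheaf C F"
  "F \<in> sheaves U C J \<Longrightarrow> c \<in> Ob C \<Longrightarrow> val F c \<in> U"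
  unfolding sheaves_def using sheaf_presheaf by auto

lemma ex_sheafification:
  fixes P :: "('o, 'a, 'v) psh"
  assumes P: "presheaf C P" and us: "\<And>c. c \<in> Ob C \<Longrightarrow> usmall U (val P c)"
  obtains F \<eta> where "F \<in> sheaves U C J" "locally_bijective C J P F \<eta>"
proof -
  obtain F0 :: "('o, 'a, ('a \<times> 'v) set) psh" and \<eta> where F0: "sheaf C J F0"
      and lb: "locally_bijective C J P F0 \<eta>"
    by (rule ex_locally_bijective[OF P]) (rule that, assumption+)
  note \<eta> = locally_bijectiveD[OF lb]
  have F0P: "presheaf C F0" using F0 sheaf_presheaf by blast
  have us0: "usmall U (val F0 c)" if "c \<in> Ob C" for c
    by (rule sheaf_usmall[OF F0 P \<eta>(1) \<eta>(3) us that])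
  obtain F \<alpha> \<alpha>' where F: "F \<in> sheaves U C J" "natural C F0 F \<alpha>" "natural C F F0 \<alpha>'"
    "\<And>c x. c \<in> Ob C \<Longrightarrow> x \<in> val F0 c \<Longrightarrow> \<alpha>' c (\<alpha> c x) = x"
    "\<And>c x. c \<in> Ob C \<Longrightarrow> x \<in> val F c \<Longrightarrow> \<alpha> c (\<alpha>' c x) = x"
    by (rule ex_sheaf_code[OF F0 us0]) (assumption | rule that)+
  have "locally_bijective C J P F (\<lambda>c x. \<alpha> c (\<eta> c x))"
    unfolding locally_bijective_def
  proof (intro conjI ballI impI)
    show "natural C P F (\<lambda>c x. \<alpha> c (\<eta> c x))" by (rule natural_o[OF \<eta>(1) F(2)])
    fix c assume c: "c \<in> Ob C"
    show "locally C J c (\<lambda>f. res P f x = res P f y)"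
      if "x \<in> val P c" "y \<in> val P c" "\<alpha> c (\<eta> c x) = \<alpha> c (\<eta> c y)" for x y
    proof (rule \<eta>(2)[OF c that(1,2)])
      show "\<eta> c x = \<eta> c y" using that F(4)[OF c] natural_val[OF \<eta>(1) c] by metis
    qed
    fix s assume s: "s \<in> val F c"
    have s': "\<alpha>' c s \<in> val F0 c" by (rule natural_val[OF F(3) c s])
    show "locally C J c (\<lambda>f. \<exists>x \<in> val P (Dom C f). res F f s = \<alpha> (Dom C f) (\<eta> (Dom C f) x))"
    proof (rule locally_mono[OF c \<eta>(3)[OF c s']])
      fix f assume f: "f \<in> Arr C" "Cod C f = c"
        and "\<exists>x \<in> val P (Dom C f). res F0 f (\<alpha>' c s) = \<eta> (Dom C f) x"
      then obtain x where x: "x \<in> val P (Dom C f)" "res F0 f (\<alpha>' c s) = \<eta> (Dom C f) x" by blast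
      have "\<alpha> (Dom C f) (res F0 f (\<alpha>' c s)) = res F f s"
        using natural_res[OF F(2) f(1), of "\<alpha>' c s"] s' f F(5)[OF c s] by simp
      then show "\<exists>x \<in> val P (Dom C f). res F f s = \<alpha> (Dom C f) (\<eta> (Dom C f) x)" using x
          by (intro bexI[of _ x]) simp_all
    qed
  qed
  then show ?thesis by (rule that[OF F(1)])
qed

lemma locally_bijective_sheafification:
  assumes lb: "locally_bijective C J P F \<eta>" and P: "presheaf C P" and F: "F \<in> sheaves U C J"
  shows "is_sheafification U C J P F (ext_nat C P \<eta>)"
  unfolding is_sheafification_def
proof (intro conjI ballI allI impI F)
  note \<eta> = locally_bijectiveD[OF lb]
  note FS = sheavesD[OF F]
  show "nat_trans C P F (ext_nat C P \<eta>)" by (rule natural_nat_trans[OF P \<eta>(1)])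
  fix G \<alpha> assume G: "G \<in> sheaves U C J" and \<alpha>: "nat_trans C P G \<alpha>"
  obtain \<beta> where \<beta>: "natural C F G \<beta>" "\<And>c x. c \<in> Ob C \<Longrightarrow> x \<in> val P c \<Longrightarrow> \<beta> c (\<eta> c x) = \<alpha> c x"
    by (rule locally_bijective_universal[OF lb P FS(2) sheavesD(1)[OF G] nat_trans_natural[OF \<alpha>]]) blast
  note \<eta>v = natural_val[OF \<eta>(1)]
  show "\<exists>!\<beta>. nat_trans C F G \<beta> \<and> nt_comp C P \<beta> (ext_nat C P \<eta>) = \<alpha>"
  proof (rule ex1I[of _ "ext_nat C F \<beta>"], rule conjI)
    show n: "nat_trans C F G (ext_nat C F \<beta>)" by (rule natural_nat_trans[OF FS(2) \<beta>(1)])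
    show "nt_comp C P (ext_nat C F \<beta>) (ext_nat C P \<eta>) = \<alpha>"
    proof (rule nat_trans_ext[OF _ \<alpha>])
      show "nat_trans C P G (nt_comp C P (ext_nat C F \<beta>) (ext_nat C P \<eta>))"
        unfolding nt_comp_ext_nat
        by (rule natural_nat_trans[OF P])
          (rule natural_o[OF nat_trans_natural[OF natural_nat_trans[OF P \<eta>(1)]] nat_trans_natural[OF n]])
    qed (use \<beta>(2) \<eta>v in simp)
    fix \<beta>' assume b: "nat_trans C F G \<beta>' \<and> nt_comp C P \<beta>' (ext_nat C P \<eta>) = \<alpha>"
    then have b': "natural C F G \<beta>'" using nat_trans_natural by blast
    show "\<beta>' = ext_nat C F \<beta>"
    proof (rule nat_trans_ext[OF conjunct1[OF b] n])
      fix c s assume c: "c \<in> Ob C" and s: "s \<in> val F c"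
      have "\<beta>' c s = \<beta> c s"
      proof (rule locally_surj_unique[OF \<eta>(3) sheavesD(1)[OF G] FS(2) b' \<beta>(1) _ c s])
        fix c x assume c: "c \<in> Ob C" and x: "x \<in> val P c"
        have "\<beta>' c (\<eta> c x) = nt_comp C P \<beta>' (ext_nat C P \<eta>) c x" using c x by simp
        then show "\<beta>' c (\<eta> c x) = \<beta> c (\<eta> c x)" using b \<beta>(2)[OF c x] by simp
      qed
      then show "\<beta>' c s = ext_nat C F \<beta> c s" using c s by simp
    qed
  qed
qed

text \<open>The universal property in \<open>is_sheafification\<close>, in terms of natural maps that need not be
  extensional.\<close>

definition sheaf_reflection :: "('o, 'a, 'v) psh \<Rightarrow> ('o, 'a, 'u) psh \<Rightarrow> ('o \<Rightarrow> 'v \<Rightarrow> 'u) \<Rightarrow> bool" where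
  "sheaf_reflection P F \<eta> \<longleftrightarrow> F \<in> sheaves U C J \<and> natural C P F \<eta> \<and>
    (\<forall>G \<in> sheaves U C J. \<forall>\<alpha>. natural C P G \<alpha> \<longrightarrow>
       (\<exists>\<beta>. nat_trans C F G \<beta> \<and> (\<forall>c \<in> Ob C. \<forall>x \<in> val P c. \<beta> c (\<eta> c x) = \<alpha> c x))) \<and>
    (\<forall>G \<in> sheaves U C J. \<forall>\<beta> \<beta>'. natural C F G \<beta> \<longrightarrow> natural C F G \<beta>' \<longrightarrow>
       (\<forall>c \<in> Ob C. \<forall>x \<in> val P c. \<beta> c (\<eta> c x) = \<beta>' c (\<eta> c x)) \<longrightarrow>
       (\<forall>c \<in> Ob C. \<forall>s \<in> val F c. \<beta> c s = \<beta>' c s))"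

lemma sheaf_reflectionD:
  assumes "sheaf_reflection P F \<eta>"
  shows "F \<in> sheaves U C J" "natural C P F \<eta>"
    and "G \<in> sheaves U C J \<Longrightarrow> natural C P G \<alpha> \<Longrightarrow>
       \<exists>\<beta>. nat_trans C F G \<beta> \<and> (\<forall>c \<in> Ob C. \<forall>x \<in> val P c. \<beta> c (\<eta> c x) = \<alpha> c x)"
    and "G \<in> sheaves U C J \<Longrightarrow> natural C F G \<beta> \<Longrightarrow> natural C F G \<beta>' \<Longrightarrow>
       (\<And>c x. c \<in> Ob C \<Longrightarrow> x \<in> val P c \<Longrightarrow> \<beta> c (\<eta> c x) = \<beta>' c (\<eta> c x)) \<Longrightarrow>
       c \<in> Ob C \<Longrightarrow> s \<in> val F c \<Longrightarrow> \<beta> c s = \<beta>' c s"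
  using assms unfolding sheaf_reflection_def by blast+

lemma is_sheafification_reflection:
  assumes sh: "is_sheafification U C J P F \<eta>" and P: "presheaf C P"
  shows "sheaf_reflection P F \<eta>"
  unfolding sheaf_reflection_def
proof (intro conjI ballI allI impI)
  show F: "F \<in> sheaves U C J" and \<eta>: "natural C P F \<eta>"
    using sh nat_trans_natural unfolding is_sheafification_def by blast+
  have univp: "\<And>G \<alpha>. G \<in> sheaves U C J \<Longrightarrow> nat_trans C P G \<alpha> \<Longrightarrow>
     \<exists>!\<beta>. nat_trans C F G \<beta> \<and> nt_comp C P \<beta> \<eta> = \<alpha>"
    using sh unfolding is_sheafification_def by blast
  show "\<exists>\<beta>. nat_trans C F G \<beta> \<and> (\<forall>c \<in> Ob C. \<forall>x \<in> val P c. \<beta> c (\<eta> c x) = \<alpha> c x)"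
    if G: "G \<in> sheaves U C J" and \<alpha>: "natural C P G \<alpha>" for G \<alpha>
  proof -
    obtain \<beta> where b: "nat_trans C F G \<beta>" "nt_comp C P \<beta> \<eta> = ext_nat C P \<alpha>"
      using univp[OF G natural_nat_trans[OF P \<alpha>]] by blast
    have "\<beta> c (\<eta> c x) = \<alpha> c x" if "c \<in> Ob C" "x \<in> val P c" for c x
      using fun_cong[OF fun_cong[OF b(2)], of c x] that by simp
    then show ?thesis using b(1) by blast
  qed
  show "\<beta> c s = \<beta>' c s"
    if G: "G \<in> sheaves U C J" and b: "natural C F G \<beta>" "natural C F G \<beta>'"
      and eq: "\<forall>c \<in> Ob C. \<forall>x \<in> val P c. \<beta> c (\<eta> c x) = \<beta>' c (\<eta> c x)"
      and cs: "c \<in> Ob C" "s \<in> val F c" for G \<beta> \<beta>' c s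
  proof -
    note FP = sheavesD(2)[OF F]
    note nb = natural_nat_trans[OF FP b(1)] natural_nat_trans[OF FP b(2)]
    note \<eta>v = natural_val[OF \<eta>]
    have "nt_comp C P (ext_nat C F \<beta>) \<eta> = nt_comp C P (ext_nat C F \<beta>') \<eta>"
      unfolding nt_comp_def using eq \<eta>v by (intro restrict_ext) simp
    moreover have "nat_trans C P G (nt_comp C P (ext_nat C F \<beta>') \<eta>)"
      unfolding nt_comp_ext_nat
      by (rule natural_nat_trans[OF P]) (rule natural_o[OF \<eta> nat_trans_natural[OF nb(2)]])
    ultimately have "ext_nat C F \<beta> = ext_nat C F \<beta>'"
      using univp[OF G] nb by blast
    then have "ext_nat C F \<beta> c s = ext_nat C F \<beta>' c s" by simp
    then show ?thesis using cs by simp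
  qed
qed

text \<open>Reflections are unique up to isomorphism, so every one of them inherits the local bijectivity
  of the one constructed above.\<close>

lemma sheaf_reflection_locally_bijective:
  assumes sh: "sheaf_reflection P F \<eta>" and P: "presheaf C P"
    and us: "\<And>c. c \<in> Ob C \<Longrightarrow> usmall U (val P c)"
  shows "locally_bijective C J P F \<eta>"
proof -
  note S = sheaf_reflectionD[OF sh]
  note FS = sheavesD[OF S(1)]
  obtain G \<theta> where G: "G \<in> sheaves U C J" and lb: "locally_bijective C J P G \<theta>"
    by (rule ex_sheafification[OF P us])
  note \<theta> = locally_bijectiveD[OF lb]
  obtain \<beta> where b: "nat_trans C F G \<beta>" "\<And>c x. c \<in> Ob C \<Longrightarrow> x \<in> val P c \<Longrightarrow> \<beta> c (\<eta> c x) = \<theta> c x"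
    using S(3)[OF G \<theta>(1)] by blast
  have bn: "natural C F G \<beta>" using b(1) nat_trans_natural by blast
  obtain \<gamma> where g: "natural C G F \<gamma>" "\<And>c x. c \<in> Ob C \<Longrightarrow> x \<in> val P c \<Longrightarrow> \<gamma> c (\<theta> c x) = \<eta> c x"
    by (rule locally_bijective_universal[OF lb P sheavesD(2)[OF G] FS(1) S(2)]) blast
  have gb: "\<gamma> c (\<beta> c s) = s" if "c \<in> Ob C" "s \<in> val F c" for c s
    by (rule S(4)[OF S(1) natural_o[OF bn g(1)] _ _ that, of "\<lambda>c s. s"])
      (use b(2) g(2) in \<open>auto simp: natural_def\<close>)
  show ?thesis unfolding locally_bijective_def
  proof (intro conjI ballI impI S(2))
    fix c assume c: "c \<in> Ob C"
    show "locally C J c (\<lambda>f. res P f x = res P f y)"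
      if "x \<in> val P c" "y \<in> val P c" "\<eta> c x = \<eta> c y" for x y
      by (rule \<theta>(2)[OF c that(1,2)]) (use b(2)[OF c] that in metis)
    fix s assume s: "s \<in> val F c"
    have s': "\<beta> c s \<in> val G c" by (rule natural_val[OF bn c s])
    show "locally C J c (\<lambda>f. \<exists>x \<in> val P (Dom C f). res F f s = \<eta> (Dom C f) x)"
    proof (rule locally_mono[OF c \<theta>(3)[OF c s']])
      fix f assume f: "f \<in> Arr C" "Cod C f = c"
        and "\<exists>x \<in> val P (Dom C f). res G f (\<beta> c s) = \<theta> (Dom C f) x"
      then obtain x where x: "x \<in> val P (Dom C f)" "res G f (\<beta> c s) = \<theta> (Dom C f) x" by blast
      have "\<gamma> (Dom C f) (res G f (\<beta> c s)) = res F f s"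
        using natural_res[OF g(1) f(1), of "\<beta> c s"] s' f gb[OF c s] by simp
      then show "\<exists>x \<in> val P (Dom C f). res F f s = \<eta> (Dom C f) x"
        using x g(2)[of "Dom C f" x] f by (intro bexI[of _ x]) simp_all
    qed
  qed
qed

end

section \<open>Sheafified representables and cofinality\<close>

lemma Sh_simps [simp]:
  "Ob (Sh U C J) = sheaves U C J"
  "Dom (Sh U C J) (F, \<alpha>, G) = F" "Cod (Sh U C J) (F, \<alpha>, G) = G"
  "(G, \<beta>, H) \<cdot>\<^bsub>Sh U C J\<^esub> (F, \<alpha>, G') = (F, nt_comp C F \<beta> \<alpha>, H)"
  "(F, \<alpha>, G) \<in> Arr (Sh U C J) \<longleftrightarrow> F \<in> sheaves U C J \<and> G \<in> sheaves U C J \<and> nat_trans C F G \<alpha>"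
  unfolding Sh_def by simp_all

lemma Sh_hom_iff: "x \<in> hom (Sh U C J) F G \<longleftrightarrow>
    (\<exists>\<alpha>. x = (F, \<alpha>, G) \<and> F \<in> sheaves U C J \<and> G \<in> sheaves U C J \<and> nat_trans C F G \<alpha>)"
  unfolding hom_def by (cases x) auto

lemma Sh_homE:
  assumes "x \<in> hom (Sh U C J) F G"
  obtains \<alpha> where "x = (F, \<alpha>, G)" "F \<in> sheaves U C J" "G \<in> sheaves U C J" "nat_trans C F G \<alpha>"
  using assms unfolding Sh_hom_iff by blast

lemma Sh_Ide: "Ide (Sh U C J) F = (F, ext_nat C F (\<lambda>c x. x), F)"
  unfolding Sh_def ext_nat_def by simp

lemma ex1_implies_eq: "\<exists>!x. Q x \<Longrightarrow> Q a \<Longrightarrow> Q b \<Longrightarrow> a = b"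
  by blast

lemma hom_iff: "f \<in> hom C a b \<longleftrightarrow> f \<in> Arr C \<and> Dom C f = a \<and> Cod C f = b"
  unfolding hom_def by simp

context plain_cat
begin

lemma presheaf_yoneda: "presheaf C (yoneda_obj C c)"
  unfolding yoneda_obj_def by (rule presheaf_mk) (auto simp: hom_iff)

lemma val_yoneda: "b \<in> Ob C \<Longrightarrow> val (yoneda_obj C c) b = hom C b c"
  and res_yoneda: "f \<in> Arr C \<Longrightarrow> g \<in> hom C (Cod C f) c \<Longrightarrow> res (yoneda_obj C c) f g = g \<cdot>\<^bsub>C\<^esub> f"
  unfolding yoneda_obj_def by simp_all

lemma natural_yoneda:
  assumes F: "presheaf C F" and z: "z \<in> val F c"
  shows "natural C (yoneda_obj C c) F (\<lambda>b v. res F v z)"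
  by (rule naturalI) (use z in \<open>auto simp: val_yoneda res_yoneda hom_iff res_comp[OF F] res_val[OF F]\<close>)

lemma natural_yoneda_eq:
  assumes F: "presheaf C F" and \<alpha>: "natural C (yoneda_obj C c) F \<alpha>" and v: "v \<in> hom C b c"
  shows "\<alpha> b v = res F v (\<alpha> c (Ide C c))"
  using natural_res[OF \<alpha>, of v "Ide C c"] v by (auto simp: val_yoneda res_yoneda hom_iff)

lemma nat_trans_comp:
  assumes "presheaf C P" "nat_trans C P Q \<alpha>" "nat_trans C Q R \<beta>"
  shows "nat_trans C P R (nt_comp C P \<beta> \<alpha>)"
  unfolding nt_comp_ext_nat
  by (rule natural_nat_trans[OF assms(1)]) (rule natural_o[OF assms(2,3)[THEN nat_trans_natural]])

end

context small_site
begin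

text \<open>The pair \<open>(L, e)\<close> represents the functor of sections at \<open>c\<close> on sheaves, so that \<open>L\<close> is
  \<open>l\<^sub>J c\<close> up to isomorphism. The value of the left adjoint of precomposition at \<open>l\<^sub>K d\<close> is such a
  sheaf \<open>L\<close>, with \<open>c = p d\<close>.\<close>

definition representing :: "'o \<Rightarrow> ('o, 'a, 'u) psh \<Rightarrow> 'u \<Rightarrow> bool" where
  "representing c L e \<longleftrightarrow> c \<in> Ob C \<and> L \<in> sheaves U C J \<and> e \<in> val L c \<and>
     (\<forall>F \<in> sheaves U C J. \<forall>z \<in> val F c. \<exists>\<beta>. nat_trans C L F \<beta> \<and> \<beta> c e = z) \<and>
     (\<forall>F \<in> sheaves U C J. \<forall>\<beta> \<beta>'. natural C L F \<beta> \<longrightarrow> natural C L F \<beta>' \<longrightarrow> \<beta> c e = \<beta>' c e \<longrightarrow>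
        (\<forall>b \<in> Ob C. \<forall>s \<in> val L b. \<beta> b s = \<beta>' b s))"

lemma representingD:
  assumes "representing c L e"
  shows "c \<in> Ob C" "L \<in> sheaves U C J" "e \<in> val L c"
    and "F \<in> sheaves U C J \<Longrightarrow> z \<in> val F c \<Longrightarrow> \<exists>\<beta>. nat_trans C L F \<beta> \<and> \<beta> c e = z"
    and "F \<in> sheaves U C J \<Longrightarrow> natural C L F \<beta> \<Longrightarrow> natural C L F \<beta>' \<Longrightarrow> \<beta> c e = \<beta>' c e \<Longrightarrow>
        b \<in> Ob C \<Longrightarrow> s \<in> val L b \<Longrightarrow> \<beta> b s = \<beta>' b s"
  using assms unfolding representing_def by blast+

lemma representing_ext:
  assumes L: "representing c L e" and F: "F \<in> sheaves U C J"
    and \<beta>: "nat_trans C L F \<beta>" "nat_trans C L F \<beta>'" and eq: "\<beta> c e = \<beta>' c e"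
  shows "\<beta> = \<beta>'"
  by (rule nat_trans_ext[OF \<beta>])
    (rule representingD(5)[OF L F \<beta>[THEN nat_trans_natural] eq])

lemma usmall_yoneda: "c \<in> Ob C \<Longrightarrow> b \<in> Ob C \<Longrightarrow> usmall U (val (yoneda_obj C c) b)"
  using small_imp_usmall[OF univ hom_small] by (simp add: val_yoneda)

text \<open>By the Yoneda lemma, representing the sections at \<open>c\<close> is the same as reflecting the
  representable presheaf of \<open>c\<close>, with \<open>v \<mapsto> L(v) e\<close> as unit.\<close>

lemma representing_locally_bijective:
  assumes "representing c L e"
  shows "locally_bijective C J (yoneda_obj C c) L (\<lambda>b v. res L v e)"
proof -
  note R = representingD[OF assms]
  note LP = sheavesD(2)[OF R(2)]
  have "sheaf_reflection (yoneda_obj C c) L (\<lambda>b v. res L v e)"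
    unfolding sheaf_reflection_def
  proof (intro conjI ballI allI impI R(2) natural_yoneda[OF LP R(3)])
    fix G \<alpha> assume G: "G \<in> sheaves U C J" and \<alpha>: "natural C (yoneda_obj C c) G \<alpha>"
    have "\<alpha> c (Ide C c) \<in> val G c"
      by (rule natural_val[OF \<alpha>]) (use R(1) in \<open>simp_all add: val_yoneda hom_iff\<close>)
    then obtain \<beta> where \<beta>: "nat_trans C L G \<beta>" "\<beta> c e = \<alpha> c (Ide C c)" using R(4)[OF G] by blast
    have "\<beta> b (res L v e) = \<alpha> b v" if "b \<in> Ob C" "v \<in> val (yoneda_obj C c) b" for b v
      using natural_res[OF nat_trans_natural[OF \<beta>(1)], of v e] that R \<beta>(2)
        natural_yoneda_eq[OF sheavesD(2)[OF G] \<alpha>, of v b] by (auto simp: val_yoneda hom_iff)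
    then show "\<exists>\<beta>. nat_trans C L G \<beta> \<and> (\<forall>b \<in> Ob C. \<forall>v \<in> val (yoneda_obj C c) b. \<beta> b (res L v e) = \<alpha> b v)"
      using \<beta>(1) by blast
  next
    fix G \<beta> \<beta>' b s
    assume a: "G \<in> sheaves U C J" "natural C L G \<beta>" "natural C L G \<beta>'"
      "\<forall>b \<in> Ob C. \<forall>v \<in> val (yoneda_obj C c) b. \<beta> b (res L v e) = \<beta>' b (res L v e)" "b \<in> Ob C" "s \<in> val L b"
    have "\<beta> c (res L (Ide C c) e) = \<beta>' c (res L (Ide C c) e)"
      using a(4) R(1) by (auto simp: val_yoneda hom_iff)
    then have "\<beta> c e = \<beta>' c e" using LP R by simp
    then show "\<beta> b s = \<beta>' b s" using R(5) a by blast
  qed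
  then show ?thesis
    by (rule sheaf_reflection_locally_bijective[OF _ presheaf_yoneda usmall_yoneda[OF R(1)]])
qed

abbreviation l_obj :: "'o \<Rightarrow> ('o, 'a, 'u) psh" where
  "l_obj c \<equiv> sh_obj U C J (yoneda_obj C c)"

text \<open>By the Yoneda lemma this element determines the whole unit of the sheafification, and it makes
  \<open>l_obj c\<close> a representing object.\<close>

definition l_elem :: "'o \<Rightarrow> 'u" where
  "l_elem c = sh_unit U C J (yoneda_obj C c) c (Ide C c)"

lemma sheafification_works:
  assumes P: "presheaf C P" and us: "\<And>c. c \<in> Ob C \<Longrightarrow> usmall U (val P c)"
  shows "is_sheafification U C J P (sh_obj U C J P) (sh_unit U C J P)"
proof -
  obtain F \<eta> where "F \<in> sheaves U C J" "locally_bijective C J P F \<eta>" by (rule ex_sheafification[OF P us]) 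
  then have "is_sheafification U C J P F (ext_nat C P \<eta>)"
    by (intro locally_bijective_sheafification P)
  then have "\<exists>x. case x of (F, \<eta>) \<Rightarrow> is_sheafification U C J P F \<eta>" by blast
  from someI_ex[OF this] show ?thesis
    unfolding sh_obj_def sh_unit_def sheafification_def
    by (cases "SOME (F, \<eta>). is_sheafification U C J P F \<eta>") simp
qed

lemma l_reflection:
  assumes c: "c \<in> Ob C"
  shows "sheaf_reflection (yoneda_obj C c) (l_obj c) (sh_unit U C J (yoneda_obj C c))"
  by (rule is_sheafification_reflection[OF sheafification_works[OF presheaf_yoneda usmall_yoneda[OF c]]
      presheaf_yoneda])

lemma l_unit_eq:
  assumes c: "c \<in> Ob C" and v: "v \<in> hom C b c"
  shows "sh_unit U C J (yoneda_obj C c) b v = res (l_obj c) v (l_elem c)"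
  unfolding l_elem_def
  using natural_yoneda_eq[OF sheavesD(2) _ v] sheaf_reflectionD(1,2)[OF l_reflection[OF c]] by blast

lemma l_representing:
  assumes c: "c \<in> Ob C"
  shows "representing c (l_obj c) (l_elem c)"
  unfolding representing_def
proof (intro conjI ballI allI impI c)
  note R = sheaf_reflectionD[OF l_reflection[OF c]]
  note LP = sheavesD(2)[OF R(1)]
  show "l_obj c \<in> sheaves U C J" by (rule R(1))
  show "l_elem c \<in> val (l_obj c) c" unfolding l_elem_def
    by (rule natural_val[OF R(2) c]) (use c in \<open>simp add: val_yoneda hom_iff\<close>)
  fix F assume F: "F \<in> sheaves U C J"
  note FP = sheavesD(2)[OF F]
  show "\<exists>\<beta>. nat_trans C (l_obj c) F \<beta> \<and> \<beta> c (l_elem c) = z" if z: "z \<in> val F c" for z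
  proof -
    obtain \<beta> where "nat_trans C (l_obj c) F \<beta>"
      "\<forall>b \<in> Ob C. \<forall>v \<in> val (yoneda_obj C c) b. \<beta> b (sh_unit U C J (yoneda_obj C c) b v) = res F v z"
      using R(3)[OF F natural_yoneda[OF FP z]] by blast
    then show ?thesis unfolding l_elem_def using c z FP by (auto simp: val_yoneda hom_iff)
  qed
  fix \<beta> \<beta>' b s
  assume b: "natural C (l_obj c) F \<beta>" "natural C (l_obj c) F \<beta>'" and eq: "\<beta> c (l_elem c) = \<beta>' c (l_elem c)"
    and bs: "b \<in> Ob C" "s \<in> val (l_obj c) b"
  show "\<beta> b s = \<beta>' b s"
  proof (rule R(4)[OF F b _ bs])
    fix a v assume a: "a \<in> Ob C" and "v \<in> val (yoneda_obj C c) a"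
    then have v: "v \<in> hom C a c" by (simp add: val_yoneda)
    have e: "l_elem c \<in> val (l_obj c) (Cod C v)" using \<open>l_elem c \<in> val (l_obj c) c\<close> v by (simp add: hom_iff)
    show "\<beta> a (sh_unit U C J (yoneda_obj C c) a v) = \<beta>' a (sh_unit U C J (yoneda_obj C c) a v)"
      unfolding l_unit_eq[OF c v]
      using natural_res[OF b(1) _ e] natural_res[OF b(2) _ e] eq v by (auto simp: hom_iff)
  qed
qed

lemma l_amap:
  assumes h: "h \<in> hom C b c"
  obtains \<beta> where "amap (l_functor U C J) h = (l_obj b, \<beta>, l_obj c)"
    "nat_trans C (l_obj b) (l_obj c) \<beta>" "\<beta> b (l_elem b) = res (l_obj c) h (l_elem c)"
proof -
  have b: "b \<in> Ob C" and c: "c \<in> Ob C" and hA: "h \<in> Arr C" "Dom C h = b" "Cod C h = c"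
    using h by (auto simp: hom_iff)
  let ?P = "yoneda_obj C b" and ?Q = "yoneda_obj C c"
  note sP = sheafification_works[OF presheaf_yoneda usmall_yoneda[OF b]]
  note R = sheaf_reflectionD[OF l_reflection[OF c]]
  have n: "natural C ?P ?Q (yoneda_arr C h)"
    by (rule naturalI) (use hA in \<open>auto simp: yoneda_arr_def val_yoneda res_yoneda hom_iff\<close>)
  have "nat_trans C ?P (l_obj c) (nt_comp C ?P (sh_unit U C J ?Q) (yoneda_arr C h))"
    unfolding nt_comp_ext_nat by (rule natural_nat_trans[OF presheaf_yoneda natural_o[OF n R(2)]])
  then have "\<exists>!\<beta>. nat_trans C (l_obj b) (l_obj c) \<beta> \<and>
     nt_comp C ?P \<beta> (sh_unit U C J ?P) = nt_comp C ?P (sh_unit U C J ?Q) (yoneda_arr C h)"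
    using sP R(1) unfolding is_sheafification_def by blast
  from theI'[OF this] obtain \<beta> where \<beta>: "amap (l_functor U C J) h = (l_obj b, \<beta>, l_obj c)"
    "nat_trans C (l_obj b) (l_obj c) \<beta>"
    "nt_comp C ?P \<beta> (sh_unit U C J ?P) = nt_comp C ?P (sh_unit U C J ?Q) (yoneda_arr C h)"
    unfolding l_functor_def sh_map_def using hA by auto
  have "\<beta> b (l_elem b) = sh_unit U C J ?Q b h"
    using fun_cong[OF fun_cong[OF \<beta>(3)], of b "Ide C b"] b hA
    unfolding l_elem_def by (simp add: val_yoneda hom_iff yoneda_arr_def)
  then show ?thesis using that[OF \<beta>(1,2)] l_unit_eq[OF c h] by simp
qed

lemma l_omap: "omap (l_functor U C J) c = l_obj c"
  unfolding l_functor_def by simp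

text \<open>By the Yoneda lemma these are the cocones with vertex \<open>F\<close> on the diagram in the definition of
  \<open>J_cofinal\<close>.\<close>

definition compatible_family :: "('i, 'j) cat \<Rightarrow> ('i, 'j, 'o \<times> 'a, ('o \<times> 'a) \<times> 'a \<times> ('o \<times> 'a)) funct \<Rightarrow>
    ('o, 'a, 'u) psh \<Rightarrow> ('i \<Rightarrow> 'u) \<Rightarrow> bool" where
  "compatible_family I G F y \<longleftrightarrow> (\<forall>i \<in> Ob I. y i \<in> val F (fst (omap G i))) \<and>
     (\<forall>u \<in> Arr I. res F (fst (snd (amap G u))) (y (Cod I u)) = y (Dom I u))"

text \<open>The Yoneda correspondence between arrows from \<open>l_obj b\<close> and elements at \<open>b\<close>.\<close>

definition elt :: "'o \<Rightarrow> ('o, 'a, 'u) sh_arr \<Rightarrow> 'u" where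
  "elt b k = fst (snd k) b (l_elem b)"

lemma elt_in: "b \<in> Ob C \<Longrightarrow> k \<in> hom (Sh U C J) (l_obj b) F \<Longrightarrow> elt b k \<in> val F b"
  unfolding Sh_hom_iff elt_def
  using natural_val[OF nat_trans_natural] representingD(3)[OF l_representing] by fastforce

lemma elt_ext:
  assumes "b \<in> Ob C" "k \<in> hom (Sh U C J) (l_obj b) F" "k' \<in> hom (Sh U C J) (l_obj b) F" "elt b k = elt b k'"
  shows "k = k'"
  using assms(2-4) representing_ext[OF l_representing[OF assms(1)]] unfolding Sh_hom_iff elt_def by auto

lemma ex_elt:
  assumes "b \<in> Ob C" "F \<in> sheaves U C J" "z \<in> val F b"
  obtains k where "k \<in> hom (Sh U C J) (l_obj b) F" "elt b k = z"
proof -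
  note r = l_representing[OF assms(1)]
  obtain \<beta> where "nat_trans C (l_obj b) F \<beta>" "\<beta> b (l_elem b) = z" using representingD(4)[OF r assms(2,3)]
      by blast
  then show ?thesis
    using that[of "(l_obj b, \<beta>, F)"] representingD(2)[OF r] assms(2) unfolding Sh_hom_iff elt_def by simp
qed

lemma category_Sh: "category (Sh U C J)"
proof
  let ?S = "Sh U C J"
  have id: "nat_trans C F F (ext_nat C F (\<lambda>c x. x))" if "F \<in> sheaves U C J" for F
    by (rule natural_nat_trans[OF sheavesD(2)[OF that]]) (simp add: natural_def)
  have cmp: "nat_trans C F H (nt_comp C F \<beta> \<alpha>)"
    if "F \<in> sheaves U C J" "nat_trans C F G \<alpha>" "nat_trans C G H \<beta>" for F G H \<alpha> \<beta>
    using nat_trans_comp[OF sheavesD(2)[OF that(1)] that(2,3)] .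
  note nv = natural_val[OF nat_trans_natural]
  show "f \<in> Arr ?S \<Longrightarrow> Dom ?S f \<in> Ob ?S" "f \<in> Arr ?S \<Longrightarrow> Cod ?S f \<in> Ob ?S" for f by (cases f, simp)+
  show "Ide ?S F \<in> hom ?S F F" if "F \<in> Ob ?S" for F using that id by (simp add: Sh_Ide Sh_hom_iff)
  show "g \<cdot>\<^bsub>?S\<^esub> f \<in> hom ?S F H" if "f \<in> hom ?S F G" "g \<in> hom ?S G H" for f g F G H
    using that cmp by (auto simp: Sh_hom_iff)
  show "Ide ?S G \<cdot>\<^bsub>?S\<^esub> f = f" "f \<cdot>\<^bsub>?S\<^esub> Ide ?S F = f" if f: "f \<in> hom ?S F G" for f F G
  proof -
    obtain \<alpha> where e: "f = (F, \<alpha>, G)" "F \<in> sheaves U C J" "G \<in> sheaves U C J" "nat_trans C F G \<alpha>"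
      using f unfolding Sh_hom_iff by blast
    have "nt_comp C F (ext_nat C G (\<lambda>c x. x)) \<alpha> = \<alpha>"
      by (rule nat_trans_ext[OF cmp[OF e(2,4) id[OF e(3)]] e(4)]) (use nv[OF e(4)] in simp)
    then show "Ide ?S G \<cdot>\<^bsub>?S\<^esub> f = f" unfolding e(1) by (simp add: Sh_Ide)
    have "nt_comp C F \<alpha> (ext_nat C F (\<lambda>c x. x)) = \<alpha>"
      by (rule nat_trans_ext[OF cmp[OF e(2) id[OF e(2)] e(4)] e(4)]) simp
    then show "f \<cdot>\<^bsub>?S\<^esub> Ide ?S F = f" unfolding e(1) by (simp add: Sh_Ide)
  qed
  show "(h \<cdot>\<^bsub>?S\<^esub> g) \<cdot>\<^bsub>?S\<^esub> f = h \<cdot>\<^bsub>?S\<^esub> (g \<cdot>\<^bsub>?S\<^esub> f)"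
    if f: "f \<in> hom ?S E F" and g: "g \<in> hom ?S F G" and h: "h \<in> hom ?S G H" for f g h E F G H
  proof -
    obtain \<alpha> \<beta> \<gamma> where e: "f = (E, \<alpha>, F)" "g = (F, \<beta>, G)" "h = (G, \<gamma>, H)" "E \<in> sheaves U C J"
        "F \<in> sheaves U C J"
      and n: "nat_trans C E F \<alpha>" "nat_trans C F G \<beta>" "nat_trans C G H \<gamma>"
      using f g h unfolding Sh_hom_iff by blast
    have "nt_comp C E (nt_comp C F \<gamma> \<beta>) \<alpha> = nt_comp C E \<gamma> (nt_comp C E \<beta> \<alpha>)"
      by (rule nat_trans_ext[OF cmp[OF e(4) n(1) cmp[OF e(5) n(2,3)]] cmp[OF e(4) cmp[OF e(4) n(1,2)] n(3)]])
        (use nv[OF n(1)] in simp)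
    then show ?thesis unfolding e by simp
  qed
qed

lemma l_hom:
  assumes h: "h \<in> hom C b c"
  shows "amap (l_functor U C J) h \<in> hom (Sh U C J) (l_obj b) (l_obj c)"
    and "k \<in> hom (Sh U C J) (l_obj c) F \<Longrightarrow> elt b (k \<cdot>\<^bsub>Sh U C J\<^esub> amap (l_functor U C J) h) = res F h (elt c k)"
    and "elt b (amap (l_functor U C J) h) = res (l_obj c) h (l_elem c)"
proof -
  have hA: "h \<in> Arr C" "Dom C h = b" "Cod C h = c" "b \<in> Ob C" "c \<in> Ob C" using h by (auto simp: hom_iff)
  note b = representingD(2,3)[OF l_representing[OF hA(4)]]
      and c = representingD(2,3)[OF l_representing[OF hA(5)]]
  obtain \<beta> where \<beta>: "amap (l_functor U C J) h = (l_obj b, \<beta>, l_obj c)"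
    "nat_trans C (l_obj b) (l_obj c) \<beta>" "\<beta> b (l_elem b) = res (l_obj c) h (l_elem c)" by (rule l_amap[OF h])
  show "amap (l_functor U C J) h \<in> hom (Sh U C J) (l_obj b) (l_obj c)" unfolding \<beta>(1) Sh_hom_iff using b c \<beta>(2)
      by blast
  show "elt b (amap (l_functor U C J) h) = res (l_obj c) h (l_elem c)" unfolding \<beta>(1) elt_def using \<beta>(3) by simp
  show "elt b (k \<cdot>\<^bsub>Sh U C J\<^esub> amap (l_functor U C J) h) = res F h (elt c k)"
    if "k \<in> hom (Sh U C J) (l_obj c) F" for k
    using that natural_res[OF nat_trans_natural hA(1), of "l_obj c" F _ "l_elem c"] hA b c \<beta>(3)
    unfolding \<beta>(1) Sh_hom_iff elt_def by auto
qed

text \<open>The canonical arrow is an isomorphism if and only if \<open>l_obj c\<close>, with the images of the structure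
  arrows as injections, is itself a colimit. Cocones with vertex \<open>F\<close> are compatible families and arrows
  from \<open>l_obj c\<close> to \<open>F\<close> are elements of \<open>F c\<close>; in these terms the universal property is the right-hand
  side.\<close>

lemma J_cofinal_iff:
  assumes c: "c \<in> Ob C" and G: "is_functor I (slice_cat C c) G"
    and I: "\<And>u. u \<in> Arr I \<Longrightarrow> Dom I u \<in> Ob I \<and> Cod I u \<in> Ob I"
  shows "J_cofinal U C J c I G \<longleftrightarrow> (\<forall>F \<in> sheaves U C J.
     (\<forall>y. compatible_family I G F y \<longrightarrow> (\<exists>z \<in> val F c. \<forall>i \<in> Ob I. res F (snd (omap G i)) z = y i)) \<and>
     (\<forall>z \<in> val F c. \<forall>z' \<in> val F c.
        (\<forall>i \<in> Ob I. res F (snd (omap G i)) z = res F (snd (omap G i)) z') \<longrightarrow> z = z'))"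
    (is "_ \<longleftrightarrow> (\<forall>F \<in> _. ?ext F \<and> ?uniq F)")
proof -
  let ?b = "\<lambda>i. fst (omap G i)" and ?v = "\<lambda>i. snd (omap G i)" and ?w = "\<lambda>u. fst (snd (amap G u))"
  let ?S = "Sh U C J" and ?l = "amap (l_functor U C J)"
  let ?X = "functor_comp (l_functor U C J) (functor_comp slice_proj G)"
  interpret S: category ?S by (rule category_Sh)
  have v: "?v i \<in> hom C (?b i) c" if "i \<in> Ob I" for i
    using G that unfolding is_functor_def slice_cat_def by fastforce
  have b: "?b i \<in> Ob C" if "i \<in> Ob I" for i
    using v[OF that] Dom_Ob[of "?v i"] unfolding hom_iff by auto
  have w: "?w u \<in> hom C (?b (Dom I u)) (?b (Cod I u))" "?v (Cod I u) \<cdot>\<^bsub>C\<^esub> ?w u = ?v (Dom I u)"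
    if u: "u \<in> Arr I" for u
  proof -
    have a: "amap G u \<in> hom (slice_cat C c) (omap G (Dom I u)) (omap G (Cod I u))"
      using G u unfolding is_functor_def by blast
    obtain b1 v1 w' b2 v2 where e: "amap G u = ((b1, v1), w', (b2, v2))" by (metis prod.collapse)
    have "omap G (Dom I u) = (b1, v1)" "omap G (Cod I u) = (b2, v2)" "w' \<in> hom C b1 b2" "v2 \<cdot>\<^bsub>C\<^esub> w' = v1"
      using a unfolding e hom_iff[of _ "slice_cat C c"] unfolding slice_cat_def by auto
    then show "?w u \<in> hom C (?b (Dom I u)) (?b (Cod I u))" "?v (Cod I u) \<cdot>\<^bsub>C\<^esub> ?w u = ?v (Dom I u)"
      unfolding e by simp_all
  qed
  have Xo: "omap ?X i = l_obj (?b i)" and Xa: "amap ?X u = ?l (?w u)" for i u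
    by (simp_all add: functor_comp_def slice_proj_def l_omap case_prod_beta)
  note lv = l_hom[OF v] and lw = l_hom[OF w(1)]
  (* an arrow out of l_obj (?b i) is determined by its value at the universal element *)
  have cocone_elts: "cocone I ?S ?X F \<kappa> \<longleftrightarrow> F \<in> sheaves U C J \<and>
      (\<forall>i \<in> Ob I. \<kappa> i \<in> hom ?S (l_obj (?b i)) F) \<and> compatible_family I G F (\<lambda>i. elt (?b i) (\<kappa> i))" for F \<kappa>
  proof -
    have "\<kappa> (Cod I u) \<cdot>\<^bsub>?S\<^esub> ?l (?w u) = \<kappa> (Dom I u) \<longleftrightarrow>
        res F (?w u) (elt (?b (Cod I u)) (\<kappa> (Cod I u))) = elt (?b (Dom I u)) (\<kappa> (Dom I u))"
      if k: "\<forall>i \<in> Ob I. \<kappa> i \<in> hom ?S (l_obj (?b i)) F" and u: "u \<in> Arr I" for u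
    proof -
      have kk: "\<kappa> (Cod I u) \<in> hom ?S (l_obj (?b (Cod I u))) F" "\<kappa> (Dom I u) \<in> hom ?S (l_obj (?b (Dom I u))) F"
        using k I[OF u] by blast+
      show ?thesis
        using lw(2)[OF u kk(1)] elt_ext[OF b[OF conjunct1[OF I[OF u]]] S.Comp_in[OF lw(1)[OF u] kk(1)] kk(2)]
            by auto
    qed
    moreover have "elt (?b i) (\<kappa> i) \<in> val F (?b i)" if "\<kappa> i \<in> hom ?S (l_obj (?b i)) F" "i \<in> Ob I" for i
      using elt_in[OF b[OF that(2)] that(1)] .
    ultimately show ?thesis unfolding cocone_def compatible_family_def Xo Xa Sh_simps(1) by blast
  qed
  show ?thesis
  proof
    assume "J_cofinal U C J c I G"
    then obtain L \<iota> m where col: "is_colimit I ?S ?X L \<iota>" and m: "m \<in> hom ?S L (l_obj c)"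
      and mi: "\<And>i. i \<in> Ob I \<Longrightarrow> m \<cdot>\<^bsub>?S\<^esub> \<iota> i = ?l (?v i)" and iso: "is_iso ?S m"
      unfolding J_cofinal_def l_omap by blast
    obtain n where n: "n \<in> hom ?S (l_obj c) L" "n \<cdot>\<^bsub>?S\<^esub> m = Ide ?S L" "m \<cdot>\<^bsub>?S\<^esub> n = Ide ?S (l_obj c)"
    proof -
      have "Dom ?S m = L" "Cod ?S m = l_obj c" using m unfolding hom_iff by auto
      then show ?thesis using iso that unfolding is_iso_def by fastforce
    qed
    have \<iota>: "\<iota> i \<in> hom ?S (l_obj (?b i)) L" if "i \<in> Ob I" for i
      using col that unfolding is_colimit_def cocone_elts by blast
    show "\<forall>F \<in> sheaves U C J. ?ext F \<and> ?uniq F"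
    proof (intro ballI conjI allI impI)
      fix F y assume F: "F \<in> sheaves U C J" and y: "compatible_family I G F y"
      have "\<forall>i \<in> Ob I. \<exists>k. k \<in> hom ?S (l_obj (?b i)) F \<and> elt (?b i) k = y i"
        using ex_elt[OF b F] y unfolding compatible_family_def by metis
      then obtain \<kappa> where \<kappa>: "\<And>i. i \<in> Ob I \<Longrightarrow> \<kappa> i \<in> hom ?S (l_obj (?b i)) F"
          "\<And>i. i \<in> Ob I \<Longrightarrow> elt (?b i) (\<kappa> i) = y i"
        by metis
      have "cocone I ?S ?X F \<kappa>"
        unfolding cocone_elts using F \<kappa> y I unfolding compatible_family_def by simp
      then obtain k where k: "k \<in> hom ?S L F" "\<And>i. i \<in> Ob I \<Longrightarrow> k \<cdot>\<^bsub>?S\<^esub> \<iota> i = \<kappa> i"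
        using col unfolding is_colimit_def by blast
      have kn: "k \<cdot>\<^bsub>?S\<^esub> n \<in> hom ?S (l_obj c) F" by (rule S.Comp_in[OF n(1) k(1)])
      have "res F (?v i) (elt c (k \<cdot>\<^bsub>?S\<^esub> n)) = y i" if i: "i \<in> Ob I" for i
      proof -
        have "(k \<cdot>\<^bsub>?S\<^esub> n) \<cdot>\<^bsub>?S\<^esub> ?l (?v i) = k \<cdot>\<^bsub>?S\<^esub> (n \<cdot>\<^bsub>?S\<^esub> (m \<cdot>\<^bsub>?S\<^esub> \<iota> i))"
          unfolding mi[OF i] by (rule S.Comp_assoc[OF lv(1)[OF i] n(1) k(1)])
        also have "n \<cdot>\<^bsub>?S\<^esub> (m \<cdot>\<^bsub>?S\<^esub> \<iota> i) = \<iota> i"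
          using S.Comp_assoc[OF \<iota>[OF i] m n(1)] n(2) S.Ide_left[OF \<iota>[OF i]] by simp
        finally show ?thesis using lv(2)[OF i kn] k(2)[OF i] \<kappa>(2)[OF i] by simp
      qed
      then show "\<exists>z \<in> val F c. \<forall>i \<in> Ob I. res F (?v i) z = y i" using elt_in[OF c kn] by blast
    next
      fix F z z' assume F: "F \<in> sheaves U C J" and z: "z \<in> val F c" "z' \<in> val F c"
        and eq: "\<forall>i \<in> Ob I. res F (?v i) z = res F (?v i) z'"
      obtain g where g: "g \<in> hom ?S (l_obj c) F" "elt c g = z" by (rule ex_elt[OF c F z(1)])
      obtain g' where g': "g' \<in> hom ?S (l_obj c) F" "elt c g' = z'" by (rule ex_elt[OF c F z(2)])
      note gm = S.Comp_in[OF m g(1)] and gm' = S.Comp_in[OF m g'(1)]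
      have gi: "(h \<cdot>\<^bsub>?S\<^esub> m) \<cdot>\<^bsub>?S\<^esub> \<iota> i = h \<cdot>\<^bsub>?S\<^esub> ?l (?v i)" if "h \<in> hom ?S (l_obj c) F" "i \<in> Ob I" for h i
        using S.Comp_assoc[OF \<iota>[OF that(2)] m that(1)] mi[OF that(2)] by simp
      have e: "(g \<cdot>\<^bsub>?S\<^esub> m) \<cdot>\<^bsub>?S\<^esub> \<iota> i = (g' \<cdot>\<^bsub>?S\<^esub> m) \<cdot>\<^bsub>?S\<^esub> \<iota> i" if i: "i \<in> Ob I" for i
        by (rule elt_ext[OF b[OF i] S.Comp_in[OF \<iota>[OF i] gm] S.Comp_in[OF \<iota>[OF i] gm']])
          (use gi[OF _ i] lv(2)[OF i] g g' eq i in simp)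
      have "cocone I ?S ?X F (\<lambda>i. (g \<cdot>\<^bsub>?S\<^esub> m) \<cdot>\<^bsub>?S\<^esub> \<iota> i)"
        unfolding cocone_def Xo Xa
      proof (intro conjI ballI)
        fix u assume u: "u \<in> Arr I"
        have iu: "Dom I u \<in> Ob I" "Cod I u \<in> Ob I" using I[OF u] by auto
        have "\<iota> (Cod I u) \<cdot>\<^bsub>?S\<^esub> ?l (?w u) = \<iota> (Dom I u)" using col u unfolding is_colimit_def cocone_def Xa
            by blast
        then show "((g \<cdot>\<^bsub>?S\<^esub> m) \<cdot>\<^bsub>?S\<^esub> \<iota> (Cod I u)) \<cdot>\<^bsub>?S\<^esub> ?l (?w u) = (g \<cdot>\<^bsub>?S\<^esub> m) \<cdot>\<^bsub>?S\<^esub> \<iota> (Dom I u)"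
          using S.Comp_assoc[OF lw(1)[OF u] \<iota>[OF iu(2)] gm] by simp
      qed (use F S.Comp_in[OF \<iota> gm] in simp_all)
      then have ex1: "\<exists>!k. k \<in> hom ?S L F \<and> (\<forall>i \<in> Ob I. k \<cdot>\<^bsub>?S\<^esub> \<iota> i = (g \<cdot>\<^bsub>?S\<^esub> m) \<cdot>\<^bsub>?S\<^esub> \<iota> i)"
        using col unfolding is_colimit_def by blast
      have "g \<cdot>\<^bsub>?S\<^esub> m = g' \<cdot>\<^bsub>?S\<^esub> m" by (rule ex1_implies_eq[OF ex1]) (use gm gm' e in simp_all)
      then have "g = g'"
        using S.Comp_assoc[OF n(1) m g(1)] S.Comp_assoc[OF n(1) m g'(1)] n(3) S.Ide_right[OF g(1)]
            S.Ide_right[OF g'(1)] by metis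
      then show "z = z'" using g(2) g'(2) by simp
    qed
  next
    assume A: "\<forall>F \<in> sheaves U C J. ?ext F \<and> ?uniq F"
    have Lc: "l_obj c \<in> sheaves U C J" by (rule representingD(2)[OF l_representing[OF c]])
    have ide: "Ide ?S (l_obj c) \<in> hom ?S (l_obj c) (l_obj c)" using S.Ide_in Lc by simp
    have "cocone I ?S ?X (l_obj c) (\<lambda>i. ?l (?v i))"
      unfolding cocone_elts compatible_family_def
    proof (intro conjI ballI Lc lv(1))
      show "elt (?b i) (?l (?v i)) \<in> val (l_obj c) (?b i)" if "i \<in> Ob I" for i using elt_in[OF b lv(1)] that
          by blast
      fix u assume u: "u \<in> Arr I"
      have iu: "Dom I u \<in> Ob I" "Cod I u \<in> Ob I" using I[OF u] by auto
      show "res (l_obj c) (?w u) (elt (?b (Cod I u)) (?l (?v (Cod I u)))) = elt (?b (Dom I u)) (?l (?v (Dom I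
          u)))"
        using lv(3)[OF iu(1)] lv(3)[OF iu(2)] res_comp[OF sheavesD(2)[OF Lc], of "?v (Cod I u)" "?w u"
            "l_elem c"]
          v[OF iu(2)] w[OF u] representingD(3)[OF l_representing[OF c]] by (simp add: hom_iff)
    qed
    moreover have "\<exists>!k. k \<in> hom ?S (l_obj c) M \<and> (\<forall>i \<in> Ob I. k \<cdot>\<^bsub>?S\<^esub> ?l (?v i) = \<kappa> i)"
      if "cocone I ?S ?X M \<kappa>" for M \<kappa>
    proof -
      have M: "M \<in> sheaves U C J" and \<kappa>: "\<And>i. i \<in> Ob I \<Longrightarrow> \<kappa> i \<in> hom ?S (l_obj (?b i)) M"
        and y: "compatible_family I G M (\<lambda>i. elt (?b i) (\<kappa> i))" using that unfolding cocone_elts by auto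
      have eq: "k \<cdot>\<^bsub>?S\<^esub> ?l (?v i) = \<kappa> i \<longleftrightarrow> res M (?v i) (elt c k) = elt (?b i) (\<kappa> i)"
        if k: "k \<in> hom ?S (l_obj c) M" and i: "i \<in> Ob I" for k i
        using lv(2)[OF i k] elt_ext[OF b[OF i] S.Comp_in[OF lv(1)[OF i] k] \<kappa>[OF i]] by auto
      obtain z where z: "z \<in> val M c" "\<forall>i \<in> Ob I. res M (?v i) z = elt (?b i) (\<kappa> i)" using A M y by blast
      obtain k where k: "k \<in> hom ?S (l_obj c) M" "elt c k = z" by (rule ex_elt[OF c M z(1)])
      show ?thesis
      proof (rule ex1I[of _ k])
        show "k \<in> hom ?S (l_obj c) M \<and> (\<forall>i \<in> Ob I. k \<cdot>\<^bsub>?S\<^esub> ?l (?v i) = \<kappa> i)" using k eq[OF k(1)] z(2) by blast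
        fix k' assume k': "k' \<in> hom ?S (l_obj c) M \<and> (\<forall>i \<in> Ob I. k' \<cdot>\<^bsub>?S\<^esub> ?l (?v i) = \<kappa> i)"
        then have "\<forall>i \<in> Ob I. res M (?v i) (elt c k') = res M (?v i) z"
          using eq[OF conjunct1[OF k']] z(2) by simp
        then have "elt c k' = z" using A M z(1) elt_in[OF c] k' by blast
        then show "k' = k" by (intro elt_ext[OF c conjunct1[OF k'] k(1)]) (simp add: k(2))
      qed
    qed
    moreover have "Ide ?S (l_obj c) \<cdot>\<^bsub>?S\<^esub> ?l (?v i) = ?l (?v i)" if "i \<in> Ob I" for i
      by (rule S.Ide_left[OF lv(1)[OF that]])
    moreover have "is_iso ?S (Ide ?S (l_obj c))"
      unfolding is_iso_def using ide S.Ide_left[OF ide] unfolding hom_iff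
          by (auto intro!: bexI[of _ "Ide ?S (l_obj c)"] simp: hom_iff)
    ultimately show "J_cofinal U C J c I G"
      unfolding J_cofinal_def l_omap is_colimit_def using G ide by blast
  qed
qed

end

section \<open>The fibration condition as a descent condition\<close>

lemma left_adjointE:
  assumes "left_adjoint A B L R"
  obtains \<eta> where "is_functor A B L"
    "\<And>a. a \<in> Ob A \<Longrightarrow> \<eta> a \<in> hom A a (omap R (omap L a))"
    "\<And>f. f \<in> Arr A \<Longrightarrow> \<eta> (Cod A f) \<cdot>\<^bsub>A\<^esub> f = amap R (amap L f) \<cdot>\<^bsub>A\<^esub> \<eta> (Dom A f)"
    "\<And>a b f. a \<in> Ob A \<Longrightarrow> b \<in> Ob B \<Longrightarrow> f \<in> hom A a (omap R b) \<Longrightarrow>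
       \<exists>!g. g \<in> hom B (omap L a) b \<and> amap R g \<cdot>\<^bsub>A\<^esub> \<eta> a = f"
proof -
  obtain \<eta> where \<eta>: "\<forall>a \<in> Ob A. \<eta> a \<in> hom A a (omap R (omap L a))"
    "\<forall>f \<in> Arr A. \<eta> (Cod A f) \<cdot>\<^bsub>A\<^esub> f = amap R (amap L f) \<cdot>\<^bsub>A\<^esub> \<eta> (Dom A f)"
    "\<forall>a \<in> Ob A. \<forall>b \<in> Ob B. \<forall>f \<in> hom A a (omap R b).
       \<exists>!g. g \<in> hom B (omap L a) b \<and> amap R g \<cdot>\<^bsub>A\<^esub> \<eta> a = f"
    and "is_functor A B L"
    using assms unfolding left_adjoint_def by (elim conjE exE) (rule that)
  then show ?thesis by (intro that[of \<eta>]) (rule \<eta>[rule_format] | assumption)+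
qed

lemma cartesian_arrowE:
  assumes "cartesian_arrow A B q v" "g \<in> Arr A" "Cod A g = Cod A v"
    "h \<in> hom B (omap q (Dom A g)) (omap q (Dom A v))" "amap q v \<cdot>\<^bsub>B\<^esub> h = amap q g"
  obtains h' where "h' \<in> hom A (Dom A g) (Dom A v)" "amap q h' = h" "v \<cdot>\<^bsub>A\<^esub> h' = g"
  using assms unfolding cartesian_arrow_def by blast

locale cont_comorphism =
  D: small_site D K U + C: small_site C J U
  for D :: "('d, 'b) cat" and K and C :: "('o, 'a) cat" and J and U :: "'u set set" +
  fixes p :: "('d, 'b, 'o, 'a) funct"
  assumes cont: "continuous_comorphism U D K C J p"
begin

lemma p_functor: "is_functor D C p"
  using cont unfolding continuous_comorphism_def comorphism_def by blast

lemma p_Ob [simp]: "d \<in> Ob D \<Longrightarrow> omap p d \<in> Ob C"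
  and p_Arr [simp]: "k \<in> Arr D \<Longrightarrow> amap p k \<in> Arr C"
  and p_Dom [simp]: "k \<in> Arr D \<Longrightarrow> Dom C (amap p k) = omap p (Dom D k)"
  and p_Cod [simp]: "k \<in> Arr D \<Longrightarrow> Cod C (amap p k) = omap p (Cod D k)"
  and p_Ide [simp]: "d \<in> Ob D \<Longrightarrow> amap p (Ide D d) = Ide C (omap p d)"
  and p_comp [simp]: "k \<in> Arr D \<Longrightarrow> l \<in> Arr D \<Longrightarrow> Cod D l = Dom D k \<Longrightarrow>
    amap p (k \<cdot>\<^bsub>D\<^esub> l) = amap p k \<cdot>\<^bsub>C\<^esub> amap p l"
  using p_functor unfolding is_functor_def hom_def by auto

text \<open>The covering lifting property of a comorphism.\<close>

lemma locally_lift: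
  assumes d: "d \<in> Ob D" and Q: "locally C J (omap p d) Q"
  shows "locally D K d (\<lambda>k. Q (amap p k))"
proof -
  obtain R where R: "R \<in> J (omap p d)" "\<forall>f \<in> R. Q f" using Q unfolding locally_def by blast
  then obtain T where "T \<in> K d" "amap p ` T \<subseteq> R"
    using cont d unfolding continuous_comorphism_def comorphism_def by blast
  then show ?thesis using R(2) unfolding locally_def by blast
qed

abbreviation pre :: "('o, 'a, 'u) psh \<Rightarrow> ('d, 'b, 'u) psh" where
  "pre F \<equiv> precomp_obj D p F"

lemma val_pre [simp]: "d \<in> Ob D \<Longrightarrow> val (pre F) d = val F (omap p d)"
  and res_pre [simp]: "k \<in> Arr D \<Longrightarrow> res (pre F) k = res F (amap p k)"
  unfolding precomp_obj_def by simp_all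

lemma pre_sheaf: "F \<in> sheaves U C J \<Longrightarrow> pre F \<in> sheaves U D K"
  using cont unfolding continuous_comorphism_def by blast

lemma pre_natural: "natural C F G \<alpha> \<Longrightarrow> natural D (pre F) (pre G) (\<lambda>d. \<alpha> (omap p d))"
  by (rule naturalI) (use natural_val[of C F G \<alpha>] natural_res[of C F G \<alpha>, OF _ p_Arr] in simp_all)

lemma naturalD_pre:
  assumes "natural D P (pre F) \<eta>"
  shows "d \<in> Ob D \<Longrightarrow> x \<in> val P d \<Longrightarrow> \<eta> d x \<in> val F (omap p d)"
    and "k \<in> Arr D \<Longrightarrow> x \<in> val P (Cod D k) \<Longrightarrow> \<eta> (Dom D k) (res P k x) = res F (amap p k) (\<eta> (Cod D k) x)"
  using natural_val[OF assms] natural_res[OF assms] by simp_all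

text \<open>A universal arrow from \<open>P\<close> to precomposition with \<open>p\<close>: the sheaf \<open>Q\<close> is the value at \<open>P\<close> of the
  left adjoint, up to isomorphism.\<close>

definition free_along :: "('d, 'b, 'u) psh \<Rightarrow> ('o, 'a, 'u) psh \<Rightarrow> ('d \<Rightarrow> 'u \<Rightarrow> 'u) \<Rightarrow> bool" where
  "free_along P Q \<eta> \<longleftrightarrow> P \<in> sheaves U D K \<and> Q \<in> sheaves U C J \<and> natural D P (pre Q) \<eta> \<and>
     (\<forall>F \<in> sheaves U C J. \<forall>\<phi>. natural D P (pre F) \<phi> \<longrightarrow>
        (\<exists>\<psi>. nat_trans C Q F \<psi> \<and> (\<forall>d \<in> Ob D. \<forall>x \<in> val P d. \<psi> (omap p d) (\<eta> d x) = \<phi> d x))) \<and>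
     (\<forall>F \<in> sheaves U C J. \<forall>\<psi> \<psi>'. natural C Q F \<psi> \<longrightarrow> natural C Q F \<psi>' \<longrightarrow>
        (\<forall>d \<in> Ob D. \<forall>x \<in> val P d. \<psi> (omap p d) (\<eta> d x) = \<psi>' (omap p d) (\<eta> d x)) \<longrightarrow>
        (\<forall>c \<in> Ob C. \<forall>s \<in> val Q c. \<psi> c s = \<psi>' c s))"

lemma free_alongD:
  assumes "free_along P Q \<eta>"
  shows "P \<in> sheaves U D K" "Q \<in> sheaves U C J" "natural D P (pre Q) \<eta>"
    and "F \<in> sheaves U C J \<Longrightarrow> natural D P (pre F) \<phi> \<Longrightarrow>
       \<exists>\<psi>. nat_trans C Q F \<psi> \<and> (\<forall>d \<in> Ob D. \<forall>x \<in> val P d. \<psi> (omap p d) (\<eta> d x) = \<phi> d x)"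
    and "F \<in> sheaves U C J \<Longrightarrow> natural C Q F \<psi> \<Longrightarrow> natural C Q F \<psi>' \<Longrightarrow>
       (\<And>d x. d \<in> Ob D \<Longrightarrow> x \<in> val P d \<Longrightarrow> \<psi> (omap p d) (\<eta> d x) = \<psi>' (omap p d) (\<eta> d x)) \<Longrightarrow>
       c \<in> Ob C \<Longrightarrow> s \<in> val Q c \<Longrightarrow> \<psi> c s = \<psi>' c s"
  using assms unfolding free_along_def by blast+

lemma free_along_ext:
  assumes Q: "free_along P Q \<eta>" and F: "F \<in> sheaves U C J"
    and \<beta>: "nat_trans C Q F \<beta>" "nat_trans C Q F \<beta>'"
    and eq: "\<And>d x. d \<in> Ob D \<Longrightarrow> x \<in> val P d \<Longrightarrow> \<beta> (omap p d) (\<eta> d x) = \<beta>' (omap p d) (\<eta> d x)"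
  shows "\<beta> = \<beta>'"
  by (rule nat_trans_ext[OF \<beta>]) (rule free_alongD(5)[OF Q F \<beta>[THEN nat_trans_natural] eq])

end

text \<open>The adjunction unpacked into universal maps \<open>\<eta> P\<close> and the action of \<open>S\<close> on arrows.\<close>

locale shriek = cont_comorphism D K C J U p
  for D :: "('d, 'b) cat" and K and C :: "('o, 'a) cat" and J and U :: "'u set set" and p +
  fixes S :: "(('d, 'b, 'u) psh, ('d, 'b, 'u) sh_arr, ('o, 'a, 'u) psh, ('o, 'a, 'u) sh_arr) funct"
    and \<eta> :: "('d, 'b, 'u) psh \<Rightarrow> 'd \<Rightarrow> 'u \<Rightarrow> 'u"
  assumes fr: "\<And>P. P \<in> sheaves U D K \<Longrightarrow> free_along P (omap S P) (\<eta> P)"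
    and Sa: "\<And>P Q \<alpha>. P \<in> sheaves U D K \<Longrightarrow> Q \<in> sheaves U D K \<Longrightarrow> nat_trans D P Q \<alpha> \<Longrightarrow>
       \<exists>\<beta>. amap S (P, \<alpha>, Q) = (omap S P, \<beta>, omap S Q) \<and> nat_trans C (omap S P) (omap S Q) \<beta> \<and>
         (\<forall>d \<in> Ob D. \<forall>x \<in> val P d. \<beta> (omap p d) (\<eta> P d x) = \<eta> Q d (\<alpha> d x))"
    and SF: "is_functor (Sh U D K) (Sh U C J) S"

lemma (in cont_comorphism) ex_shriek:
  assumes S: "is_C_shriek U D K C J p S"
  obtains \<eta> where "shriek D K C J U p S \<eta>"
proof -
  let ?A = "Sh U D K" and ?B = "Sh U C J"
      and ?R = "precomp D p :: (('o, 'a, 'u) psh, ('o, 'a, 'u) sh_arr, ('d, 'b, 'u) psh, ('d, 'b, 'u) sh_arr)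
          funct"
  have Ro: "omap ?R F = pre F" for F unfolding precomp_def by simp
  have Ra: "amap ?R (F, \<alpha>, G) = (pre F, \<lambda>d \<in> Ob D. \<alpha> (omap p d), pre G)" for F \<alpha> G
    unfolding precomp_def by simp
  obtain h where h: "\<And>P. P \<in> sheaves U D K \<Longrightarrow> h P \<in> hom ?A P (pre (omap S P))"
    and hn: "\<And>f. f \<in> Arr ?A \<Longrightarrow> h (Cod ?A f) \<cdot>\<^bsub>?A\<^esub> f = amap ?R (amap S f) \<cdot>\<^bsub>?A\<^esub> h (Dom ?A f)"
    and hu: "\<And>P F f. P \<in> sheaves U D K \<Longrightarrow> F \<in> sheaves U C J \<Longrightarrow> f \<in> hom ?A P (pre F) \<Longrightarrow>
       \<exists>!g. g \<in> hom ?B (omap S P) F \<and> amap ?R g \<cdot>\<^bsub>?A\<^esub> h P = f"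
    and SF: "is_functor ?A ?B S"
    by (rule left_adjointE[OF S[unfolded is_C_shriek_def], unfolded Ro Sh_simps(1)]) (rule that)
  define \<eta> where "\<eta> P = fst (snd (h P))" for P
  have \<eta>: "h P = (P, \<eta> P, pre (omap S P))" "nat_trans D P (pre (omap S P)) (\<eta> P)"
    if "P \<in> sheaves U D K" for P
    using h[OF that] unfolding \<eta>_def Sh_hom_iff by auto
  have So: "omap S P \<in> sheaves U C J" if "P \<in> sheaves U D K" for P
    using SF that unfolding is_functor_def by simp
  have comp: "amap ?R (omap S P, \<psi>, F) \<cdot>\<^bsub>?A\<^esub> h P = (P, nt_comp D P (\<lambda>d \<in> Ob D. \<psi> (omap p d)) (\<eta> P), pre F)"
    if "P \<in> sheaves U D K" for P \<psi> F
    unfolding Ra \<eta>(1)[OF that] by simp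
  have free: "free_along P (omap S P) (\<eta> P)" if P: "P \<in> sheaves U D K" for P
    unfolding free_along_def
  proof (intro conjI ballI allI impI P So nat_trans_natural[OF \<eta>(2)])
    note PP = D.sheavesD(2)[OF P]
    fix F assume F: "F \<in> sheaves U C J"
    show "\<exists>\<psi>. nat_trans C (omap S P) F \<psi> \<and> (\<forall>d \<in> Ob D. \<forall>x \<in> val P d. \<psi> (omap p d) (\<eta> P d x) = \<phi> d x)"
      if \<phi>: "natural D P (pre F) \<phi>" for \<phi>
    proof -
      have "(P, ext_nat D P \<phi>, pre F) \<in> hom ?A P (pre F)"
        unfolding Sh_hom_iff using P pre_sheaf[OF F] D.natural_nat_trans[OF PP \<phi>] by blast
      then obtain g where g: "g \<in> hom ?B (omap S P) F" "amap ?R g \<cdot>\<^bsub>?A\<^esub> h P = (P, ext_nat D P \<phi>, pre F)"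
        using hu[OF P F] by blast
      then obtain \<psi> where \<psi>: "g = (omap S P, \<psi>, F)" "nat_trans C (omap S P) F \<psi>" unfolding Sh_hom_iff by blast
      have e: "nt_comp D P (\<lambda>d \<in> Ob D. \<psi> (omap p d)) (\<eta> P) = ext_nat D P \<phi>"
        using g(2) unfolding \<psi>(1) comp[OF P] by simp
      have "\<psi> (omap p d) (\<eta> P d x) = \<phi> d x" if "d \<in> Ob D" "x \<in> val P d" for d x
        using fun_cong[OF fun_cong[OF e], of d x] that by simp
      then show ?thesis using \<psi>(2) by blast
    qed
    fix \<psi> \<psi>' c s
    assume n: "natural C (omap S P) F \<psi>" "natural C (omap S P) F \<psi>'"
      and eq: "\<forall>d \<in> Ob D. \<forall>x \<in> val P d. \<psi> (omap p d) (\<eta> P d x) = \<psi>' (omap p d) (\<eta> P d x)"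
      and cs: "c \<in> Ob C" "s \<in> val (omap S P) c"
    note SP = C.sheavesD(2)[OF So[OF P]]
    let ?e = "\<lambda>\<psi>. ext_nat C (omap S P) \<psi>"
    let ?f = "amap ?R (omap S P, ?e \<psi>, F) \<cdot>\<^bsub>?A\<^esub> h P"
    have \<eta>v: "\<eta> P d x \<in> val (omap S P) (omap p d)" if "d \<in> Ob D" "x \<in> val P d" for d x
      using naturalD_pre(1)[OF nat_trans_natural[OF \<eta>(2)[OF P]]] that by blast
    have nn: "nat_trans C (omap S P) F (?e \<psi>)" "nat_trans C (omap S P) F (?e \<psi>')"
      using C.natural_nat_trans[OF SP] n by blast+
    have f: "?f \<in> hom ?A P (pre F)"
    proof -
      have "natural D P (pre F) (\<lambda>d x. ?e \<psi> (omap p d) (\<eta> P d x))"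
        by (rule D.natural_o[OF nat_trans_natural[OF \<eta>(2)[OF P]] pre_natural[OF nat_trans_natural[OF nn(1)]]])
      from D.natural_nat_trans[OF PP this]
      have "nat_trans D P (pre F) (nt_comp D P (\<lambda>d \<in> Ob D. ?e \<psi> (omap p d)) (\<eta> P))"
        unfolding nt_comp_def ext_nat_def by (simp cong: restrict_cong)
      then show ?thesis unfolding comp[OF P] Sh_hom_iff using P pre_sheaf[OF F] by blast
    qed
    have f': "amap ?R (omap S P, ?e \<psi>', F) \<cdot>\<^bsub>?A\<^esub> h P = ?f"
      unfolding comp[OF P] nt_comp_def using eq \<eta>v by (simp cong: restrict_cong)
    have "(omap S P, ?e \<psi>, F) = (omap S P, ?e \<psi>', F)"
      by (rule ex1_implies_eq[OF hu[OF P F f]]) (use f' nn So[OF P] F in \<open>simp_all add: Sh_hom_iff\<close>)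
    then have "?e \<psi> c s = ?e \<psi>' c s" by simp
    then show "\<psi> c s = \<psi>' c s" using cs by simp
  qed
  have nat: "\<exists>\<beta>. amap S (P, \<alpha>, Q) = (omap S P, \<beta>, omap S Q) \<and> nat_trans C (omap S P) (omap S Q) \<beta> \<and>
         (\<forall>d \<in> Ob D. \<forall>x \<in> val P d. \<beta> (omap p d) (\<eta> P d x) = \<eta> Q d (\<alpha> d x))"
    if P: "P \<in> sheaves U D K" and Q: "Q \<in> sheaves U D K" and \<alpha>: "nat_trans D P Q \<alpha>" for P Q \<alpha>
  proof -
    have a: "(P, \<alpha>, Q) \<in> Arr ?A" using P Q \<alpha> by simp
    then have "amap S (P, \<alpha>, Q) \<in> hom ?B (omap S P) (omap S Q)"
      using SF unfolding is_functor_def by (metis Sh_simps(2,3))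
    then obtain \<beta> where \<beta>: "amap S (P, \<alpha>, Q) = (omap S P, \<beta>, omap S Q)" "nat_trans C (omap S P) (omap S Q) \<beta>"
      unfolding Sh_hom_iff by blast
    have e: "nt_comp D P (\<lambda>d \<in> Ob D. \<beta> (omap p d)) (\<eta> P) = nt_comp D P (\<eta> Q) \<alpha>"
      using hn[OF a] comp[OF P] unfolding Sh_simps \<beta>(1) \<eta>(1)[OF Q] by simp
    have "\<beta> (omap p d) (\<eta> P d x) = \<eta> Q d (\<alpha> d x)" if "d \<in> Ob D" "x \<in> val P d" for d x
      using fun_cong[OF fun_cong[OF e], of d x] that by simp
    then show ?thesis using \<beta> by blast
  qed
  show ?thesis
    by (rule that[OF shriek.intro[OF cont_comorphism_axioms shriek_axioms.intro[OF free nat SF]]])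
qed

context cont_comorphism
begin

text \<open>The pair \<open>(x, e)\<close> is an element at \<open>d\<close> of the fibre product of \<open>P\<close> and \<open>pre E\<close> over \<open>pre Q\<close>, for
  \<open>\<eta> : P \<rightarrow> pre Q\<close> and \<open>u : E \<rightarrow> Q\<close>.\<close>

definition over :: "('d, 'b, 'u) psh \<Rightarrow> ('d \<Rightarrow> 'u \<Rightarrow> 'u) \<Rightarrow> ('o, 'a, 'u) psh \<Rightarrow> ('o \<Rightarrow> 'u \<Rightarrow> 'u) \<Rightarrow> 'd \<Rightarrow> 'u \<Rightarrow> 'u \<Rightarrow> bool"
    where
  "over P \<eta> E u d x e \<longleftrightarrow> d \<in> Ob D \<and> x \<in> val P d \<and> e \<in> val E (omap p d) \<and> u (omap p d) e = \<eta> d x"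

definition fibre_product :: "('d, 'b, 'u) psh \<Rightarrow> ('d \<Rightarrow> 'u \<Rightarrow> 'u) \<Rightarrow> ('o, 'a, 'u) psh \<Rightarrow> ('o \<Rightarrow> 'u \<Rightarrow> 'u) \<Rightarrow>
    ('d, 'b, 'u \<times> 'u) psh" where
  "fibre_product P \<eta> E u = (let V = (\<lambda>d. {(x, e). over P \<eta> E u d x e}) in
     \<lparr>val = \<lambda>d \<in> Ob D. V d, res = \<lambda>k \<in> Arr D. \<lambda>z \<in> V (Cod D k). (res P k (fst z), res E (amap p k) (snd z))\<rparr>)"

lemma fibre_productI: "over P \<eta> E u d x e \<Longrightarrow> (x, e) \<in> val (fibre_product P \<eta> E u) d"
  and fibre_productE: "d \<in> Ob D \<Longrightarrow> z \<in> val (fibre_product P \<eta> E u) d \<Longrightarrow> over P \<eta> E u d (fst z) (snd z)"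
  and res_fibre_product: "k \<in> Arr D \<Longrightarrow> over P \<eta> E u (Cod D k) x e \<Longrightarrow>
    res (fibre_product P \<eta> E u) k (x, e) = (res P k x, res E (amap p k) e)"
  unfolding fibre_product_def Let_def by (auto simp: over_def)

context
  fixes P Q \<eta> E u
  assumes P: "P \<in> sheaves U D K" and Q: "Q \<in> sheaves U C J" and \<eta>: "natural D P (pre Q) \<eta>"
    and E: "E \<in> sheaves U C J" and u: "natural C E Q u"
begin

lemma over_res:
  assumes k: "k \<in> Arr D" and o: "over P \<eta> E u (Cod D k) x e"
  shows "over P \<eta> E u (Dom D k) (res P k x) (res E (amap p k) e)"
  using o k naturalD_pre(2)[OF \<eta> k, of x] natural_res[OF u p_Arr[OF k], of e]
    D.res_val[OF D.sheavesD(2)[OF P] k, of x] C.res_val[OF C.sheavesD(2)[OF E] p_Arr[OF k], of e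
        "omap p (Dom D k)"]
  unfolding over_def by simp

lemma presheaf_fibre_product: "presheaf D (fibre_product P \<eta> E u)"
  unfolding fibre_product_def Let_def
proof (rule D.presheaf_mk)
  note PP = D.sheavesD(2)[OF P] and EP = C.sheavesD(2)[OF E]
  show "(res P k (fst z), res E (amap p k) (snd z)) \<in> {(x, e). over P \<eta> E u (Dom D k) x e}"
    if "k \<in> Arr D" "z \<in> {(x, e). over P \<eta> E u (Cod D k) x e}" for k z
    using over_res[OF that(1)] that(2) by auto
  show "(res P (Ide D d) (fst z), res E (amap p (Ide D d)) (snd z)) = z"
    if "d \<in> Ob D" "z \<in> {(x, e). over P \<eta> E u d x e}" for d z
    using that by (auto simp: over_def D.res_Ide[OF PP] C.res_Ide[OF EP])
  show "(res P (k \<cdot>\<^bsub>D\<^esub> l) (fst z), res E (amap p (k \<cdot>\<^bsub>D\<^esub> l)) (snd z)) =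
      (res P l (fst (res P k (fst z), res E (amap p k) (snd z))),
       res E (amap p l) (snd (res P k (fst z), res E (amap p k) (snd z))))"
    if "k \<in> Arr D" "l \<in> Arr D" "Cod D l = Dom D k" "z \<in> {(x, e). over P \<eta> E u (Cod D k) x e}" for k l z
    using that by (auto simp: over_def D.res_comp[OF PP] C.res_comp[OF EP])
qed

text \<open>The fibre product is a sheaf of pairs. The sheaf \<open>W\<close> codes it with values in the universe, so
  that it can be an object of the category of sheaves.\<close>

lemma ex_pullback:
  obtains W \<pi>1 \<pi>2 where "W \<in> sheaves U D K" "natural D W P \<pi>1" "natural D W (pre E) \<pi>2"
    "\<And>d w. d \<in> Ob D \<Longrightarrow> w \<in> val W d \<Longrightarrow> over P \<eta> E u d (\<pi>1 d w) (\<pi>2 d w)"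
    "\<And>d x e. over P \<eta> E u d x e \<Longrightarrow> \<exists>w \<in> val W d. \<pi>1 d w = x \<and> \<pi>2 d w = e"
    "\<And>d w w'. d \<in> Ob D \<Longrightarrow> w \<in> val W d \<Longrightarrow> w' \<in> val W d \<Longrightarrow> \<pi>1 d w = \<pi>1 d w' \<Longrightarrow> \<pi>2 d w = \<pi>2 d w' \<Longrightarrow> w = w'"
proof -
  note PS = D.sheavesD(1)[OF P] and ES = D.sheavesD(1)[OF pre_sheaf[OF E]]
      and QS = D.sheavesD(1)[OF pre_sheaf[OF Q]]
  let ?W = "fibre_product P \<eta> E u"
  have WS: "sheaf D K ?W"
  proof (rule D.sheafI[OF presheaf_fibre_product])
    fix d R assume d: "d \<in> Ob D" and R: "R \<in> K d"
    have RA: "\<And>k. k \<in> R \<Longrightarrow> k \<in> Arr D \<and> Cod D k = d" using D.J_Arr[OF d R] .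
    show "z = z'" if z: "z \<in> val ?W d" "z' \<in> val ?W d" and eq: "\<And>k. k \<in> R \<Longrightarrow> res ?W k z = res ?W k z'" for z z'
    proof -
      note v = fibre_productE[OF d z(1)] fibre_productE[OF d z(2)]
      have eqs: "res P k (fst z) = res P k (fst z') \<and> res E (amap p k) (snd z) = res E (amap p k) (snd z')"
          if k: "k \<in> R" for k
        using eq[OF k] res_fibre_product[of k P \<eta> E u "fst z" "snd z"] res_fibre_product[of k P \<eta> E u "fst z'"
            "snd z'"] v RA[OF k] by simp
      have "fst z = fst z'"
        by (rule D.sheaf_separated[OF PS d]) (use v eqs R in \<open>auto simp: locally_def over_def\<close>)
      moreover have "snd z = snd z'"
        by (rule D.sheaf_separated[OF ES d])
            (use v eqs R RA d in \<open>auto simp: locally_def over_def intro!: bexI[of _ R]\<close>)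
      ultimately show ?thesis by (simp add: prod_eq_iff)
    qed
    fix m assume "matching_family D ?W R m"
    then have m: "\<And>k. k \<in> R \<Longrightarrow> m k \<in> val ?W (Dom D k)"
      "\<And>k l. k \<in> R \<Longrightarrow> l \<in> Arr D \<Longrightarrow> Cod D l = Dom D k \<Longrightarrow> res ?W l (m k) = m (k \<cdot>\<^bsub>D\<^esub> l)"
      unfolding matching_family_def by blast+
    have mo: "over P \<eta> E u (Dom D k) (fst (m k)) (snd (m k))" if "k \<in> R" for k
      using fibre_productE[OF _ m(1)[OF that]] RA[OF that] by simp
    have mr: "m (k \<cdot>\<^bsub>D\<^esub> l) = (res P l (fst (m k)), res E (amap p l) (snd (m k)))"
      if "k \<in> R" "l \<in> Arr D" "Cod D l = Dom D k" for k l
      using m(2)[OF that] res_fibre_product[OF that(2), of P \<eta> E u "fst (m k)"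
          "snd (m k)"] mo[OF that(1)] that(3) by simp
    have "matching_family D P R (\<lambda>k. fst (m k))" by (rule matching_familyI) (use mo mr in \<open>auto simp: over_def\<close>)
    then obtain x where x: "x \<in> val P d" "\<forall>k \<in> R. res P k x = fst (m k)" by (rule D.sheaf_amalgam[OF PS d R])
    have "matching_family D (pre E) R (\<lambda>k. snd (m k))" by (rule matching_familyI)
        (use mo mr RA in \<open>auto simp: over_def\<close>)
    then obtain e where e: "e \<in> val (pre E) d" "\<forall>k \<in> R. res (pre E) k e = snd (m k)"
        by (rule D.sheaf_amalgam[OF ES d R])
    have e': "e \<in> val E (omap p d)" "\<And>k. k \<in> R \<Longrightarrow> res E (amap p k) e = snd (m k)" using e d RA by auto
    have "u (omap p d) e = \<eta> d x"
    proof (rule D.sheaf_separated[OF QS d])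
      show "u (omap p d) e \<in> val (pre Q) d" "\<eta> d x \<in> val (pre Q) d"
        using natural_val[OF u _ e'(1)] natural_val[OF \<eta> d x(1)] d by simp_all
      have "res (pre Q) k (u (omap p d) e) = res (pre Q) k (\<eta> d x)" if k: "k \<in> R" for k
      proof -
        have kA: "k \<in> Arr D" "Cod D k = d" using RA[OF k] by auto
        show ?thesis using natural_res[OF u p_Arr[OF kA(1)], of e] naturalD_pre(2)[OF \<eta> kA(1), of x] e' x kA
            mo[OF k] k
          by (simp add: over_def)
      qed
      then show "locally D K d (\<lambda>k. res (pre Q) k (u (omap p d) e) = res (pre Q) k (\<eta> d x))"
        using R unfolding locally_def by blast
    qed
    then have xe: "over P \<eta> E u d x e" unfolding over_def using d x e' by simp
    have "res ?W k (x, e) = m k" if "k \<in> R" for k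
      using res_fibre_product[of k P \<eta> E u x e] xe RA[OF that] x e'(2)[OF that] that by simp
    then show "\<exists>y \<in> val ?W d. \<forall>k \<in> R. res ?W k y = m k" using fibre_productI[OF xe] by blast
  qed
  have us: "usmall U (val ?W d)" if d: "d \<in> Ob D" for d
  proof -
    have "usmall U (val P d \<times> val E (omap p d))"
      using usmall_Times[OF D.univ usmall_member[OF D.sheavesD(3)[OF P d]] usmall_member[OF C.sheavesD(3)[OF E
          p_Ob[OF d]]]] .
    then show ?thesis by (rule usmall_subset) (use fibre_productE[OF d] in \<open>fastforce simp: over_def\<close>)
  qed
  obtain W \<alpha> \<alpha>' where W: "W \<in> sheaves U D K" "natural D ?W W \<alpha>" "natural D W ?W \<alpha>'"
    "\<And>d x. d \<in> Ob D \<Longrightarrow> x \<in> val ?W d \<Longrightarrow> \<alpha>' d (\<alpha> d x) = x"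
    "\<And>d x. d \<in> Ob D \<Longrightarrow> x \<in> val W d \<Longrightarrow> \<alpha> d (\<alpha>' d x) = x"
    by (rule D.ex_sheaf_code[OF WS us]) (assumption | rule that)+
  have ov: "over P \<eta> E u d (fst (\<alpha>' d w)) (snd (\<alpha>' d w))" if "d \<in> Ob D" "w \<in> val W d" for d w
    using fibre_productE[OF that(1) natural_val[OF W(3) that]] .
  have \<alpha>'r: "\<alpha>' (Dom D k) (res W k w) = (res P k (fst (\<alpha>' (Cod D k) w)), res E (amap p k) (snd (\<alpha>' (Cod D k)
      w)))"
    if k: "k \<in> Arr D" and w: "w \<in> val W (Cod D k)" for k w
    using natural_res[OF W(3) k w] res_fibre_product[OF k ov[OF _ w]] k by simp
  show ?thesis
  proof (rule that[of W "\<lambda>d w. fst (\<alpha>' d w)" "\<lambda>d w. snd (\<alpha>' d w)"])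
    show "natural D W P (\<lambda>d w. fst (\<alpha>' d w))" "natural D W (pre E) (\<lambda>d w. snd (\<alpha>' d w))"
      by (rule naturalI; use ov \<alpha>'r in \<open>simp add: over_def\<close>)+
    show "\<exists>w \<in> val W d. fst (\<alpha>' d w) = x \<and> snd (\<alpha>' d w) = e" if "over P \<eta> E u d x e" for d x e
      using natural_val[OF W(2) _ fibre_productI[OF that]] W(4)[OF _ fibre_productI[OF that]] that
      by (intro bexI[of _ "\<alpha> d (x, e)"]) (auto simp: over_def)
    show "w = w'" if "d \<in> Ob D" "w \<in> val W d" "w' \<in> val W d" "fst (\<alpha>' d w) = fst (\<alpha>' d w')"
        "snd (\<alpha>' d w) = snd (\<alpha>' d w')" for d w w'
      using W(5)[OF that(1,2)] W(5)[OF that(1,3)] that(4,5) by (metis prod_eq_iff)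
  qed (rule W(1), rule ov)
qed

end

definition natural_over :: "('d, 'b, 'u) psh \<Rightarrow> ('d \<Rightarrow> 'u \<Rightarrow> 'u) \<Rightarrow> ('o, 'a, 'u) psh \<Rightarrow> ('o \<Rightarrow> 'u \<Rightarrow> 'u) \<Rightarrow>
    ('o, 'a, 'u) psh \<Rightarrow> ('d \<Rightarrow> 'u \<Rightarrow> 'u \<Rightarrow> 'u) \<Rightarrow> bool" where
  "natural_over P \<eta> E u F \<phi> \<longleftrightarrow>
     (\<forall>d x e. over P \<eta> E u d x e \<longrightarrow> \<phi> d x e \<in> val F (omap p d)) \<and>
     (\<forall>k \<in> Arr D. \<forall>x e. over P \<eta> E u (Cod D k) x e \<longrightarrow>
        \<phi> (Dom D k) (res P k x) (res E (amap p k) e) = res F (amap p k) (\<phi> (Cod D k) x e))"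

lemma natural_over_fibre_product:
  assumes "natural D (fibre_product P \<eta> E u) (pre F) \<phi>"
  shows "natural_over P \<eta> E u F (\<lambda>d x e. \<phi> d (x, e))"
  unfolding natural_over_def
proof (intro conjI allI ballI impI)
  show "\<phi> d (x, e) \<in> val F (omap p d)" if "over P \<eta> E u d x e" for d x e
    using naturalD_pre(1)[OF assms _ fibre_productI[OF that]] that unfolding over_def by blast
  show "\<phi> (Dom D k) (res P k x, res E (amap p k) e) = res F (amap p k) (\<phi> (Cod D k) (x, e))"
    if "k \<in> Arr D" "over P \<eta> E u (Cod D k) x e" for k x e
    using naturalD_pre(2)[OF assms that(1) fibre_productI[OF that(2)]] res_fibre_product[OF that] by simp
qed

text \<open>The universal property that makes \<open>E\<close> the value of the left adjoint at the fibre product, with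
  the projection to \<open>pre E\<close> as universal map.\<close>

definition descent :: "('d, 'b, 'u) psh \<Rightarrow> ('d \<Rightarrow> 'u \<Rightarrow> 'u) \<Rightarrow> ('o, 'a, 'u) psh \<Rightarrow> ('o \<Rightarrow> 'u \<Rightarrow> 'u) \<Rightarrow> bool" where
  "descent P \<eta> E u \<longleftrightarrow> (\<forall>F \<in> sheaves U C J.
     (\<forall>\<phi>. natural_over P \<eta> E u F \<phi> \<longrightarrow>
        (\<exists>\<psi>. natural C E F \<psi> \<and> (\<forall>d x e. over P \<eta> E u d x e \<longrightarrow> \<psi> (omap p d) e = \<phi> d x e))) \<and>
     (\<forall>\<psi> \<psi>'. natural C E F \<psi> \<longrightarrow> natural C E F \<psi>' \<longrightarrow>
        (\<forall>d x e. over P \<eta> E u d x e \<longrightarrow> \<psi> (omap p d) e = \<psi>' (omap p d) e) \<longrightarrow>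
        (\<forall>c \<in> Ob C. \<forall>e \<in> val E c. \<psi> c e = \<psi>' c e)))"

lemma Sh_isoE:
  assumes "is_iso (Sh U C J) (A, s, B)"
  obtains s' where "A \<in> sheaves U C J" "B \<in> sheaves U C J" "natural C A B s" "natural C B A s'"
    "\<And>c x. c \<in> Ob C \<Longrightarrow> x \<in> val A c \<Longrightarrow> s' c (s c x) = x"
    "\<And>c x. c \<in> Ob C \<Longrightarrow> x \<in> val B c \<Longrightarrow> s c (s' c x) = x"
proof -
  have a: "A \<in> sheaves U C J" "B \<in> sheaves U C J" "nat_trans C A B s"
    and "\<exists>g \<in> hom (Sh U C J) B A. g \<cdot>\<^bsub>Sh U C J\<^esub> (A, s, B) = Ide (Sh U C J) A \<and>
        (A, s, B) \<cdot>\<^bsub>Sh U C J\<^esub> g = Ide (Sh U C J) B"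
    using assms unfolding is_iso_def by auto
  then obtain g where g: "g \<in> hom (Sh U C J) B A" "g \<cdot>\<^bsub>Sh U C J\<^esub> (A, s, B) = Ide (Sh U C J) A"
    "(A, s, B) \<cdot>\<^bsub>Sh U C J\<^esub> g = Ide (Sh U C J) B" by blast
  obtain s' where g': "g = (B, s', A)" "nat_trans C B A s'" using g(1) by (rule Sh_homE) (rule that)
  have s': "nat_trans C B A s'" "nt_comp C A s' s = ext_nat C A (\<lambda>c x. x)"
    "nt_comp C B s s' = ext_nat C B (\<lambda>c x. x)" using g(2,3) g' by (simp_all add: Sh_Ide)
  show ?thesis
  proof (rule that[OF a(1,2) a(3)[THEN nat_trans_natural] s'(1)[THEN nat_trans_natural]])
    show "s' c (s c x) = x" if "c \<in> Ob C" "x \<in> val A c" for c x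
      using fun_cong[OF fun_cong[OF s'(2)], of c x] that by simp
    show "s c (s' c x) = x" if "c \<in> Ob C" "x \<in> val B c" for c x
      using fun_cong[OF fun_cong[OF s'(3)], of c x] that by simp
  qed
qed

lemma Sh_isoI:
  assumes A: "A \<in> sheaves U C J" "B \<in> sheaves U C J" "nat_trans C A B s" "natural C B A s'"
    and inv: "\<And>c x. c \<in> Ob C \<Longrightarrow> x \<in> val A c \<Longrightarrow> s' c (s c x) = x"
    "\<And>c x. c \<in> Ob C \<Longrightarrow> x \<in> val B c \<Longrightarrow> s c (s' c x) = x"
  shows "is_iso (Sh U C J) (A, s, B)"
proof -
  note P = C.sheavesD(2)[OF A(1)] C.sheavesD(2)[OF A(2)]
  let ?s = "ext_nat C B s'"
  have n: "nat_trans C B A ?s" by (rule C.natural_nat_trans[OF P(2) A(4)])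
  have id: "nat_trans C F F (ext_nat C F (\<lambda>c x. x))" if "presheaf C F" for F :: "('o, 'a, 'u) psh"
    by (rule C.natural_nat_trans[OF that]) (simp add: natural_def)
  note v = natural_val[OF nat_trans_natural[OF A(3)]] natural_val[OF A(4)]
  have 1: "nt_comp C A ?s s = ext_nat C A (\<lambda>c x. x)"
    by (rule nat_trans_ext[OF C.nat_trans_comp[OF P(1) A(3) n] id[OF P(1)]]) (use v inv in simp)
  have 2: "nt_comp C B s ?s = ext_nat C B (\<lambda>c x. x)"
    by (rule nat_trans_ext[OF C.nat_trans_comp[OF P(2) n A(3)] id[OF P(2)]]) (use v inv in simp)
  have "(B, ?s, A) \<in> hom (Sh U C J) B A" unfolding Sh_hom_iff using A n by blast
  then show ?thesis unfolding is_iso_def using A(1-3) 1 2 by (auto simp: Sh_Ide intro!: bexI[of _ "(B, ?s, A)"])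
qed

end

context shriek
begin

text \<open>A cartesian lift \<open>t : A \<rightarrow> P\<close> of \<open>u\<close> comes with an isomorphism \<open>s\<close> from \<open>S A\<close> to \<open>E\<close>, and
  \<open>t\<close> and \<open>s\<close> together give a map from \<open>A\<close> to the fibre product \<open>W\<close>. The projection \<open>W \<rightarrow> P\<close> lies
  over the arrow \<open>S W \<rightarrow> S A\<close> obtained from the other projection, so it factors through \<open>t\<close> by a map
  \<open>k : W \<rightarrow> A\<close>, which shows that every pair in \<open>W\<close> comes from an element of \<open>A\<close>. Composition with
  the map from \<open>A\<close> turns a natural map out of \<open>W\<close> into one out of \<open>A\<close>, whose transpose is a map out of
  \<open>S A\<close>, that is, out of \<open>E\<close>; it has the required values because all pairs come from \<open>A\<close>.\<close>

lemma descent_of_fibration: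
  assumes fib: "street_fibration (Sh U D K) (Sh U C J) S"
    and P: "P \<in> sheaves U D K" and E: "E \<in> sheaves U C J" and u: "nat_trans C E (omap S P) u"
  shows "descent P (\<eta> P) E u"
proof -
  let ?A = "Sh U D K" and ?B = "Sh U C J"
  note PP = D.sheavesD(2)[OF P] and EP = C.sheavesD(2)[OF E]
  note un = nat_trans_natural[OF u]
  note SP = free_alongD(2)[OF fr[OF P]]
  have "(E, u, omap S P) \<in> hom ?B E (omap S P)" unfolding Sh_hom_iff using E SP u by blast
  then obtain A u' \<sigma> where A: "A \<in> sheaves U D K" and u': "u' \<in> hom ?A A P"
    and \<sigma>: "\<sigma> \<in> hom ?B (omap S A) E" and cart: "cartesian_arrow ?A ?B S u'"
    and iso: "is_iso ?B \<sigma>" and Su': "amap S u' = (E, u, omap S P) \<cdot>\<^bsub>?B\<^esub> \<sigma>"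
    using fib P E unfolding street_fibration_def Sh_simps(1) by blast
  obtain t where t: "u' = (A, t, P)" "nat_trans D A P t" using u' by (rule Sh_homE) (rule that)
  obtain s where s: "\<sigma> = (omap S A, s, E)" "nat_trans C (omap S A) E s" using \<sigma> by (rule Sh_homE) (rule that)
  obtain s' where s': "natural C E (omap S A) s'"
    "\<And>c x. c \<in> Ob C \<Longrightarrow> x \<in> val (omap S A) c \<Longrightarrow> s' c (s c x) = x"
    "\<And>c x. c \<in> Ob C \<Longrightarrow> x \<in> val E c \<Longrightarrow> s c (s' c x) = x"
    using iso unfolding s(1) by (rule Sh_isoE) (rule that)
  note frA = free_alongD[OF fr[OF A]]
  note sn = nat_trans_natural[OF s(2)] and tn = nat_trans_natural[OF t(2)]
  have \<eta>A: "\<eta> A d a \<in> val (omap S A) (omap p d)" if "d \<in> Ob D" "a \<in> val A d" for d a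
    using naturalD_pre(1)[OF frA(3)] that by blast
  obtain St where St: "amap S u' = (omap S A, St, omap S P)"
    "\<And>d a. d \<in> Ob D \<Longrightarrow> a \<in> val A d \<Longrightarrow> St (omap p d) (\<eta> A d a) = \<eta> P d (t d a)"
    using Sa[OF A P t(2)] unfolding t(1) by blast
  have St_eq: "St = nt_comp C (omap S A) u s" using St(1) Su' unfolding s(1) by simp
  have sq: "over P (\<eta> P) E u d (t d a) (s (omap p d) (\<eta> A d a))" if d: "d \<in> Ob D" and a: "a \<in> val A d" for d a
    using St(2)[OF d a] \<eta>A[OF d a] natural_val[OF sn _ \<eta>A[OF d a]] natural_val[OF tn d a] d
    unfolding St_eq over_def by simp
  obtain W \<pi>1 \<pi>2 where W: "W \<in> sheaves U D K" "natural D W P \<pi>1" "natural D W (pre E) \<pi>2"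
    "\<And>d w. d \<in> Ob D \<Longrightarrow> w \<in> val W d \<Longrightarrow> over P (\<eta> P) E u d (\<pi>1 d w) (\<pi>2 d w)"
    "\<And>d x e. over P (\<eta> P) E u d x e \<Longrightarrow> \<exists>w \<in> val W d. \<pi>1 d w = x \<and> \<pi>2 d w = e"
    by (rule ex_pullback[OF P SP free_alongD(3)[OF fr[OF P]] E un]) (rule that)
  note WP = D.sheavesD(2)[OF W(1)]
  note frW = free_alongD[OF fr[OF W(1)]]
  let ?g = "(W, ext_nat D W \<pi>1, P)"
  have gn: "nat_trans D W P (ext_nat D W \<pi>1)" by (rule D.natural_nat_trans[OF WP W(2)])
  have gA: "?g \<in> Arr ?A" using W(1) P gn by simp
  obtain Sg where Sg: "amap S ?g = (omap S W, Sg, omap S P)" "nat_trans C (omap S W) (omap S P) Sg"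
    "\<And>d w. d \<in> Ob D \<Longrightarrow> w \<in> val W d \<Longrightarrow> Sg (omap p d) (\<eta> W d w) = \<eta> P d (ext_nat D W \<pi>1 d w)"
    using Sa[OF W(1) P gn] by blast
  have "natural D W (pre (omap S A)) (\<lambda>d w. s' (omap p d) (\<pi>2 d w))"
    by (rule D.natural_o[OF W(3) pre_natural[OF s'(1)]])
  then obtain h where h: "nat_trans C (omap S W) (omap S A) h"
    "\<And>d w. d \<in> Ob D \<Longrightarrow> w \<in> val W d \<Longrightarrow> h (omap p d) (\<eta> W d w) = s' (omap p d) (\<pi>2 d w)"
    using frW(4)[OF frA(2)] by blast
  have hh: "(omap S W, h, omap S A) \<in> hom ?B (omap S W) (omap S A)"
    unfolding Sh_hom_iff using frW(2) frA(2) h(1) by blast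
  have \<pi>2E: "\<pi>2 d w \<in> val E (omap p d)" if "d \<in> Ob D" "w \<in> val W d" for d w
    using naturalD_pre(1)[OF W(3)] that by blast
  have Stn: "nat_trans C (omap S A) (omap S P) St"
    unfolding St_eq by (rule C.nat_trans_comp[OF C.sheavesD(2)[OF frA(2)] s(2) u])
  have "nt_comp C (omap S W) St h = Sg"
  proof (rule free_along_ext[OF fr[OF W(1)] SP C.nat_trans_comp[OF C.sheavesD(2)[OF frW(2)] h(1) Stn] Sg(2)])
    fix d w assume d: "d \<in> Ob D" and w: "w \<in> val W d"
    have "\<eta> W d w \<in> val (omap S W) (omap p d)" using naturalD_pre(1)[OF frW(3) d w] .
    moreover have "s' (omap p d) (\<pi>2 d w) \<in> val (omap S A) (omap p d)"
      using natural_val[OF s'(1) _ \<pi>2E[OF d w]] d by simp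
    ultimately show "nt_comp C (omap S W) St h (omap p d) (\<eta> W d w) = Sg (omap p d) (\<eta> W d w)"
      using d w h(2)[OF d w] Sg(3)[OF d w] s'(3)[OF _ \<pi>2E[OF d w]] W(4)[OF d w]
      unfolding St_eq over_def by simp
  qed
  then have "amap S u' \<cdot>\<^bsub>?B\<^esub> (omap S W, h, omap S A) = amap S ?g"
    unfolding St(1) Sg(1) by simp
  then obtain h' where h': "h' \<in> hom ?A W A" "amap S h' = (omap S W, h, omap S A)" "u' \<cdot>\<^bsub>?A\<^esub> h' = ?g"
    by (rule cartesian_arrowE[OF cart gA, rotated 2]) (use hh in \<open>simp_all add: t(1)\<close>)
  obtain k where k: "h' = (W, k, A)" "nat_trans D W A k" using h'(1) by (rule Sh_homE) (rule that)
  have tk: "t d (k d w) = \<pi>1 d w" if "d \<in> Ob D" "w \<in> val W d" for d w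
  proof -
    have "nt_comp D W t k = ext_nat D W \<pi>1" using h'(3) unfolding k(1) t(1) by simp
    from fun_cong[OF fun_cong[OF this], of d w] show ?thesis using that by simp
  qed
  have kA: "k d w \<in> val A d" if "d \<in> Ob D" "w \<in> val W d" for d w
    using natural_val[OF nat_trans_natural[OF k(2)] that] .
  (* k lies over h; this compares the two at the universal element *)
  have s'\<pi>: "s' (omap p d) (\<pi>2 d w) = \<eta> A d (k d w)" if dw: "d \<in> Ob D" "w \<in> val W d" for d w
  proof -
    obtain \<beta> where "amap S (W, k, A) = (omap S W, \<beta>, omap S A)"
      "\<forall>d \<in> Ob D. \<forall>x \<in> val W d. \<beta> (omap p d) (\<eta> W d x) = \<eta> A d (k d x)" using Sa[OF W(1) A k(2)] by blast
    then show ?thesis using h'(2) h(2)[OF dw] dw unfolding k(1) by simp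
  qed
  show ?thesis unfolding descent_def
  proof (intro ballI conjI allI impI)
    fix F \<phi> assume F: "F \<in> sheaves U C J" and \<phi>: "natural_over P (\<eta> P) E u F \<phi>"
    have "natural D A (pre F) (\<lambda>d a. \<phi> d (t d a) (s (omap p d) (\<eta> A d a)))"
    proof (rule naturalI)
      show "\<phi> d (t d a) (s (omap p d) (\<eta> A d a)) \<in> val (pre F) d" if "d \<in> Ob D" "a \<in> val A d" for d a
        using \<phi> sq[OF that] that unfolding natural_over_def by simp
      fix l a assume l: "l \<in> Arr D" and a: "a \<in> val A (Cod D l)"
      have "s (omap p (Dom D l)) (\<eta> A (Dom D l) (res A l a)) = res E (amap p l) (s (omap p (Cod D l)) (\<eta> A (Cod
          D l) a))"
        using naturalD_pre(2)[OF frA(3) l a] natural_res[OF sn p_Arr[OF l], of "\<eta> A (Cod D l) a"] \<eta>A[OF _ a] l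
            by simp
      then show "\<phi> (Dom D l) (t (Dom D l) (res A l a)) (s (omap p (Dom D l)) (\<eta> A (Dom D l) (res A l a))) =
         res (pre F) l (\<phi> (Cod D l) (t (Cod D l) a) (s (omap p (Cod D l)) (\<eta> A (Cod D l) a)))"
        using \<phi> sq[OF _ a] l natural_res[OF tn l a] unfolding natural_over_def by simp
    qed
    then obtain \<chi> where c: "nat_trans C (omap S A) F \<chi>"
      "\<And>d a. d \<in> Ob D \<Longrightarrow> a \<in> val A d \<Longrightarrow> \<chi> (omap p d) (\<eta> A d a) = \<phi> d (t d a) (s (omap p d) (\<eta> A d a))"
      using frA(4)[OF F] by blast
    show "\<exists>\<psi>. natural C E F \<psi> \<and> (\<forall>d x e. over P (\<eta> P) E u d x e \<longrightarrow> \<psi> (omap p d) e = \<phi> d x e)"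
    proof (intro exI conjI allI impI)
      show "natural C E F (\<lambda>c e. \<chi> c (s' c e))" by (rule C.natural_o[OF s'(1) nat_trans_natural[OF c(1)]])
      fix d x e assume "over P (\<eta> P) E u d x e"
      then obtain w where d: "d \<in> Ob D" and w: "w \<in> val W d" "\<pi>1 d w = x" "\<pi>2 d w = e"
        using W(5) unfolding over_def by metis
      have "s (omap p d) (\<eta> A d (k d w)) = e"
        using s'(3)[OF p_Ob[OF d] \<pi>2E[OF d w(1)]] s'\<pi>[OF d w(1)] w(3) by simp
      then show "\<chi> (omap p d) (s' (omap p d) e) = \<phi> d x e"
        using s'\<pi>[OF d w(1)] c(2)[OF d kA[OF d w(1)]] tk[OF d w(1)] w by simp
    qed
  next
    fix F \<psi> \<psi>' c e assume F: "F \<in> sheaves U C J" and n: "natural C E F \<psi>" "natural C E F \<psi>'"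
      and eq: "\<forall>d x e. over P (\<eta> P) E u d x e \<longrightarrow> \<psi> (omap p d) e = \<psi>' (omap p d) e"
      and ce: "c \<in> Ob C" "e \<in> val E c"
    have "\<psi> c (s c (s' c e)) = \<psi>' c (s c (s' c e))"
      by (rule frA(5)[OF F C.natural_o[OF sn n(1)] C.natural_o[OF sn n(2)] _ ce(1) natural_val[OF s'(1) ce]])
        (use eq sq in blast)
    then show "\<psi> c e = \<psi>' c e" using s'(3)[OF ce] by simp
  qed
qed

text \<open>By descent the transpose \<open>s : S W \<rightarrow> E\<close> of the second projection is an isomorphism, with
  inverse \<open>\<psi>\<close>. The first projection is then a cartesian lift: an arrow \<open>V \<rightarrow> W\<close> is a pair of
  maps from \<open>V\<close> to \<open>P\<close> and to \<open>pre E\<close>, and the second of these is the transpose of an arrow from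
  \<open>S V\<close> to \<open>E\<close>, hence amounts to an arrow \<open>S V \<rightarrow> S W\<close>.\<close>

lemma fibration_of_descent:
  assumes des: "\<And>P E u. P \<in> sheaves U D K \<Longrightarrow> E \<in> sheaves U C J \<Longrightarrow> nat_trans C E (omap S P) u \<Longrightarrow>
       descent P (\<eta> P) E u"
  shows "street_fibration (Sh U D K) (Sh U C J) S"
  unfolding street_fibration_def Sh_simps(1)
proof (intro conjI ballI SF)
  let ?A = "Sh U D K" and ?B = "Sh U C J"
  fix P E v assume P: "P \<in> sheaves U D K" and E: "E \<in> sheaves U C J" and v: "v \<in> hom ?B E (omap S P)"
  obtain u where u: "v = (E, u, omap S P)" "nat_trans C E (omap S P) u" using v by (rule Sh_homE) (rule that)
  note PP = D.sheavesD(2)[OF P] and EP = C.sheavesD(2)[OF E]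
  note un = nat_trans_natural[OF u(2)]
  note frP = free_alongD[OF fr[OF P]]
  note des = des[OF P E u(2)]
  obtain W \<pi>1 \<pi>2 where W: "W \<in> sheaves U D K" "natural D W P \<pi>1" "natural D W (pre E) \<pi>2"
    "\<And>d w. d \<in> Ob D \<Longrightarrow> w \<in> val W d \<Longrightarrow> over P (\<eta> P) E u d (\<pi>1 d w) (\<pi>2 d w)"
    "\<And>d x e. over P (\<eta> P) E u d x e \<Longrightarrow> \<exists>w \<in> val W d. \<pi>1 d w = x \<and> \<pi>2 d w = e"
    "\<And>d w w'. d \<in> Ob D \<Longrightarrow> w \<in> val W d \<Longrightarrow> w' \<in> val W d \<Longrightarrow> \<pi>1 d w = \<pi>1 d w' \<Longrightarrow> \<pi>2 d w = \<pi>2 d w' \<Longrightarrow> w = w'"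
    by (rule ex_pullback[OF P frP(2) frP(3) E un]) (rule that)
  note WP = D.sheavesD(2)[OF W(1)]
  note frW = free_alongD[OF fr[OF W(1)]]
  have \<pi>2E: "\<pi>2 d w \<in> val E (omap p d)" if "d \<in> Ob D" "w \<in> val W d" for d w
    using naturalD_pre(1)[OF W(3)] that by blast
  have \<eta>W: "\<eta> W d w \<in> val (omap S W) (omap p d)" if "d \<in> Ob D" "w \<in> val W d" for d w
    using naturalD_pre(1)[OF frW(3)] that by blast
  obtain s where s: "nat_trans C (omap S W) E s"
    "\<And>d w. d \<in> Ob D \<Longrightarrow> w \<in> val W d \<Longrightarrow> s (omap p d) (\<eta> W d w) = \<pi>2 d w"
    using frW(4)[OF E W(3)] by blast
  note sn = nat_trans_natural[OF s(1)]
  (* the code of the pair (x, e) in W *)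
  define pr where "pr d x e = (SOME w. w \<in> val W d \<and> \<pi>1 d w = x \<and> \<pi>2 d w = e)" for d x e
  have pr: "pr d x e \<in> val W d" "\<pi>1 d (pr d x e) = x" "\<pi>2 d (pr d x e) = e" if "over P (\<eta> P) E u d x e"
      for d x e
  proof -
    have "\<exists>w. w \<in> val W d \<and> \<pi>1 d w = x \<and> \<pi>2 d w = e" using W(5)[OF that] by blast
    from someI_ex[OF this] show "pr d x e \<in> val W d" "\<pi>1 d (pr d x e) = x" "\<pi>2 d (pr d x e) = e"
      unfolding pr_def by blast+
  qed
  have prw: "pr d (\<pi>1 d w) (\<pi>2 d w) = w" if "d \<in> Ob D" "w \<in> val W d" for d w
    using W(6)[OF that(1) _ that(2)] pr[OF W(4)[OF that]] by blast
  note ovr = over_res[OF P frP(2,3) E un]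
  have prr: "pr (Dom D k) (res P k x) (res E (amap p k) e) = res W k (pr (Cod D k) x e)"
    if k: "k \<in> Arr D" and o: "over P (\<eta> P) E u (Cod D k) x e" for k x e
  proof (rule W(6))
    note o' = ovr[OF k o]
    show "Dom D k \<in> Ob D" using k by simp
    show "pr (Dom D k) (res P k x) (res E (amap p k) e) \<in> val W (Dom D k)" by (rule pr(1)[OF o'])
    show "res W k (pr (Cod D k) x e) \<in> val W (Dom D k)" using D.res_val[OF WP k pr(1)[OF o]] by simp
    show "\<pi>1 (Dom D k) (pr (Dom D k) (res P k x) (res E (amap p k) e)) = \<pi>1 (Dom D k) (res W k (pr (Cod D k) x
        e))"
      using pr(2)[OF o'] natural_res[OF W(2) k pr(1)[OF o]] pr(2)[OF o] by simp
    show "\<pi>2 (Dom D k) (pr (Dom D k) (res P k x) (res E (amap p k) e)) = \<pi>2 (Dom D k) (res W k (pr (Cod D k) x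
        e))"
      using pr(3)[OF o'] naturalD_pre(2)[OF W(3) k pr(1)[OF o]] pr(3)[OF o] by simp
  qed
  have "natural_over P (\<eta> P) E u (omap S W) (\<lambda>d x e. \<eta> W d (pr d x e))"
    unfolding natural_over_def
  proof (intro conjI allI impI ballI)
    show "\<eta> W d (pr d x e) \<in> val (omap S W) (omap p d)" if "over P (\<eta> P) E u d x e" for d x e
      using \<eta>W pr(1)[OF that] that unfolding over_def by blast
    show "\<eta> W (Dom D k) (pr (Dom D k) (res P k x) (res E (amap p k) e)) = res (omap S W) (amap p k) (\<eta> W (Cod D
        k) (pr (Cod D k) x e))"
      if "k \<in> Arr D" "over P (\<eta> P) E u (Cod D k) x e" for k x e
      using prr[OF that] naturalD_pre(2)[OF frW(3) that(1) pr(1)[OF that(2)]] by simp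
  qed
  then obtain \<psi> where \<psi>: "natural C E (omap S W) \<psi>"
    "\<And>d x e. over P (\<eta> P) E u d x e \<Longrightarrow> \<psi> (omap p d) e = \<eta> W d (pr d x e)"
    using des frW(2) unfolding descent_def by blast
  have \<psi>2: "\<psi> (omap p d) (\<pi>2 d w) = \<eta> W d w" if "d \<in> Ob D" "w \<in> val W d" for d w
    using \<psi>(2)[OF W(4)[OF that]] prw[OF that] by simp
  have s\<psi>: "s c (\<psi> c e) = e" if "c \<in> Ob C" "e \<in> val E c" for c e
  proof -
    have "natural C E E (\<lambda>c e. s c (\<psi> c e))" "natural C E E (\<lambda>c e. e)"
      using C.natural_o[OF \<psi>(1) sn] by (simp_all add: natural_def)
    moreover have "\<forall>d x e. over P (\<eta> P) E u d x e \<longrightarrow> s (omap p d) (\<psi> (omap p d) e) = e"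
    proof (intro allI impI)
      fix d x e assume o: "over P (\<eta> P) E u d x e"
      then have d: "d \<in> Ob D" unfolding over_def by blast
      show "s (omap p d) (\<psi> (omap p d) e) = e" using \<psi>(2)[OF o] s(2)[OF d pr(1)[OF o]] pr(3)[OF o] by simp
    qed
    ultimately have "\<forall>c \<in> Ob C. \<forall>e \<in> val E c. s c (\<psi> c e) = e"
      using des E unfolding descent_def by blast
    then show ?thesis using that by blast
  qed
  have \<psi>s: "\<psi> c (s c x) = x" if "c \<in> Ob C" "x \<in> val (omap S W) c" for c x
  proof (rule frW(5)[OF frW(2) C.natural_o[OF sn \<psi>(1)] _ _ that, of "\<lambda>c x. x"])
    show "natural C (omap S W) (omap S W) (\<lambda>c x. x)" by (simp add: natural_def)
    show "\<psi> (omap p d) (s (omap p d) (\<eta> W d w)) = \<eta> W d w" if "d \<in> Ob D" "w \<in> val W d" for d w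
      using s(2)[OF that] \<psi>2[OF that] by simp
  qed
  have \<pi>1n: "nat_trans D W P (ext_nat D W \<pi>1)" by (rule D.natural_nat_trans[OF WP W(2)])
  let ?u = "(W, ext_nat D W \<pi>1, P)" and ?\<sigma> = "(omap S W, s, E)"
  obtain S1 where S1: "amap S ?u = (omap S W, S1, omap S P)" "nat_trans C (omap S W) (omap S P) S1"
    "\<And>d w. d \<in> Ob D \<Longrightarrow> w \<in> val W d \<Longrightarrow> S1 (omap p d) (\<eta> W d w) = \<eta> P d (ext_nat D W \<pi>1 d w)"
    using Sa[OF W(1) P \<pi>1n] by blast
  have S1s: "S1 = nt_comp C (omap S W) u s"
    by (rule free_along_ext[OF fr[OF W(1)] frP(2) S1(2) C.nat_trans_comp[OF C.sheavesD(2)[OF frW(2)] s(1)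
        u(2)]])
      (use S1(3) s(2) \<eta>W W(4) in \<open>simp add: over_def\<close>)
  have uh: "?u \<in> hom ?A W P" unfolding Sh_hom_iff using W(1) P \<pi>1n by blast
  have \<sigma>h: "?\<sigma> \<in> hom ?B (omap S W) E" unfolding Sh_hom_iff using frW(2) E s(1) by blast
  have iso: "is_iso ?B ?\<sigma>" by (rule Sh_isoI[OF frW(2) E s(1) \<psi>(1) \<psi>s s\<psi>])
  have eq: "amap S ?u = v \<cdot>\<^bsub>?B\<^esub> ?\<sigma>" unfolding S1(1) S1s u(1) by simp
  have cart: "cartesian_arrow ?A ?B S ?u"
    unfolding cartesian_arrow_def
  proof (intro conjI ballI allI impI)
    show "?u \<in> Arr ?A" using W(1) P \<pi>1n by simp
    fix g h assume g: "g \<in> Arr ?A"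
        and "Cod ?A g = Cod ?A ?u \<and> h \<in> hom ?B (omap S (Dom ?A g)) (omap S (Dom ?A ?u)) \<and>
        amap S ?u \<cdot>\<^bsub>?B\<^esub> h = amap S g"
    then have gh: "Cod ?A g = P" "h \<in> hom ?B (omap S (Dom ?A g)) (omap S W)" "amap S ?u \<cdot>\<^bsub>?B\<^esub> h = amap S g"
        by simp_all
    obtain V \<gamma> where g': "g = (V, \<gamma>, P)" using gh(1) by (cases g) auto
    have V: "V \<in> sheaves U D K" and \<gamma>: "nat_trans D V P \<gamma>" using g unfolding g' by simp_all
    obtain h0 where h0: "h = (omap S V, h0, omap S W)" "nat_trans C (omap S V) (omap S W) h0"
      using gh(2) unfolding g' Sh_simps by (rule Sh_homE) (rule that)
    note VP = D.sheavesD(2)[OF V]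
    note frV = free_alongD[OF fr[OF V]]
    note \<gamma>n = nat_trans_natural[OF \<gamma>] and h0n = nat_trans_natural[OF h0(2)]
    obtain Sg where Sg: "amap S g = (omap S V, Sg, omap S P)"
      "\<And>d x. d \<in> Ob D \<Longrightarrow> x \<in> val V d \<Longrightarrow> Sg (omap p d) (\<eta> V d x) = \<eta> P d (\<gamma> d x)"
      using Sa[OF V P \<gamma>] unfolding g' by blast
    have \<eta>V: "\<eta> V d x \<in> val (omap S V) (omap p d)" if "d \<in> Ob D" "x \<in> val V d" for d x
      using naturalD_pre(1)[OF frV(3)] that by blast
    have h0\<eta>: "h0 (omap p d) (\<eta> V d x) \<in> val (omap S W) (omap p d)" if "d \<in> Ob D" "x \<in> val V d" for d x
      using natural_val[OF h0n _ \<eta>V[OF that]] that by simp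
    have Sgh: "nt_comp C (omap S V) S1 h0 = Sg" using gh(3) unfolding S1(1) h0(1) Sg(1) by simp
    define \<epsilon> where "\<epsilon> d x = s (omap p d) (h0 (omap p d) (\<eta> V d x))" for d x
    have \<epsilon>n: "natural D V (pre E) \<epsilon>"
      unfolding \<epsilon>_def by (rule D.natural_o[OF D.natural_o[OF frV(3) pre_natural[OF h0n]] pre_natural[OF sn]])
    have ovV: "over P (\<eta> P) E u d (\<gamma> d x) (\<epsilon> d x)" if d: "d \<in> Ob D" and x: "x \<in> val V d" for d x
    proof -
      have "S1 (omap p d) (h0 (omap p d) (\<eta> V d x)) = \<eta> P d (\<gamma> d x)"
        using fun_cong[OF fun_cong[OF Sgh], of "omap p d" "\<eta> V d x"] Sg(2)[OF d x] d \<eta>V[OF d x] by simp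
      then show ?thesis unfolding S1s over_def \<epsilon>_def
        using natural_val[OF \<gamma>n d x] naturalD_pre(1)[OF \<epsilon>n d x] h0\<eta>[OF d x] d unfolding \<epsilon>_def by simp
    qed
    define k where "k d x = pr d (\<gamma> d x) (\<epsilon> d x)" for d x
    have kv: "k d x \<in> val W d" "\<pi>1 d (k d x) = \<gamma> d x" "\<pi>2 d (k d x) = \<epsilon> d x" if "d \<in> Ob D" "x \<in> val V d" for d x
      using pr[OF ovV[OF that]] unfolding k_def by blast+
    have kn: "natural D V W k"
    proof (rule naturalI[OF kv(1)])
      fix l x assume l: "l \<in> Arr D" and x: "x \<in> val V (Cod D l)"
      show "k (Dom D l) (res V l x) = res W l (k (Cod D l) x)"
        using prr[OF l ovV[OF _ x]] natural_res[OF \<gamma>n l x] naturalD_pre(2)[OF \<epsilon>n l x] l unfolding k_def by simp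
    qed
    let ?h = "(V, ext_nat D V k, W)"
    have kn': "nat_trans D V W (ext_nat D V k)" by (rule D.natural_nat_trans[OF VP kn])
    obtain Sk where Sk: "amap S ?h = (omap S V, Sk, omap S W)" "nat_trans C (omap S V) (omap S W) Sk"
      "\<And>d x. d \<in> Ob D \<Longrightarrow> x \<in> val V d \<Longrightarrow> Sk (omap p d) (\<eta> V d x) = \<eta> W d (ext_nat D V k d x)"
      using Sa[OF V W(1) kn'] by blast
    show "\<exists>!h'. h' \<in> hom ?A (Dom ?A g) (Dom ?A ?u) \<and> amap S h' = h \<and> ?u \<cdot>\<^bsub>?A\<^esub> h' = g"
      unfolding g' Sh_simps(2)
    proof (rule ex1I[of _ ?h], intro conjI)
      show "?h \<in> hom ?A V W" unfolding Sh_hom_iff using V W(1) kn' by blast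
      have "Sk = h0"
      proof (rule free_along_ext[OF fr[OF V] frW(2) Sk(2) h0(2)])
        fix d x assume d: "d \<in> Ob D" and x: "x \<in> val V d"
        have "s (omap p d) (\<eta> W d (k d x)) = s (omap p d) (h0 (omap p d) (\<eta> V d x))"
          using s(2)[OF d kv(1)[OF d x]] kv(3)[OF d x] unfolding \<epsilon>_def by simp
        then have "\<eta> W d (k d x) = h0 (omap p d) (\<eta> V d x)"
          using \<psi>s[OF p_Ob[OF d] \<eta>W[OF d kv(1)[OF d x]]] \<psi>s[OF p_Ob[OF d] h0\<eta>[OF d x]] by metis
        then show "Sk (omap p d) (\<eta> V d x) = h0 (omap p d) (\<eta> V d x)" using Sk(3)[OF d x] d x by simp
      qed
      then show "amap S ?h = h" unfolding Sk(1) h0(1) by simp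
      have "nt_comp D V (ext_nat D W \<pi>1) (ext_nat D V k) = \<gamma>"
        by (rule nat_trans_ext[OF D.nat_trans_comp[OF VP kn' \<pi>1n] \<gamma>]) (use kv in simp)
      then show "?u \<cdot>\<^bsub>?A\<^esub> ?h = (V, \<gamma>, P)" by simp
    next
      fix h2 assume h2: "h2 \<in> hom ?A V W \<and> amap S h2 = h \<and> ?u \<cdot>\<^bsub>?A\<^esub> h2 = (V, \<gamma>, P)"
      then obtain k2 where k2: "h2 = (V, k2, W)" "nat_trans D V W k2" unfolding Sh_hom_iff by blast
      have p1: "nt_comp D V (ext_nat D W \<pi>1) k2 = \<gamma>" using h2 unfolding k2(1) by simp
      obtain Sk2 where Sk2: "amap S h2 = (omap S V, Sk2, omap S W)"
        "\<And>d x. d \<in> Ob D \<Longrightarrow> x \<in> val V d \<Longrightarrow> Sk2 (omap p d) (\<eta> V d x) = \<eta> W d (k2 d x)"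
        using Sa[OF V W(1) k2(2)] unfolding k2(1) by blast
      have "Sk2 = h0" using h2 unfolding Sk2(1) h0(1) by simp
      have "k2 = ext_nat D V k"
      proof (rule nat_trans_ext[OF k2(2) kn'])
        fix d x assume d: "d \<in> Ob D" and x: "x \<in> val V d"
        have k2W: "k2 d x \<in> val W d" by (rule natural_val[OF nat_trans_natural[OF k2(2)] d x])
        have "\<pi>1 d (k2 d x) = \<gamma> d x" using fun_cong[OF fun_cong[OF p1], of d x] d x k2W by simp
        moreover have "\<pi>2 d (k2 d x) = \<epsilon> d x"
          using s(2)[OF d k2W] Sk2(2)[OF d x] \<open>Sk2 = h0\<close> unfolding \<epsilon>_def by simp
        ultimately have "k2 d x = k d x" using W(6)[OF d k2W kv(1)[OF d x]] kv[OF d x] by simp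
        then show "k2 d x = ext_nat D V k d x" using d x by simp
      qed
      then show "h2 = ?h" using k2(1) by simp
    qed
  qed
  show "\<exists>a' \<in> sheaves U D K. \<exists>u' \<in> hom ?A a' P. \<exists>\<sigma> \<in> hom ?B (omap S a') E.
      cartesian_arrow ?A ?B S u' \<and> is_iso ?B \<sigma> \<and> amap S u' = v \<cdot>\<^bsub>?B\<^esub> \<sigma>"
    by (rule bexI[OF _ W(1)], rule bexI[OF _ uh], rule bexI[OF _ \<sigma>h]) (intro conjI cart iso eq)
qed

end

section \<open>A presentation of the free sheaf\<close>

context cont_comorphism
begin

text \<open>The left Kan extension of \<open>P\<close> along \<open>p\<close> is at \<open>c\<close> the quotient of the triples \<open>(d, x, f)\<close> with
  \<open>x\<close> in \<open>P d\<close> and \<open>f : c \<rightarrow> p d\<close> by the equivalence relation generated by \<open>step\<close>. Only objects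
  \<open>d\<close> of a set \<open>B\<close> are admitted: if \<open>B\<close> is small, then the values are bounded, and if \<open>B\<close> generates the
  site and \<open>P\<close> is a sheaf, then the sheafification does not change.\<close>

definition sections :: "'d set \<Rightarrow> ('d, 'b, 'u) psh \<Rightarrow> 'o \<Rightarrow> ('d \<times> 'u \<times> 'a) set" where
  "sections B P c = (SIGMA d:B. val P d \<times> hom C c (omap p d))"

definition step :: "'d set \<Rightarrow> ('d, 'b, 'u) psh \<Rightarrow> 'o \<Rightarrow> ('d \<times> 'u \<times> 'a) rel" where
  "step B P c = {((Dom D k, res P k x, f), (Cod D k, x, amap p k \<cdot>\<^bsub>C\<^esub> f)) | k x f.
     k \<in> Arr D \<and> Dom D k \<in> B \<and> Cod D k \<in> B \<and> x \<in> val P (Cod D k) \<and> f \<in> hom C c (omap p (Dom D k))}"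

definition zigzag :: "'d set \<Rightarrow> ('d, 'b, 'u) psh \<Rightarrow> 'o \<Rightarrow> ('d \<times> 'u \<times> 'a) rel" where
  "zigzag B P c = (step B P c \<union> (step B P c)\<inverse>)\<^sup>*"

definition act :: "'a \<Rightarrow> 'd \<times> 'u \<times> 'a \<Rightarrow> 'd \<times> 'u \<times> 'a" where
  "act w = (\<lambda>(d, x, f). (d, x, f \<cdot>\<^bsub>C\<^esub> w))"

definition class_res :: "'d set \<Rightarrow> ('d, 'b, 'u) psh \<Rightarrow> 'a \<Rightarrow> ('d \<times> 'u \<times> 'a) set \<Rightarrow> ('d \<times> 'u \<times> 'a) set" where
  "class_res B P w X = zigzag B P (Dom C w) `` (act w ` X)"

definition classes :: "'d set \<Rightarrow> ('d, 'b, 'u) psh \<Rightarrow> ('o, 'a, ('d \<times> 'u \<times> 'a) set) psh" where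
  "classes B P = (let V = (\<lambda>c. (\<lambda>t. zigzag B P c `` {t}) ` sections B P c) in
     \<lparr>val = \<lambda>c \<in> Ob C. V c, res = \<lambda>w \<in> Arr C. \<lambda>X \<in> V (Cod C w). class_res B P w X\<rparr>)"

lemma sections_iff: "(d, x, f) \<in> sections B P c \<longleftrightarrow> d \<in> B \<and> x \<in> val P d \<and> f \<in> hom C c (omap p d)"
  unfolding sections_def by auto

lemma stepI: "k \<in> Arr D \<Longrightarrow> Dom D k = d \<Longrightarrow> Cod D k = d' \<Longrightarrow> d \<in> B \<Longrightarrow> d' \<in> B \<Longrightarrow> x \<in> val P d' \<Longrightarrow>
   f \<in> hom C c (omap p d) \<Longrightarrow> y = res P k x \<Longrightarrow> g = amap p k \<cdot>\<^bsub>C\<^esub> f \<Longrightarrow> ((d, y, f), (d', x, g)) \<in> step B P c"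
  unfolding step_def by blast

lemma stepE:
  assumes "(t, t') \<in> step B P c"
  obtains k x f where "t = (Dom D k, res P k x, f)" "t' = (Cod D k, x, amap p k \<cdot>\<^bsub>C\<^esub> f)"
    "k \<in> Arr D" "Dom D k \<in> B" "Cod D k \<in> B" "x \<in> val P (Cod D k)" "f \<in> hom C c (omap p (Dom D k))"
  using assms unfolding step_def by blast

lemma zigzag_refl: "(t, t) \<in> zigzag B P c"
  unfolding zigzag_def by simp

lemma zigzag_sym: "(t, t') \<in> zigzag B P c \<Longrightarrow> (t', t) \<in> zigzag B P c"
  unfolding zigzag_def by (meson symD sym_Un_converse sym_rtrancl)

lemma zigzag_trans: "(t, t') \<in> zigzag B P c \<Longrightarrow> (t', t'') \<in> zigzag B P c \<Longrightarrow> (t, t'') \<in> zigzag B P c"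
  unfolding zigzag_def by (rule rtrancl_trans)

lemma step_zigzag: "(t, t') \<in> step B P c \<Longrightarrow> (t, t') \<in> zigzag B P c"
  unfolding zigzag_def by blast

lemma zigzag_class: "zigzag B P c `` {t} = zigzag B P c `` {t'} \<longleftrightarrow> (t, t') \<in> zigzag B P c"
  using zigzag_refl zigzag_sym zigzag_trans by blast

lemma step_act:
  assumes w: "w \<in> Arr C" and t: "(t, t') \<in> step B P (Cod C w)"
  shows "(act w t, act w t') \<in> step B P (Dom C w)"
  using t
proof (rule stepE)
  fix k x f assume a: "t = (Dom D k, res P k x, f)" "t' = (Cod D k, x, amap p k \<cdot>\<^bsub>C\<^esub> f)"
    "k \<in> Arr D" "Dom D k \<in> B" "Cod D k \<in> B" "x \<in> val P (Cod D k)" "f \<in> hom C (Cod C w) (omap p (Dom D k))"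
  show ?thesis unfolding a(1,2) act_def prod.case
    by (rule stepI[OF a(3) refl refl a(4-6) _ refl]) (use a w in \<open>auto simp: hom_iff\<close>)
qed

lemma zigzag_act:
  assumes w: "w \<in> Arr C" and t: "(t, t') \<in> zigzag B P (Cod C w)"
  shows "(act w t, act w t') \<in> zigzag B P (Dom C w)"
  using t unfolding zigzag_def[of _ _ "Cod C w"]
proof (induction rule: rtrancl_induct)
  case base then show ?case by (rule zigzag_refl)
next
  case (step y z)
  then have "(act w y, act w z) \<in> zigzag B P (Dom C w)"
    using step_act[OF w] step_zigzag zigzag_sym by blast
  then show ?case using step.IH zigzag_trans by blast
qed

lemma class_res_class:
  assumes w: "w \<in> Arr C"
  shows "class_res B P w (zigzag B P (Cod C w) `` {t}) = zigzag B P (Dom C w) `` {act w t}"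
  unfolding class_res_def
  using zigzag_act[OF w] zigzag_trans zigzag_refl by blast

lemma act_sections:
  assumes w: "w \<in> Arr C" and t: "t \<in> sections B P (Cod C w)"
  shows "act w t \<in> sections B P (Dom C w)"
  using assms by (cases t) (auto simp: sections_iff act_def hom_iff)

lemma act_comp: "w \<in> Arr C \<Longrightarrow> w' \<in> Arr C \<Longrightarrow> Cod C w' = Dom C w \<Longrightarrow> t \<in> sections B P (Cod C w) \<Longrightarrow>
    act (w \<cdot>\<^bsub>C\<^esub> w') t = act w' (act w t)"
  by (cases t) (auto simp: sections_iff act_def hom_iff)

lemma act_Ide: "c \<in> Ob C \<Longrightarrow> t \<in> sections B P c \<Longrightarrow> act (Ide C c) t = t"
  by (cases t) (auto simp: sections_iff act_def hom_iff)

lemma presheaf_classes: "presheaf C (classes B P)"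
  unfolding classes_def Let_def
proof (rule C.presheaf_mk)
  show "class_res B P w X \<in> (\<lambda>t. zigzag B P (Dom C w) `` {t}) ` sections B P (Dom C w)"
    if "w \<in> Arr C" "X \<in> (\<lambda>t. zigzag B P (Cod C w) `` {t}) ` sections B P (Cod C w)" for w X
    using that class_res_class[OF that(1)] act_sections[OF that(1)] by auto
  show "class_res B P (Ide C c) X = X"
    if "c \<in> Ob C" "X \<in> (\<lambda>t. zigzag B P c `` {t}) ` sections B P c" for c X
    using that class_res_class[of "Ide C c" B P] act_Ide[OF that(1)] by auto
  fix w w' X assume w: "w \<in> Arr C" "w' \<in> Arr C" "Cod C w' = Dom C w"
    and "X \<in> (\<lambda>t. zigzag B P (Cod C w) `` {t}) ` sections B P (Cod C w)"
  then obtain t where t: "X = zigzag B P (Cod C w) `` {t}" "t \<in> sections B P (Cod C w)" by blast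
  show "class_res B P (w \<cdot>\<^bsub>C\<^esub> w') X = class_res B P w' (class_res B P w X)"
    using class_res_class[of "w \<cdot>\<^bsub>C\<^esub> w'" B P t] class_res_class[OF w(1), of B P t]
      class_res_class[OF w(2), of B P "act w t"] act_comp[OF w t(2)] w unfolding t(1) by simp
qed

lemma val_classes: "c \<in> Ob C \<Longrightarrow> val (classes B P) c = (\<lambda>t. zigzag B P c `` {t}) ` sections B P c"
  unfolding classes_def by simp

lemma res_classes: "w \<in> Arr C \<Longrightarrow> t \<in> sections B P (Cod C w) \<Longrightarrow>
    res (classes B P) w (zigzag B P (Cod C w) `` {t}) = zigzag B P (Dom C w) `` {act w t}"
  unfolding classes_def by (simp add: class_res_class)

text \<open>Let \<open>L\<close> be the sheafification of the presheaf of classes of triples. For \<open>d\<close> in \<open>B\<close> the classes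
  of the triples \<open>(d, x, id)\<close> give a map from \<open>P d\<close> to \<open>L (p d)\<close>. These maps extend to a map
  \<open>\<gamma> : P \<rightarrow> pre L\<close>, because \<open>B\<close> generates the site \<open>D\<close> and \<open>pre L\<close> is a sheaf on it by continuity of
  \<open>p\<close>. So there is a map \<open>a : Q \<rightarrow> L\<close>. Conversely \<open>(d, x, f) \<mapsto> Q(f) (\<eta> x)\<close> induces a map
  \<open>b : L \<rightarrow> Q\<close>, and \<open>b\<close> after \<open>a\<close> is the identity by universality of \<open>Q\<close>. Through \<open>b\<close>, every section of
  \<open>Q\<close> comes locally from a triple, since this holds in \<open>L\<close>. Through \<open>a\<close>, triples with equal values in
  \<open>Q\<close> are equal in \<open>L\<close>, so their restrictions are locally connected by a zigzag of steps.\<close>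

lemma free_presentation:
  assumes free: "free_along P Q \<eta>"
  obtains B where "B \<subseteq> Ob D"
    "\<And>d. d \<in> Ob D \<Longrightarrow> locally D K d (\<lambda>h. \<exists>n m. m \<in> Arr D \<and> n \<in> Arr D \<and> Cod D m = Dom D n \<and>
        Dom D n \<in> B \<and> Cod D n = d \<and> h = n \<cdot>\<^bsub>D\<^esub> m)"
    "\<And>c s. c \<in> Ob C \<Longrightarrow> s \<in> val Q c \<Longrightarrow> locally C J c (\<lambda>w. \<exists>d x f. (d, x, f) \<in> sections B P (Dom C w) \<and>
        res Q w s = res Q f (\<eta> d x))"
    "\<And>c d x f d' x' f'. c \<in> Ob C \<Longrightarrow> (d, x, f) \<in> sections B P c \<Longrightarrow> (d', x', f') \<in> sections B P c \<Longrightarrow>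
        res Q f (\<eta> d x) = res Q f' (\<eta> d' x') \<Longrightarrow>
        locally C J c (\<lambda>w. (act w (d, x, f), act w (d', x', f')) \<in> zigzag B P (Dom C w))"
proof -
  note fr = free_alongD[OF free]
  note PP = D.sheavesD(2)[OF fr(1)] and QP = C.sheavesD(2)[OF fr(2)]
  obtain B where B: "B \<subseteq> Ob D" "small U B"
    and gen: "\<And>d. d \<in> Ob D \<Longrightarrow> locally D K d (\<lambda>h. \<exists>n m. m \<in> Arr D \<and> n \<in> Arr D \<and> Cod D m = Dom D n \<and>
        Dom D n \<in> B \<and> Cod D n = d \<and> h = n \<cdot>\<^bsub>D\<^esub> m)"
    by (rule D.ex_generators) (rule that)
  have us: "usmall U (val (classes B P) c)" if c: "c \<in> Ob C" for c
    unfolding val_classes[OF c] sections_def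
    by (rule usmall_image, rule usmall_Sigma[OF D.univ small_imp_usmall[OF D.univ B(2)]],
        rule usmall_Times[OF D.univ usmall_member[OF D.sheavesD(3)[OF fr(1)]] small_imp_usmall[OF D.univ
            C.hom_small]])
      (use B(1) c in auto)
  obtain L \<theta> where L: "L \<in> sheaves U C J" and lb: "locally_bijective C J (classes B P) L \<theta>"
    by (rule C.ex_sheafification[OF presheaf_classes us]) (assumption | rule that)+
  note LS = C.sheavesD(1)[OF L] and LP = C.sheavesD(2)[OF L]
  note \<theta> = C.locally_bijectiveD[OF lb]
  define \<tau> where "\<tau> c t = \<theta> c (zigzag B P c `` {t})" for c t
  have \<tau>L: "\<tau> c t \<in> val L c" if "c \<in> Ob C" "t \<in> sections B P c" for c t
    unfolding \<tau>_def using natural_val[OF \<theta>(1) that(1)] that by (simp add: val_classes)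
  have \<tau>r: "res L w (\<tau> (Cod C w) t) = \<tau> (Dom C w) (act w t)" if "w \<in> Arr C" "t \<in> sections B P (Cod C w)" for w t
    unfolding \<tau>_def using natural_res[OF \<theta>(1) that(1), of "zigzag B P (Cod C w) `` {t}"] res_classes[OF that]
        that
    by (simp add: val_classes)
  have \<tau>z: "\<tau> c t = \<tau> c t'" if "(t, t') \<in> zigzag B P c" for c t t'
    unfolding \<tau>_def using that by (simp only: zigzag_class[THEN iffD2])
  have \<tau>i: "locally C J c (\<lambda>w. (act w t, act w t') \<in> zigzag B P (Dom C w))"
    if c: "c \<in> Ob C" and t: "t \<in> sections B P c" "t' \<in> sections B P c" and eq: "\<tau> c t = \<tau> c t'" for c t t'
  proof -
    have "locally C J c (\<lambda>w. res (classes B P) w (zigzag B P c `` {t}) = res (classes B P) w (zigzag B P c ``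
        {t'}))"
      by (rule \<theta>(2)[OF c]) (use c t eq in \<open>auto simp: val_classes \<tau>_def\<close>)
    then show ?thesis
      by (rule C.locally_mono[OF c]) (use res_classes t zigzag_class in metis)
  qed
  have \<tau>s: "locally C J c (\<lambda>w. \<exists>t \<in> sections B P (Dom C w). res L w s = \<tau> (Dom C w) t)"
    if c: "c \<in> Ob C" and s: "s \<in> val L c" for c s
    by (rule C.locally_mono[OF c \<theta>(3)[OF c s]]) (auto simp: val_classes \<tau>_def)
  have Bsec: "(Dom D n, res P n x, amap p m) \<in> sections B P (omap p (Dom D m))"
    if "n \<in> Arr D" "m \<in> Arr D" "Cod D m = Dom D n" "Dom D n \<in> B" "x \<in> val P (Cod D n)" for n m x
    using that D.res_val[OF PP that(1,5)] by (simp add: sections_iff hom_iff)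
  have \<tau>rm: "res L (amap p l) (\<tau> (omap p (Dom D m)) (Dom D n, res P n x, amap p m)) =
      \<tau> (omap p (Dom D l)) (Dom D n, res P n x, amap p (m \<cdot>\<^bsub>D\<^esub> l))"
    if "n \<in> Arr D" "m \<in> Arr D" "Cod D m = Dom D n" "Dom D n \<in> B" "x \<in> val P (Cod D n)"
      "l \<in> Arr D" "Cod D l = Dom D m" for n m x l
    using \<tau>r[of "amap p l" "(Dom D n, res P n x, amap p m)"] Bsec[OF that(1-5)] that by (simp add: act_def)
  (* k factors as n after m through a generator, where the class of the restriction of x is available *)
  define Rel where "Rel d x k z \<longleftrightarrow> (\<exists>n m. n \<in> Arr D \<and> m \<in> Arr D \<and> Cod D m = Dom D n \<and> Dom D n \<in> B \<and> Cod D n = d \<and>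
     k = n \<cdot>\<^bsub>D\<^esub> m \<and> z = \<tau> (omap p (Dom D m)) (Dom D n, res P n x, amap p m))" for d x k z
  obtain \<gamma> where \<gamma>n: "natural D P (pre L) \<gamma>"
    and \<gamma>: "\<And>d x k z. d \<in> Ob D \<Longrightarrow> x \<in> val P d \<Longrightarrow> k \<in> Arr D \<Longrightarrow> Cod D k = d \<Longrightarrow> Rel d x k z \<Longrightarrow>
      res (pre L) k (\<gamma> d x) = z"
  proof (rule D.glue_natural[OF D.sheavesD(1)[OF pre_sheaf[OF L]] PP, of Rel])
      show "locally D K d (\<lambda>k. \<exists>z. Rel d x k z)" if d: "d \<in> Ob D" for d x
        by (rule D.locally_mono[OF d gen[OF d]]) (unfold Rel_def, blast)
      show "z \<in> val (pre L) (Dom D k)"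
        if x: "x \<in> val P d" and k: "k \<in> Arr D" "Cod D k = d" and r: "Rel d x k z" for d x k z
        using r \<tau>L[OF _ Bsec] x unfolding Rel_def by auto
      show "Rel d x (k \<cdot>\<^bsub>D\<^esub> l) (res (pre L) l z)"
        if x: "x \<in> val P d" and k: "k \<in> Arr D" "Cod D k = d" and l: "l \<in> Arr D" "Cod D l = Dom D k"
          and r: "Rel d x k z" for d x k l z
      proof -
        obtain n m where nm: "n \<in> Arr D" "m \<in> Arr D" "Cod D m = Dom D n" "Dom D n \<in> B" "Cod D n = d"
          "k = n \<cdot>\<^bsub>D\<^esub> m" "z = \<tau> (omap p (Dom D m)) (Dom D n, res P n x, amap p m)" using r unfolding Rel_def
              by blast
        have lm: "Cod D l = Dom D m" using nm l by simp
        show ?thesis unfolding Rel_def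
          by (rule exI[of _ n], rule exI[of _ "m \<cdot>\<^bsub>D\<^esub> l"])
            (use nm l lm x \<tau>rm[OF nm(1-4) _ l(1) lm, of x] in simp)
      qed
      show "z = z'"
        if x: "x \<in> val P d" and k: "k \<in> Arr D" "Cod D k = d" and r: "Rel d x k z" "Rel d x k z'" for d x k z z'
      proof -
        obtain n m where nm: "n \<in> Arr D" "m \<in> Arr D" "Cod D m = Dom D n" "Dom D n \<in> B" "Cod D n = d"
          "k = n \<cdot>\<^bsub>D\<^esub> m" "z = \<tau> (omap p (Dom D m)) (Dom D n, res P n x, amap p m)" using r unfolding Rel_def
              by blast
        obtain n' m' where nm': "n' \<in> Arr D" "m' \<in> Arr D" "Cod D m' = Dom D n'" "Dom D n' \<in> B" "Cod D n' = d"
          "k = n' \<cdot>\<^bsub>D\<^esub> m'" "z' = \<tau> (omap p (Dom D m')) (Dom D n', res P n' x, amap p m')" using r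
              unfolding Rel_def by blast
        have Dk: "Dom D k = Dom D m" using nm(1-3,6) by simp
        have Dk': "Dom D k = Dom D m'" using nm'(1-3,6) by simp
        have z: "z \<in> val L (omap p (Dom D k))"
          unfolding nm(7) Dk using \<tau>L[OF _ Bsec[OF nm(1-4)]] nm(2,5) x by simp
        have z': "z' \<in> val L (omap p (Dom D k))"
          unfolding nm'(7) Dk' using \<tau>L[OF _ Bsec[OF nm'(1-4)]] nm'(2,5) x by simp
        (* Both values are compared, over an arrow g from a generator to the domain of k, with the
           class of the restriction of x along k g, which is one step away from either. *)
        have key: "\<tau> (omap p (Dom D h)) (Dom D n, res P n x, amap p (m \<cdot>\<^bsub>D\<^esub> (g \<cdot>\<^bsub>D\<^esub> h))) =
            \<tau> (omap p (Dom D h)) (Dom D g, res P (k \<cdot>\<^bsub>D\<^esub> g) x, amap p h)"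
          if nm: "n \<in> Arr D" "m \<in> Arr D" "Cod D m = Dom D n" "Dom D n \<in> B" "Cod D n = d" "k = n \<cdot>\<^bsub>D\<^esub> m"
            and g: "g \<in> Arr D" "h \<in> Arr D" "Cod D h = Dom D g" "Dom D g \<in> B" "Cod D g = Dom D k" for n m g h
        proof (rule \<tau>z[OF zigzag_sym[OF step_zigzag]])
          show "((Dom D g, res P (k \<cdot>\<^bsub>D\<^esub> g) x, amap p h), (Dom D n, res P n x, amap p (m \<cdot>\<^bsub>D\<^esub> (g \<cdot>\<^bsub>D\<^esub> h))))
              \<in> step B P (omap p (Dom D h))"
            by (rule stepI[of "m \<cdot>\<^bsub>D\<^esub> g"])
              (use nm g x D.res_val[OF PP] in \<open>simp_all add: hom_iff D.res_comp[OF PP, symmetric]\<close>)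
        qed
        show ?thesis
        proof (rule D.sheaf_separated[OF D.sheavesD(1)[OF pre_sheaf[OF L]]])
          show "Dom D k \<in> Ob D" using k by simp
          show "z \<in> val (pre L) (Dom D k)" "z' \<in> val (pre L) (Dom D k)" using z z' k by simp_all
          show "locally D K (Dom D k) (\<lambda>l. res (pre L) l z = res (pre L) l z')"
          proof (rule D.locally_mono[OF _ gen])
            fix l assume l: "l \<in> Arr D" "Cod D l = Dom D k"
              and "\<exists>g h. h \<in> Arr D \<and> g \<in> Arr D \<and> Cod D h = Dom D g \<and> Dom D g \<in> B \<and> Cod D g = Dom D k \<and>
                  l = g \<cdot>\<^bsub>D\<^esub> h"
            then obtain g h where g: "g \<in> Arr D" "h \<in> Arr D" "Cod D h = Dom D g" "Dom D g \<in> B"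
                "Cod D g = Dom D k" "l = g \<cdot>\<^bsub>D\<^esub> h"
              by blast
            have lm: "Cod D l = Dom D m" "Cod D l = Dom D m'" using l(2) Dk Dk' by simp_all
            have x': "x \<in> val P (Cod D n)" "x \<in> val P (Cod D n')" using x nm nm' by simp_all
            have "Dom D l = Dom D h" using g by simp
            then show "res (pre L) l z = res (pre L) l z'"
              using \<tau>rm[OF nm(1-4) x'(1) l(1) lm(1)] \<tau>rm[OF nm'(1-4) x'(2) l(1) lm(2)]
                key[OF nm(1-6) g(1-5)] key[OF nm'(1-6) g(1-5)] l unfolding nm(7) nm'(7) g(6) by simp
          qed (use k in simp_all)
        qed
      qed
      show "Rel (Cod D k) x (k \<cdot>\<^bsub>D\<^esub> l) z"
        if k: "k \<in> Arr D" and x: "x \<in> val P (Cod D k)" and l: "l \<in> Arr D" "Cod D l = Dom D k"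
          and r: "Rel (Dom D k) (res P k x) l z" for k x l z
      proof -
        obtain n m where nm: "n \<in> Arr D" "m \<in> Arr D" "Cod D m = Dom D n" "Dom D n \<in> B" "Cod D n = Dom D k"
          "l = n \<cdot>\<^bsub>D\<^esub> m" "z = \<tau> (omap p (Dom D m)) (Dom D n, res P n (res P k x), amap p m)"
          using r unfolding Rel_def by blast
        show ?thesis unfolding Rel_def
          by (rule exI[of _ "k \<cdot>\<^bsub>D\<^esub> n"], rule exI[of _ m]) (use nm k x in \<open>simp add: D.res_comp[OF PP]\<close>)
      qed
  qed (rule that)
  have \<gamma>nm: "res L (amap p (n \<cdot>\<^bsub>D\<^esub> m)) (\<gamma> d x) = \<tau> (omap p (Dom D m)) (Dom D n, res P n x, amap p m)"
    if nm: "n \<in> Arr D" "m \<in> Arr D" "Cod D m = Dom D n" "Dom D n \<in> B" "Cod D n = d" and x: "x \<in> val P d"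
        for n m d x
  proof -
    have "Rel d x (n \<cdot>\<^bsub>D\<^esub> m) (\<tau> (omap p (Dom D m)) (Dom D n, res P n x, amap p m))" unfolding Rel_def using nm
        by blast
    from \<gamma>[OF _ x _ _ this] show ?thesis using nm by auto
  qed
  have \<gamma>B: "\<gamma> d x = \<tau> (omap p d) (d, x, Ide C (omap p d))" if d: "d \<in> B" and x: "x \<in> val P d" for d x
  proof -
    have d': "d \<in> Ob D" using d B(1) by blast
    show ?thesis
      using \<gamma>nm[of "Ide D d" "Ide D d" d x] d d' x naturalD_pre(1)[OF \<gamma>n d' x] C.res_Ide[OF LP] D.res_Ide[OF PP]
          by simp
  qed
  obtain a where a: "nat_trans C Q L a" "\<And>d x. d \<in> Ob D \<Longrightarrow> x \<in> val P d \<Longrightarrow> a (omap p d) (\<eta> d x) = \<gamma> d x"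
    using fr(4)[OF L \<gamma>n] by blast
  note an = nat_trans_natural[OF a(1)]
  define ev where "ev = (\<lambda>(d, x, f). res Q f (\<eta> d x))"
  have \<eta>Q: "\<eta> d x \<in> val Q (omap p d)" if "d \<in> Ob D" "x \<in> val P d" for d x using naturalD_pre(1)[OF fr(3) that] .
  have evstep: "ev t = ev t'" if "(t, t') \<in> step B P c" for t t' c
    using that
  proof (rule stepE)
    fix k x f assume k: "t = (Dom D k, res P k x, f)" "t' = (Cod D k, x, amap p k \<cdot>\<^bsub>C\<^esub> f)"
      "k \<in> Arr D" "Dom D k \<in> B" "Cod D k \<in> B" "x \<in> val P (Cod D k)" "f \<in> hom C c (omap p (Dom D k))"
    show ?thesis unfolding k(1,2) ev_def prod.case
      using naturalD_pre(2)[OF fr(3) k(3,6)] C.res_comp[OF QP, of "amap p k"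
          f "\<eta> (Cod D k) x"] k \<eta>Q[of "Cod D k" x]
      by (simp add: hom_iff)
  qed
  have evz: "ev t = ev t'" if "(t, t') \<in> zigzag B P c" for t t' c
    using that unfolding zigzag_def by (induction rule: rtrancl_induct) (auto dest: evstep)
  (* ev is constant on zigzag classes, so the representative does not matter *)
  define \<epsilon> where "\<epsilon> c X = ev (SOME t. t \<in> X)" for c :: 'o and X
  have \<epsilon>: "\<epsilon> c (zigzag B P c `` {t}) = ev t" for c t
  proof -
    have "t \<in> zigzag B P c `` {t}" using zigzag_refl by blast
    then have "(SOME s. s \<in> zigzag B P c `` {t}) \<in> zigzag B P c `` {t}" by (rule someI)
    then have "(t, SOME s. s \<in> zigzag B P c `` {t}) \<in> zigzag B P c" by blast
    from evz[OF this] show ?thesis unfolding \<epsilon>_def by simp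
  qed
  have evQ: "ev t \<in> val Q c" "w \<in> Arr C \<Longrightarrow> Cod C w = c \<Longrightarrow> ev (act w t) = res Q w (ev t)"
      if sec: "t \<in> sections B P c" for t c w
  proof -
    obtain d x f where t: "t = (d, x, f)" "d \<in> Ob D" "x \<in> val P d" "f \<in> Arr C" "Dom C f = c"
        "Cod C f = omap p d"
      using sec B(1) by (cases t) (auto simp: sections_iff hom_iff)
    show "ev t \<in> val Q c" unfolding ev_def t(1) using C.res_val[OF QP t(4), of "\<eta> d x"] t \<eta>Q by simp
    show "ev (act w t) = res Q w (ev t)" if "w \<in> Arr C" "Cod C w = c"
      unfolding ev_def t(1) act_def using C.res_comp[OF QP t(4) that(1)] that t \<eta>Q by simp
  qed
  have "natural C (classes B P) Q \<epsilon>"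
  proof (rule naturalI)
    show "\<epsilon> c X \<in> val Q c" if "c \<in> Ob C" "X \<in> val (classes B P) c" for c X
      using that \<epsilon> evQ by (auto simp: val_classes)
    fix w X assume w: "w \<in> Arr C" and "X \<in> val (classes B P) (Cod C w)"
    then obtain t where t: "X = zigzag B P (Cod C w) `` {t}" "t \<in> sections B P (Cod C w)"
        by (auto simp: val_classes)
    show "\<epsilon> (Dom C w) (res (classes B P) w X) = res Q w (\<epsilon> (Cod C w) X)"
      unfolding t(1) res_classes[OF w t(2)] \<epsilon> by (rule evQ(2)[OF t(2) w refl])
  qed
  then obtain b where b: "natural C L Q b" "\<And>c X. c \<in> Ob C \<Longrightarrow> X \<in> val (classes B P) c \<Longrightarrow> b c (\<theta> c X) = \<epsilon> c X"
    by (rule C.locally_bijective_universal[OF lb presheaf_classes LP C.sheavesD(1)[OF fr(2)]]) (rule that)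
  have b\<tau>: "b c (\<tau> c t) = ev t" if "c \<in> Ob C" "t \<in> sections B P c" for c t
    unfolding \<tau>_def using b(2)[OF that(1)] \<epsilon> that by (simp add: val_classes)
  have ba: "b c (a c s) = s" if cs: "c \<in> Ob C" "s \<in> val Q c" for c s
  proof (rule fr(5)[OF fr(2) C.natural_o[OF an b(1)] _ _ cs, of "\<lambda>c s. s"])
    show "natural C Q Q (\<lambda>c s. s)" by (simp add: natural_def)
    fix d x assume d: "d \<in> Ob D" and x: "x \<in> val P d"
    have \<gamma>L: "\<gamma> d x \<in> val L (omap p d)" by (rule naturalD_pre(1)[OF \<gamma>n d x])
    have "b (omap p d) (\<gamma> d x) = \<eta> d x"
    proof (rule D.sheaf_separated[OF D.sheavesD(1)[OF pre_sheaf[OF fr(2)]] d])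
      show "b (omap p d) (\<gamma> d x) \<in> val (pre Q) d" using natural_val[OF b(1) _ \<gamma>L] d by simp
      show "\<eta> d x \<in> val (pre Q) d" using \<eta>Q d x by simp
      show "locally D K d (\<lambda>k. res (pre Q) k (b (omap p d) (\<gamma> d x)) = res (pre Q) k (\<eta> d x))"
      proof (rule D.locally_mono[OF d gen[OF d]])
        fix k assume k: "k \<in> Arr D" "Cod D k = d"
          and "\<exists>n m. m \<in> Arr D \<and> n \<in> Arr D \<and> Cod D m = Dom D n \<and> Dom D n \<in> B \<and> Cod D n = d \<and> k = n \<cdot>\<^bsub>D\<^esub> m"
        then obtain n m where nm: "n \<in> Arr D" "m \<in> Arr D" "Cod D m = Dom D n" "Dom D n \<in> B" "Cod D n = d"
            "k = n \<cdot>\<^bsub>D\<^esub> m"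
          by blast
        have x': "x \<in> val P (Cod D n)" using x nm by simp
        have "res Q (amap p k) (b (omap p d) (\<gamma> d x)) = b (omap p (Dom D k)) (res L (amap p k) (\<gamma> d x))"
          using natural_res[OF b(1), of "amap p k" "\<gamma> d x"] k \<gamma>L by simp
        also have "\<dots> = ev (Dom D n, res P n x, amap p m)"
          using \<gamma>nm[OF nm(1-5) x] b\<tau>[OF _ Bsec[OF nm(1-4) x']] nm by simp
        also have "\<dots> = res Q (amap p k) (\<eta> d x)"
          unfolding ev_def prod.case nm(6)
          using naturalD_pre(2)[OF fr(3) nm(1) x'] C.res_comp[OF QP, of "amap p n" "amap p m"
              "\<eta> d x"] nm \<eta>Q[OF d x] by simp
        finally show "res (pre Q) k (b (omap p d) (\<gamma> d x)) = res (pre Q) k (\<eta> d x)" using k by simp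
      qed
    qed
    then show "b (omap p d) (a (omap p d) (\<eta> d x)) = \<eta> d x" using a(2)[OF d x] by simp
  qed
  show ?thesis
  proof (rule that[OF B(1) gen])
    fix c s assume c: "c \<in> Ob C" and s: "s \<in> val Q c"
    show "locally C J c (\<lambda>w. \<exists>d x f. (d, x, f) \<in> sections B P (Dom C w) \<and> res Q w s = res Q f (\<eta> d x))"
    proof (rule C.locally_mono[OF c \<tau>s[OF c natural_val[OF an c s]]])
      fix w assume w: "w \<in> Arr C" "Cod C w = c"
          and "\<exists>t \<in> sections B P (Dom C w). res L w (a c s) = \<tau> (Dom C w) t"
      then obtain d x f where t: "(d, x, f) \<in> sections B P (Dom C w)" "res L w (a c s) = \<tau> (Dom C w) (d, x, f)"
          by auto
      have ws: "res Q w s \<in> val Q (Dom C w)" using C.res_val[OF QP w(1)] w s by simp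
      have "res Q w s = b (Dom C w) (a (Dom C w) (res Q w s))" using ba[OF _ ws] w by simp
      also have "\<dots> = b (Dom C w) (\<tau> (Dom C w) (d, x, f))" using natural_res[OF an w(1)] w s t(2) by simp
      also have "\<dots> = res Q f (\<eta> d x)" using b\<tau>[OF _ t(1)] w unfolding ev_def by simp
      finally show "\<exists>d x f. (d, x, f) \<in> sections B P (Dom C w) \<and> res Q w s = res Q f (\<eta> d x)" using t(1)
          by blast
    qed
  next
    fix c d x f d' x' f' assume c: "c \<in> Ob C"
        and t: "(d, x, f) \<in> sections B P c" "(d', x', f') \<in> sections B P c"
      and eq: "res Q f (\<eta> d x) = res Q f' (\<eta> d' x')"
    have a\<tau>: "a c (res Q f (\<eta> d x)) = \<tau> c (d, x, f)" if t: "(d, x, f) \<in> sections B P c" for d x f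
    proof -
      have d: "d \<in> B" "d \<in> Ob D" "x \<in> val P d" "f \<in> Arr C" "Dom C f = c" "Cod C f = omap p d"
        using t B(1) by (auto simp: sections_iff hom_iff)
      have sec: "(d, x, Ide C (omap p d)) \<in> sections B P (Cod C f)" using d by (simp add: sections_iff hom_iff)
      have "a c (res Q f (\<eta> d x)) = res L f (\<gamma> d x)"
        using natural_res[OF an d(4), of "\<eta> d x"] d \<eta>Q a(2)[OF d(2,3)] by simp
      also have "\<dots> = \<tau> c (act f (d, x, Ide C (omap p d)))"
        using \<tau>r[OF d(4) sec] \<gamma>B[OF d(1,3)] d by simp
      also have "act f (d, x, Ide C (omap p d)) = (d, x, f)" using d unfolding act_def by simp
      finally show ?thesis .
    qed
    show "locally C J c (\<lambda>w. (act w (d, x, f), act w (d', x', f')) \<in> zigzag B P (Dom C w))"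
      by (rule \<tau>i[OF c t]) (use a\<tau>[OF t(1)] a\<tau>[OF t(2)] eq in simp)
  qed
qed

end

section \<open>Descent and cofinality\<close>

context cont_comorphism
begin

lemma fact_obs_iff: "(d', v', f') \<in> fact_obs D C p f d \<longleftrightarrow> d' \<in> Ob D \<and>
    v' \<in> Arr C \<and> Dom C v' = omap p d' \<and> Cod C v' = Dom C f \<and>
    f' \<in> Arr D \<and> Dom D f' = d' \<and> Cod D f' = d \<and> f \<cdot>\<^bsub>C\<^esub> v' = amap p f'"
  unfolding fact_obs_def by (auto simp: hom_iff)

lemma fact_obs_comp:
  assumes f: "f \<in> Arr C" "Cod C f = omap p d" and i: "(d', v', f') \<in> fact_obs D C p f d"
    and k: "k \<in> Arr D" "Cod D k = d'"
  shows "(Dom D k, v' \<cdot>\<^bsub>C\<^esub> amap p k, f' \<cdot>\<^bsub>D\<^esub> k) \<in> fact_obs D C p f d"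
proof -
  have "f \<cdot>\<^bsub>C\<^esub> (v' \<cdot>\<^bsub>C\<^esub> amap p k) = (f \<cdot>\<^bsub>C\<^esub> v') \<cdot>\<^bsub>C\<^esub> amap p k"
    by (rule C.comp_assoc[symmetric]) (use assms in \<open>simp_all add: fact_obs_iff\<close>)
  also have "\<dots> = amap p f' \<cdot>\<^bsub>C\<^esub> amap p k" using i by (simp add: fact_obs_iff)
  finally show ?thesis using assms by (simp add: fact_obs_iff)
qed

text \<open>A compatible family on the category of factorizations. An arrow into \<open>(d', v', f')\<close> is given by
  an arrow \<open>k\<close> into \<open>d'\<close>, which determines its source.\<close>

definition fact_family :: "'a \<Rightarrow> 'd \<Rightarrow> ('o, 'a, 'u) psh \<Rightarrow> ('d \<Rightarrow> 'a \<Rightarrow> 'b \<Rightarrow> 'u) \<Rightarrow> bool" where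
  "fact_family f d F y \<longleftrightarrow>
     (\<forall>d' v' f'. (d', v', f') \<in> fact_obs D C p f d \<longrightarrow> y d' v' f' \<in> val F (omap p d')) \<and>
     (\<forall>d' v' f' k. (d', v', f') \<in> fact_obs D C p f d \<longrightarrow> k \<in> Arr D \<longrightarrow> Cod D k = d' \<longrightarrow>
        res F (amap p k) (y d' v' f') = y (Dom D k) (v' \<cdot>\<^bsub>C\<^esub> amap p k) (f' \<cdot>\<^bsub>D\<^esub> k))"

definition unique_amalgamation :: "'a \<Rightarrow> 'd \<Rightarrow> bool" where
  "unique_amalgamation f d \<longleftrightarrow> (\<forall>F \<in> sheaves U C J.
     (\<forall>y. fact_family f d F y \<longrightarrow> (\<exists>z \<in> val F (Dom C f).
        \<forall>d' v' f'. (d', v', f') \<in> fact_obs D C p f d \<longrightarrow> res F v' z = y d' v' f')) \<and>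
     (\<forall>z \<in> val F (Dom C f). \<forall>z' \<in> val F (Dom C f).
        (\<forall>d' v' f'. (d', v', f') \<in> fact_obs D C p f d \<longrightarrow> res F v' z = res F v' z') \<longrightarrow> z = z'))"

lemma J_cofinal_fact_iff:
  assumes d: "d \<in> Ob D" and f: "f \<in> hom C c (omap p d)"
  shows "J_cofinal U C J c (fact_cat D C p f d) (fact_proj p) \<longleftrightarrow> unique_amalgamation f d"
proof -
  let ?I = "fact_cat D C p f d"
  have fA: "f \<in> Arr C" "Dom C f = c" "Cod C f = omap p d" "c \<in> Ob C" using f by (auto simp: hom_iff)
  have ObI: "Ob ?I = fact_obs D C p f d" and DomI: "Dom ?I (x, k, y) = x" and CodI: "Cod ?I (x, k, y) = y"
      for x k y
    unfolding fact_cat_def by simp_all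
  have ArrI: "((d1, v1, f1), k, (d2, v2, f2)) \<in> Arr ?I \<longleftrightarrow> (d1, v1, f1) \<in> fact_obs D C p f d \<and>
     (d2, v2, f2) \<in> fact_obs D C p f d \<and> k \<in> hom D d1 d2 \<and> v2 \<cdot>\<^bsub>C\<^esub> amap p k = v1 \<and> f2 \<cdot>\<^bsub>D\<^esub> k = f1"
    for d1 v1 f1 k d2 v2 f2 unfolding fact_cat_def by simp
  have G: "is_functor ?I (slice_cat C c) (fact_proj p)"
    unfolding is_functor_def
  proof (intro conjI ballI impI)
    fix i assume "i \<in> Ob ?I"
    then show "omap (fact_proj p) i \<in> Ob (slice_cat C c)"
      "amap (fact_proj p) (Ide ?I i) = Ide (slice_cat C c) (omap (fact_proj p) i)"
      using fA by (auto simp: ObI fact_obs_def fact_cat_def fact_proj_def slice_cat_def)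
  next
    fix u assume "u \<in> Arr ?I"
    then show "amap (fact_proj p) u \<in> hom (slice_cat C c) (omap (fact_proj p) (Dom ?I u)) (omap (fact_proj p)
        (Cod ?I u))"
      using fA by (cases u) (auto simp: ArrI DomI CodI hom_iff[of _ "slice_cat C c"] fact_proj_def slice_cat_def
          fact_obs_iff hom_iff)
  next
    fix u w assume "u \<in> Arr ?I" "w \<in> Arr ?I" "Cod ?I u = Dom ?I w"
    then show "amap (fact_proj p) (w \<cdot>\<^bsub>?I\<^esub> u) = amap (fact_proj p) w \<cdot>\<^bsub>slice_cat C c\<^esub> amap (fact_proj p) u"
      by (cases u; cases w) (auto simp: ArrI DomI CodI fact_proj_def slice_cat_def fact_cat_def hom_iff)
  qed
  have I: "Dom ?I u \<in> Ob ?I \<and> Cod ?I u \<in> Ob ?I" if "u \<in> Arr ?I" for u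
    using that by (cases u) (auto simp: ArrI DomI CodI ObI)
  have o: "fst (omap (fact_proj p) (d', v', f')) = omap p d'" "snd (omap (fact_proj p) (d', v', f')) = v'"
      for d' v' f'
    unfolding fact_proj_def by simp_all
  have fam: "C.compatible_family ?I (fact_proj p) F y \<longleftrightarrow> fact_family f d F (\<lambda>d' v' f'. y (d', v', f'))" for F y
    unfolding C.compatible_family_def fact_family_def
  proof (intro conj_cong iffI allI impI ballI)
    show "y (d', v', f') \<in> val F (omap p d')"
      if "\<forall>i \<in> Ob ?I. y i \<in> val F (fst (omap (fact_proj p) i))" "(d', v', f') \<in> fact_obs D C p f d" for d' v' f'
      using bspec[OF that(1), of "(d', v', f')"] that(2) by (simp add: ObI o)
    show "y i \<in> val F (fst (omap (fact_proj p) i))"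
      if "\<forall>d' v' f'. (d', v', f') \<in> fact_obs D C p f d \<longrightarrow> y (d', v', f') \<in> val F (omap p d')" "i \<in> Ob ?I" for i
      using that by (cases i) (auto simp: ObI o)
    show "res F (amap p k) (y (d', v', f')) = y (Dom D k, v' \<cdot>\<^bsub>C\<^esub> amap p k, f' \<cdot>\<^bsub>D\<^esub> k)"
      if a: "\<forall>u \<in> Arr ?I. res F (fst (snd (amap (fact_proj p) u))) (y (Cod ?I u)) = y (Dom ?I u)"
        and i: "(d', v', f') \<in> fact_obs D C p f d" and k: "k \<in> Arr D" "Cod D k = d'" for d' v' f' k
    proof -
      have "((Dom D k, v' \<cdot>\<^bsub>C\<^esub> amap p k, f' \<cdot>\<^bsub>D\<^esub> k), k, (d', v', f')) \<in> Arr ?I"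
        using fact_obs_comp[OF fA(1,3) i k] i k by (simp add: ArrI hom_iff)
      from bspec[OF a this] show ?thesis by (simp add: DomI CodI fact_proj_def)
    qed
    show "res F (fst (snd (amap (fact_proj p) u))) (y (Cod ?I u)) = y (Dom ?I u)"
      if a: "\<forall>d' v' f' k. (d', v', f') \<in> fact_obs D C p f d \<longrightarrow> k \<in> Arr D \<longrightarrow> Cod D k = d' \<longrightarrow>
        res F (amap p k) (y (d', v', f')) = y (Dom D k, v' \<cdot>\<^bsub>C\<^esub> amap p k, f' \<cdot>\<^bsub>D\<^esub> k)" and u: "u \<in> Arr ?I" for u
    proof -
      obtain d1 v1 f1 k d2 v2 f2 where e: "u = ((d1, v1, f1), k, (d2, v2, f2))" by (metis prod_cases3)
      show ?thesis using u a unfolding e by (auto simp: ArrI DomI CodI fact_proj_def hom_iff)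
    qed
  qed
  have ext: "(\<forall>y. C.compatible_family ?I (fact_proj p) F y \<longrightarrow>
        (\<exists>z \<in> val F c. \<forall>i \<in> Ob ?I. res F (snd (omap (fact_proj p) i)) z = y i)) \<longleftrightarrow>
      (\<forall>y. fact_family f d F y \<longrightarrow> (\<exists>z \<in> val F (Dom C f).
        \<forall>d' v' f'. (d', v', f') \<in> fact_obs D C p f d \<longrightarrow> res F v' z = y d' v' f'))" (is "?l \<longleftrightarrow> ?r") for F
  proof
    assume l: ?l
    show ?r
    proof (intro allI impI)
      fix y assume "fact_family f d F y"
      then have "C.compatible_family ?I (fact_proj p) F (\<lambda>(d', v', f'). y d' v' f')" unfolding fam by simp
      with l obtain z where "z \<in> val F c"
          "\<forall>i \<in> Ob ?I. res F (snd (omap (fact_proj p) i)) z = (case i of (d', v', f') \<Rightarrow> y d' v' f')"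
        by blast
      then show "\<exists>z \<in> val F (Dom C f). \<forall>d' v' f'. (d', v', f') \<in> fact_obs D C p f d \<longrightarrow> res F v' z = y d' v' f'"
        using fA(2) by (intro bexI[of _ z]) (auto simp: ObI o dest!: bspec)
    qed
  next
    assume r: ?r
    show ?l
    proof (intro allI impI)
      fix y assume "C.compatible_family ?I (fact_proj p) F y"
      then obtain z where "z \<in> val F c" "\<forall>d' v' f'. (d', v', f') \<in> fact_obs D C p f d \<longrightarrow>
          res F v' z = y (d', v', f')"
        using r fA(2) unfolding fam by blast
      then show "\<exists>z \<in> val F c. \<forall>i \<in> Ob ?I. res F (snd (omap (fact_proj p) i)) z = y i"
        by (intro bexI[of _ z]) (auto simp: ObI o)
    qed
  qed
  have un: "(\<forall>i \<in> Ob ?I. res F (snd (omap (fact_proj p) i)) z = res F (snd (omap (fact_proj p) i)) z') \<longleftrightarrow>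
      (\<forall>d' v' f'. (d', v', f') \<in> fact_obs D C p f d \<longrightarrow> res F v' z = res F v' z')" for F and z z' :: 'u
    unfolding ObI by (auto simp: o split_paired_Ball_Sigma) (metis o(2))+
  show ?thesis
    using C.J_cofinal_iff[OF fA(4) G I] unfolding unique_amalgamation_def ext un fA(2) by simp
qed

text \<open>Since \<open>l_obj d\<close> represents the sections at \<open>d\<close>, the sheaf \<open>Q\<close> represents the sections at \<open>p d\<close>,
  with universal element \<open>s\<^sub>0\<close>. Let \<open>u\<close> be the arrow that sends the universal element of \<open>l_obj c\<close> to the
  restriction of \<open>s\<^sub>0\<close> along \<open>f\<close>. Locally, a pair in the fibre product consists of the elements named
  by some \<open>f' : d' \<rightarrow> d\<close> and \<open>v' : p d' \<rightarrow> c\<close>, and that both have the same image in \<open>Q\<close> means,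
  locally again, that \<open>f \<cdot> v' = p f'\<close>. So a compatible family on the factorizations of \<open>f\<close> glues to a
  natural map on the fibre product, and the value of its descent at the universal element of
  \<open>l_obj c\<close> is the amalgamation.\<close>

lemma unique_amalgamation_of_descent:
  assumes d: "d \<in> Ob D" and f: "f \<in> Arr C" "Cod C f = omap p d" and c_def: "c = Dom C f"
    and frP: "free_along (D.l_obj d) Q h"
    and des: "\<And>u. nat_trans C (C.l_obj c) Q u \<Longrightarrow> descent (D.l_obj d) h (C.l_obj c) u"
  shows "unique_amalgamation f d"
proof -
  have c: "c \<in> Ob C" using f c_def by simp
  let ?P = "D.l_obj d" and ?x0 = "D.l_elem d" and ?E = "C.l_obj c" and ?e0 = "C.l_elem c"
  note rP = D.l_representing[OF d] and rE = C.l_representing[OF c]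
  note repP = D.representingD[OF rP] and repE = C.representingD[OF rE]
  note P = repP(2) and E = repE(2)
  note PP = D.sheavesD(2)[OF P] and EP = C.sheavesD(2)[OF E]
  note frp = free_alongD[OF frP]
  note QP = C.sheavesD(2)[OF frp(2)]
  define s0 where "s0 = h d ?x0"
  have s0: "s0 \<in> val Q (omap p d)" unfolding s0_def by (rule naturalD_pre(1)[OF frp(3) d repP(3)])
  (* maps Q -> F are maps ?P -> pre F, that is, elements of F at p d *)
  have rQ: "C.representing (omap p d) Q s0"
    unfolding C.representing_def
  proof (intro conjI ballI allI impI p_Ob d frp(2) s0)
    fix F assume F: "F \<in> sheaves U C J"
    show "\<exists>\<beta>. nat_trans C Q F \<beta> \<and> \<beta> (omap p d) s0 = z" if z: "z \<in> val F (omap p d)" for z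
    proof -
      have "z \<in> val (pre F) d" using z d by simp
      then obtain \<beta> where b: "nat_trans D ?P (pre F) \<beta>" "\<beta> d ?x0 = z" using repP(4)[OF pre_sheaf[OF F]] by blast
      obtain \<psi> where "nat_trans C Q F \<psi>" "\<forall>d \<in> Ob D. \<forall>x \<in> val ?P d. \<psi> (omap p d) (h d x) = \<beta> d x"
        using frp(4)[OF F nat_trans_natural[OF b(1)]] by blast
      then show ?thesis using b(2) d repP(3) unfolding s0_def by blast
    qed
    fix \<psi> \<psi>' b s assume n: "natural C Q F \<psi>" "natural C Q F \<psi>'" and eq: "\<psi> (omap p d) s0 = \<psi>' (omap p d) s0"
      and b: "b \<in> Ob C" and s: "s \<in> val Q b"
    note m = D.natural_o[OF frp(3) pre_natural[OF n(1)]] D.natural_o[OF frp(3) pre_natural[OF n(2)]]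
    show "\<psi> b s = \<psi>' b s"
      by (rule frp(5)[OF F n _ b s]) (rule repP(5)[OF pre_sheaf[OF F] m], use eq s0_def in simp_all)
  qed
  note lbP = D.locally_bijectiveD[OF D.representing_locally_bijective[OF rP]]
  note lbE = C.locally_bijectiveD[OF C.representing_locally_bijective[OF rE]]
  note lbQ = C.locally_bijectiveD[OF C.representing_locally_bijective[OF rQ]]
  have fs0: "res Q f s0 \<in> val Q c" using C.res_val[OF QP f(1)] f s0 c_def by simp
  then obtain u where u: "nat_trans C ?E Q u" "u c ?e0 = res Q f s0" using repE(4)[OF frp(2)] by blast
  note un = nat_trans_natural[OF u(1)]
  note des = des[OF u(1)]
  have hP: "h (Dom D f') (res ?P f' ?x0) = res Q (amap p f') s0" if "f' \<in> Arr D" "Cod D f' = d" for f'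
    using naturalD_pre(2)[OF frp(3) that(1), of ?x0] repP(3) that s0_def by simp
  have uE: "u (Dom C v) (res ?E v ?e0) = res Q (f \<cdot>\<^bsub>C\<^esub> v) s0" if "v \<in> Arr C" "Cod C v = c" for v
    using natural_res[OF un that(1), of ?e0] repE(3) that u(2) C.res_comp[OF QP f(1) that(1), of s0] s0 f c_def
        by simp
  let ?img = "\<lambda>d1 x e v f'. (d1, v, f') \<in> fact_obs D C p f d \<and> x = res ?P f' ?x0 \<and> e = res ?E v ?e0"
  (* Locally x and e are named by arrows f' and v. On a further covering these form a
     factorization of f, because u e and h x agree. *)
  have loc: "locally D K d1 (\<lambda>k. \<exists>v f'. ?img (Dom D k) (res ?P k x) (res ?E (amap p k) e) v f')"
    if o: "over ?P h ?E u d1 x e" for d1 x e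
  proof -
    have d1: "d1 \<in> Ob D" "x \<in> val ?P d1" "e \<in> val ?E (omap p d1)" "u (omap p d1) e = h d1 x"
      using o unfolding over_def by auto
    have 1: "locally D K d1 (\<lambda>k. \<exists>f' \<in> val (yoneda_obj D d) (Dom D k). res ?P k x = res ?P f' ?x0)"
      by (rule lbP(3)[OF d1(1,2)])
    have "locally C J (omap p d1) (\<lambda>w. \<exists>v \<in> val (yoneda_obj C c) (Dom C w). res ?E w e = res ?E v ?e0)"
      by (rule lbE(3)[OF p_Ob[OF d1(1)] d1(3)])
    note 2 = locally_lift[OF d1(1) this]
    show ?thesis
    proof (rule D.locally_trans[OF d1(1) D.locally_conj[OF d1(1) 1 2]])
      fix k assume k: "k \<in> Arr D" "Cod D k = d1" and
        ex: "(\<exists>f' \<in> val (yoneda_obj D d) (Dom D k). res ?P k x = res ?P f' ?x0) \<and>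
          (\<exists>v \<in> val (yoneda_obj C c) (Dom C (amap p k)). res ?E (amap p k) e = res ?E v ?e0)"
      from ex obtain f' where f': "f' \<in> Arr D" "Dom D f' = Dom D k" "Cod D f' = d" "res ?P k x = res ?P f' ?x0"
        using k by (auto simp: D.val_yoneda hom_iff)
      from ex obtain v where v: "v \<in> Arr C" "Dom C v = omap p (Dom D k)" "Cod C v = c"
          "res ?E (amap p k) e = res ?E v ?e0"
        using k by (auto simp: C.val_yoneda hom_iff)
      have "res Q (f \<cdot>\<^bsub>C\<^esub> v) s0 = u (omap p (Dom D k)) (res ?E (amap p k) e)" using uE[OF v(1,3)] v by simp
      also have "\<dots> = res Q (amap p k) (h d1 x)" using natural_res[OF un p_Arr[OF k(1)], of e] k d1 by simp
      also have "\<dots> = h (Dom D k) (res ?P k x)" using naturalD_pre(2)[OF frp(3) k(1), of x] k d1 by simp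
      also have "\<dots> = res Q (amap p f') s0" using hP[OF f'(1,3)] f' by simp
      finally have "locally C J (omap p (Dom D k)) (\<lambda>w. res (yoneda_obj C (omap p d)) w (f \<cdot>\<^bsub>C\<^esub> v) =
          res (yoneda_obj C (omap p d)) w (amap p f'))"
        using k f' v f c_def by (intro lbQ(2)) (simp_all add: C.val_yoneda hom_iff)
      from locally_lift[OF _ this] k
      have "locally D K (Dom D k) (\<lambda>l. res (yoneda_obj C (omap p d)) (amap p l) (f \<cdot>\<^bsub>C\<^esub> v) =
          res (yoneda_obj C (omap p d)) (amap p l) (amap p f'))" by simp
      then show "locally D K (Dom D k) (\<lambda>l. \<exists>v f'. ?img (Dom D (k \<cdot>\<^bsub>D\<^esub> l)) (res ?P (k \<cdot>\<^bsub>D\<^esub> l) x) (res ?E (amap p (k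
          \<cdot>\<^bsub>D\<^esub> l)) e) v f')"
      proof (rule D.locally_mono[rotated])
        fix l assume l: "l \<in> Arr D" "Cod D l = Dom D k" and
          eq: "res (yoneda_obj C (omap p d)) (amap p l) (f \<cdot>\<^bsub>C\<^esub> v) = res (yoneda_obj C (omap p d)) (amap p l)
              (amap p f')"
        have eq': "f \<cdot>\<^bsub>C\<^esub> (v \<cdot>\<^bsub>C\<^esub> amap p l) = amap p f' \<cdot>\<^bsub>C\<^esub> amap p l"
          using eq l k v f f' c_def by (simp add: C.res_yoneda hom_iff)
        show "\<exists>v f'. ?img (Dom D (k \<cdot>\<^bsub>D\<^esub> l)) (res ?P (k \<cdot>\<^bsub>D\<^esub> l) x) (res ?E (amap p (k \<cdot>\<^bsub>D\<^esub> l)) e) v f'"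
        proof (intro exI conjI)
          show "(Dom D (k \<cdot>\<^bsub>D\<^esub> l), v \<cdot>\<^bsub>C\<^esub> amap p l, f' \<cdot>\<^bsub>D\<^esub> l) \<in> fact_obs D C p f d"
            using eq' l k v f f' c_def by (simp add: fact_obs_iff)
          show "res ?P (k \<cdot>\<^bsub>D\<^esub> l) x = res ?P (f' \<cdot>\<^bsub>D\<^esub> l) ?x0"
            using D.res_comp[OF PP k(1) l(1), of x] D.res_comp[OF PP f'(1) l(1), of ?x0] k l f' d1 repP(3)
                by simp
          show "res ?E (amap p (k \<cdot>\<^bsub>D\<^esub> l)) e = res ?E (v \<cdot>\<^bsub>C\<^esub> amap p l) ?e0"
            using C.res_comp[OF EP p_Arr[OF k(1)] p_Arr[OF l(1)], of e] C.res_comp[OF EP v(1) p_Arr[OF l(1)],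
                of ?e0] k l v d1 repE(3)
            by simp
        qed
      qed (use k in simp)
    qed
  qed
  have overI: "over ?P h ?E u d' (res ?P f' ?x0) (res ?E v ?e0)" if i: "(d', v, f') \<in> fact_obs D C p f d"
      for d' v f'
  proof -
    have a: "d' \<in> Ob D" "v \<in> Arr C" "Dom C v = omap p d'" "Cod C v = c" "f' \<in> Arr D" "Dom D f' = d'"
        "Cod D f' = d"
      "f \<cdot>\<^bsub>C\<^esub> v = amap p f'" using i c_def by (auto simp: fact_obs_iff)
    show ?thesis unfolding over_def
      using a uE[OF a(2,4)] hP[OF a(5,7)] D.res_val[OF PP a(5), of ?x0 d'] C.res_val[OF EP a(2), of ?e0
          "omap p d'"] repP(3) repE(3) by simp
  qed
  show ?thesis unfolding unique_amalgamation_def c_def[symmetric]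
  proof (intro ballI conjI allI impI)
    fix F y assume F: "F \<in> sheaves U C J" and y: "fact_family f d F y"
    note FS = D.sheavesD(1)[OF pre_sheaf[OF F]] and FP = C.sheavesD(2)[OF F]
    have yF: "y d' v f' \<in> val F (omap p d')" if "(d', v, f') \<in> fact_obs D C p f d" for d' v f'
      using y that unfolding fact_family_def by blast
    have yr: "res F (amap p k) (y d' v f') = y (Dom D k) (v \<cdot>\<^bsub>C\<^esub> amap p k) (f' \<cdot>\<^bsub>D\<^esub> k)"
      if "(d', v, f') \<in> fact_obs D C p f d" "k \<in> Arr D" "Cod D k = d'" for d' v f' k
      using y that unfolding fact_family_def by blast
    define Rel where "Rel d1 xe k z \<longleftrightarrow>
        (\<exists>v f'. ?img (Dom D k) (res ?P k (fst xe)) (res ?E (amap p k) (snd xe)) v f' \<and> z = y (Dom D k) v f')"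
      for d1 :: 'd and xe k z
    note WP = presheaf_fibre_product[OF P frp(2,3) E un]
    obtain \<phi> where \<phi>n: "natural D (fibre_product ?P h ?E u) (pre F) \<phi>"
      and \<phi>: "\<And>d1 xe k z. d1 \<in> Ob D \<Longrightarrow> xe \<in> val (fibre_product ?P h ?E u) d1 \<Longrightarrow> k \<in> Arr D \<Longrightarrow> Cod D k = d1 \<Longrightarrow>
        Rel d1 xe k z \<Longrightarrow> res (pre F) k (\<phi> d1 xe) = z"
    proof (rule D.glue_natural[OF FS WP, of Rel])
      show "locally D K d1 (\<lambda>k. \<exists>z. Rel d1 xe k z)" if d1: "d1 \<in> Ob D"
          and xe: "xe \<in> val (fibre_product ?P h ?E u) d1" for d1 xe
        by (rule D.locally_mono[OF d1 loc[OF fibre_productE[OF d1 xe]]]) (unfold Rel_def, blast)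
      show "z \<in> val (pre F) (Dom D k)" if "k \<in> Arr D" "Rel d1 xe k z" for d1 xe k z
          using that yF unfolding Rel_def by auto
      show "Rel d1 xe (k \<cdot>\<^bsub>D\<^esub> l) (res (pre F) l z)"
        if d1': "d1 \<in> Ob D" "xe \<in> val (fibre_product ?P h ?E u) d1" and k: "k \<in> Arr D" "Cod D k = d1"
          and l: "l \<in> Arr D" "Cod D l = Dom D k" and r: "Rel d1 xe k z" for d1 xe k l z
        proof -
          obtain x e where xe: "xe = (x, e)" by (cases xe)
          have d1: "d1 \<in> Ob D" "x \<in> val ?P d1" "e \<in> val ?E (omap p d1)"
            using fibre_productE[OF d1'] unfolding xe over_def by auto
          obtain v f' where i: "(Dom D k, v, f') \<in> fact_obs D C p f d" "res ?P k x = res ?P f' ?x0"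
            "res ?E (amap p k) e = res ?E v ?e0" "z = y (Dom D k) v f'" using r unfolding Rel_def xe by auto
          have f': "f' \<in> Arr D" "Dom D f' = Dom D k" "Cod D f' = d"
              and v: "v \<in> Arr C" "Dom C v = omap p (Dom D k)" "Cod C v = c"
            using i(1) c_def by (auto simp: fact_obs_iff)
          show ?thesis unfolding Rel_def xe fst_conv snd_conv
          proof (intro exI conjI)
            show "(Dom D (k \<cdot>\<^bsub>D\<^esub> l), v \<cdot>\<^bsub>C\<^esub> amap p l, f' \<cdot>\<^bsub>D\<^esub> l) \<in> fact_obs D C p f d"
              using fact_obs_comp[OF f i(1) l] k l by simp
            show "res ?P (k \<cdot>\<^bsub>D\<^esub> l) x = res ?P (f' \<cdot>\<^bsub>D\<^esub> l) ?x0"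
              using D.res_comp[OF PP k(1) l(1), of x] D.res_comp[OF PP f'(1) l(1), of ?x0] k l f' d1 repP(3)
                  i(2) by simp
            show "res ?E (amap p (k \<cdot>\<^bsub>D\<^esub> l)) e = res ?E (v \<cdot>\<^bsub>C\<^esub> amap p l) ?e0"
              using C.res_comp[OF EP p_Arr[OF k(1)] p_Arr[OF l(1)], of e] C.res_comp[OF EP v(1) p_Arr[OF l(1)],
                  of ?e0] k l v d1 repE(3) i(3)
              by simp
            show "res (pre F) l z = y (Dom D (k \<cdot>\<^bsub>D\<^esub> l)) (v \<cdot>\<^bsub>C\<^esub> amap p l) (f' \<cdot>\<^bsub>D\<^esub> l)"
              using yr[OF i(1) l] i(4) k l by simp
          qed
        qed
      show "z = z'" if k: "k \<in> Arr D" "Cod D k = d1" and r: "Rel d1 xe k z" "Rel d1 xe k z'" for d1 xe k z z'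
        proof -
          obtain x e where xe: "xe = (x, e)" by (cases xe)
          obtain v f' where i: "(Dom D k, v, f') \<in> fact_obs D C p f d" "res ?P k x = res ?P f' ?x0"
            "res ?E (amap p k) e = res ?E v ?e0" "z = y (Dom D k) v f'" using r unfolding Rel_def xe by auto
          obtain v2 f2 where i2: "(Dom D k, v2, f2) \<in> fact_obs D C p f d" "res ?P k x = res ?P f2 ?x0"
            "res ?E (amap p k) e = res ?E v2 ?e0" "z' = y (Dom D k) v2 f2" using r unfolding Rel_def xe by auto
          have f': "f' \<in> Arr D" "Dom D f' = Dom D k" "Cod D f' = d"
              and v: "v \<in> Arr C" "Dom C v = omap p (Dom D k)" "Cod C v = c"
            using i(1) c_def by (auto simp: fact_obs_iff)
          have f2: "f2 \<in> Arr D" "Dom D f2 = Dom D k" "Cod D f2 = d"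
              and v2: "v2 \<in> Arr C" "Dom C v2 = omap p (Dom D k)" "Cod C v2 = c"
            using i2(1) c_def by (auto simp: fact_obs_iff)
          have dk: "Dom D k \<in> Ob D" using k by simp
          have 1: "locally D K (Dom D k) (\<lambda>l. res (yoneda_obj D d) l f' = res (yoneda_obj D d) l f2)"
            by (rule lbP(2)) (use dk f' f2 i(2) i2(2) in \<open>simp_all add: D.val_yoneda hom_iff\<close>)
          have "locally C J (omap p (Dom D k)) (\<lambda>w. res (yoneda_obj C c) w v = res (yoneda_obj C c) w v2)"
            by (rule lbE(2)) (use dk v v2 i(3) i2(3) in \<open>simp_all add: C.val_yoneda hom_iff\<close>)
          note 2 = locally_lift[OF dk this]
          show ?thesis
          proof (rule D.sheaf_separated[OF FS dk])
            show "z \<in> val (pre F) (Dom D k)" "z' \<in> val (pre F) (Dom D k)" using yF i(1,4) i2(1,4) dk by simp_all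
            show "locally D K (Dom D k) (\<lambda>l. res (pre F) l z = res (pre F) l z')"
            proof (rule D.locally_mono[OF dk D.locally_conj[OF dk 1 2]])
              fix l assume l: "l \<in> Arr D" "Cod D l = Dom D k"
                  and eq: "res (yoneda_obj D d) l f' = res (yoneda_obj D d) l f2 \<and>
                 res (yoneda_obj C c) (amap p l) v = res (yoneda_obj C c) (amap p l) v2"
              have "f' \<cdot>\<^bsub>D\<^esub> l = f2 \<cdot>\<^bsub>D\<^esub> l" "v \<cdot>\<^bsub>C\<^esub> amap p l = v2 \<cdot>\<^bsub>C\<^esub> amap p l"
                using eq l f' f2 v v2 by (simp_all add: D.res_yoneda C.res_yoneda hom_iff)
              then show "res (pre F) l z = res (pre F) l z'"
                using yr[OF i(1) l] yr[OF i2(1) l] i(4) i2(4) l by simp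
            qed
          qed
        qed
      show "Rel (Cod D k) xe (k \<cdot>\<^bsub>D\<^esub> l) z"
        if k: "k \<in> Arr D" and xe': "xe \<in> val (fibre_product ?P h ?E u) (Cod D k)"
            and l: "l \<in> Arr D" "Cod D l = Dom D k"
          and r: "Rel (Dom D k) (res (fibre_product ?P h ?E u) k xe) l z" for k xe l z
      proof -
        obtain x e where xe: "xe = (x, e)" by (cases xe)
        have o: "over ?P h ?E u (Cod D k) x e" using fibre_productE[OF _ xe'] k unfolding xe by simp
        then have "x \<in> val ?P (Cod D k)" "e \<in> val ?E (omap p (Cod D k))" unfolding over_def by auto
        then show ?thesis
          using r D.res_comp[OF PP k l, of x] C.res_comp[OF EP p_Arr[OF k] p_Arr[OF l(1)], of e] k l
          unfolding Rel_def xe res_fibre_product[OF k o] by simp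
      qed
    qed (rule that)
    obtain \<psi> where \<psi>: "natural C ?E F \<psi>" "\<And>d x e. over ?P h ?E u d x e \<Longrightarrow> \<psi> (omap p d) e = \<phi> d (x, e)"
      using des F natural_over_fibre_product[OF \<phi>n] unfolding descent_def by blast
    show "\<exists>z \<in> val F c. \<forall>d' v' f'. (d', v', f') \<in> fact_obs D C p f d \<longrightarrow> res F v' z = y d' v' f'"
    proof (intro bexI[of _ "\<psi> c ?e0"] allI impI)
      show "\<psi> c ?e0 \<in> val F c" by (rule natural_val[OF \<psi>(1) c repE(3)])
      fix d' v f' assume i: "(d', v, f') \<in> fact_obs D C p f d"
      have a: "d' \<in> Ob D" "v \<in> Arr C" "Dom C v = omap p d'" "Cod C v = c" "f' \<in> Arr D" "Dom D f' = d'"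
          "Cod D f' = d"
        using i c_def by (auto simp: fact_obs_iff)
      note o = overI[OF i]
      have xe: "res ?P f' ?x0 \<in> val ?P d'" "res ?E v ?e0 \<in> val ?E (omap p d')" using o unfolding over_def
          by auto
      have "Rel d' (res ?P f' ?x0, res ?E v ?e0) (Ide D d') (y d' v f')"
        unfolding Rel_def using i a xe D.res_Ide[OF PP a(1)] C.res_Ide[OF EP p_Ob[OF a(1)]] by auto
      from \<phi>[OF a(1) fibre_productI[OF o] _ _ this] have "\<phi> d' (res ?P f' ?x0, res ?E v ?e0) = y d' v f'"
        using a naturalD_pre(1)[OF \<phi>n a(1) fibre_productI[OF o]] C.res_Ide[OF FP p_Ob[OF a(1)]] by simp
      then show "res F v (\<psi> c ?e0) = y d' v f'" using natural_res[OF \<psi>(1) a(2), of ?e0] \<psi>(2)[OF o] a repE(3)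
          by simp
    qed
  next
    fix F z z' assume F: "F \<in> sheaves U C J" and z: "z \<in> val F c" "z' \<in> val F c"
      and eq: "\<forall>d' v' f'. (d', v', f') \<in> fact_obs D C p f d \<longrightarrow> res F v' z = res F v' z'"
    note FS = D.sheavesD(1)[OF pre_sheaf[OF F]]
    obtain \<psi> where p: "natural C ?E F \<psi>" "\<psi> c ?e0 = z" using repE(4)[OF F z(1)] nat_trans_natural by blast
    obtain \<psi>' where p': "natural C ?E F \<psi>'" "\<psi>' c ?e0 = z'" using repE(4)[OF F z(2)] nat_trans_natural by blast
    have "\<psi> (omap p d1) e = \<psi>' (omap p d1) e" if o: "over ?P h ?E u d1 x e" for d1 x e
    proof -
      have d1: "d1 \<in> Ob D" "e \<in> val ?E (omap p d1)" using o unfolding over_def by auto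
      show ?thesis
      proof (rule D.sheaf_separated[OF FS d1(1)])
        show "\<psi> (omap p d1) e \<in> val (pre F) d1" "\<psi>' (omap p d1) e \<in> val (pre F) d1"
          using natural_val[OF p(1) _ d1(2)] natural_val[OF p'(1) _ d1(2)] d1 by simp_all
        show "locally D K d1 (\<lambda>k. res (pre F) k (\<psi> (omap p d1) e) = res (pre F) k (\<psi>' (omap p d1) e))"
        proof (rule D.locally_mono[OF d1(1) loc[OF o]])
          fix k assume k: "k \<in> Arr D" "Cod D k = d1"
            and "\<exists>v f'. ?img (Dom D k) (res ?P k x) (res ?E (amap p k) e) v f'"
          then obtain v f' where i: "(Dom D k, v, f') \<in> fact_obs D C p f d" "res ?E (amap p k) e = res ?E v ?e0"
              by blast
          have v: "v \<in> Arr C" "Dom C v = omap p (Dom D k)" "Cod C v = c" using i(1) c_def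
              by (auto simp: fact_obs_iff)
          show "res (pre F) k (\<psi> (omap p d1) e) = res (pre F) k (\<psi>' (omap p d1) e)"
            using natural_res[OF p(1) p_Arr[OF k(1)], of e] natural_res[OF p'(1) p_Arr[OF k(1)], of e]
              natural_res[OF p(1) v(1), of ?e0] natural_res[OF p'(1) v(1), of ?e0] eq i v k d1 repE(3) p(2)
                  p'(2) by simp
        qed
      qed
    qed
    then have "\<forall>b \<in> Ob C. \<forall>e \<in> val ?E b. \<psi> b e = \<psi>' b e" using des F p(1) p'(1) unfolding descent_def by blast
    then show "z = z'" using c repE(3) p(2) p'(2) by blast
  qed
qed

text \<open>Let \<open>e\<close> be an element of \<open>E\<close> at \<open>c\<close> that lies over a triple \<open>(d, x, f)\<close>, that is, \<open>u e\<close> equals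
  \<open>Q(f) (\<eta> x)\<close>. Each factorization \<open>(d', v', f')\<close> of \<open>f\<close> restricts \<open>x\<close> and \<open>e\<close> to a pair in the fibre
  product, so a natural map \<open>\<phi>\<close> on the fibre product gives a compatible family, and this has a unique
  amalgamation \<open>z\<close> in \<open>F c\<close> (the relation \<open>Zs\<close>). By uniqueness \<open>z\<close> does not change along a step
  between triples, because the factorizations for one triple are among those for the other. As triples
  over the same element are locally connected by zigzags, the values \<open>z\<close> depend on \<open>e\<close> only, and they
  glue to the required map.\<close>

lemma descent_of_unique_amalgamation:
  assumes free: "free_along P Q \<eta>" and E: "E \<in> sheaves U C J" and u: "natural C E Q u"
    and am: "\<And>d f. d \<in> Ob D \<Longrightarrow> f \<in> Arr C \<Longrightarrow> Cod C f = omap p d \<Longrightarrow> unique_amalgamation f d"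
  shows "descent P \<eta> E u"
proof -
  note fr = free_alongD[OF free]
  note PP = D.sheavesD(2)[OF fr(1)] and QP = C.sheavesD(2)[OF fr(2)] and EP = C.sheavesD(2)[OF E]
  obtain B where B: "B \<subseteq> Ob D"
    and gen: "\<And>d. d \<in> Ob D \<Longrightarrow> locally D K d (\<lambda>h. \<exists>n m. m \<in> Arr D \<and> n \<in> Arr D \<and> Cod D m = Dom D n \<and>
        Dom D n \<in> B \<and> Cod D n = d \<and> h = n \<cdot>\<^bsub>D\<^esub> m)"
    and surj: "\<And>c s. c \<in> Ob C \<Longrightarrow> s \<in> val Q c \<Longrightarrow> locally C J c (\<lambda>w. \<exists>d x f. (d, x, f) \<in> sections B P (Dom C w) \<and>
        res Q w s = res Q f (\<eta> d x))"
    and inj: "\<And>c d x f d' x' f'. c \<in> Ob C \<Longrightarrow> (d, x, f) \<in> sections B P c \<Longrightarrow> (d', x', f') \<in> sections B P c \<Longrightarrow>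
        res Q f (\<eta> d x) = res Q f' (\<eta> d' x') \<Longrightarrow>
        locally C J c (\<lambda>w. (act w (d, x, f), act w (d', x', f')) \<in> zigzag B P (Dom C w))"
    by (rule free_presentation[OF free]) (rule that)
  have \<eta>Q: "\<eta> d x \<in> val Q (omap p d)" if "d \<in> Ob D" "x \<in> val P d" for d x using naturalD_pre(1)[OF fr(3) that] .
  have secD: "d \<in> B" "d \<in> Ob D" "x \<in> val P d" "f \<in> Arr C" "Dom C f = c" "Cod C f = omap p d"
    if "(d, x, f) \<in> sections B P c" for d x f c using that B by (auto simp: sections_iff hom_iff)
  have ovr: "over P \<eta> E u d' (res P f' x) (res E v' e)"
    if d: "d \<in> Ob D" "x \<in> val P d" "f \<in> Arr C" "Dom C f = c" "Cod C f = omap p d" and e: "e \<in> val E c"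
      and ue: "u c e = res Q f (\<eta> d x)" and i: "(d', v', f') \<in> fact_obs D C p f d" for d x f c e d' v' f'
  proof -
    have a: "d' \<in> Ob D" "v' \<in> Arr C" "Dom C v' = omap p d'" "Cod C v' = c" "f' \<in> Arr D" "Dom D f' = d'"
        "Cod D f' = d"
      "f \<cdot>\<^bsub>C\<^esub> v' = amap p f'" using i d(4) by (auto simp: fact_obs_iff)
    have "u (omap p d') (res E v' e) = res Q v' (res Q f (\<eta> d x))" using natural_res[OF u a(2), of e] a e ue
        by simp
    also have "\<dots> = res Q (amap p f') (\<eta> d x)"
      using C.res_comp[OF QP d(3) a(2), of "\<eta> d x"] a d \<eta>Q by simp
    also have "\<dots> = \<eta> d' (res P f' x)" using naturalD_pre(2)[OF fr(3) a(5), of x] a d by simp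
    finally show ?thesis unfolding over_def
      using a d e D.res_val[OF PP a(5), of x d'] C.res_val[OF EP a(2), of e "omap p d'"] by simp
  qed
  show ?thesis unfolding descent_def
  proof (intro ballI conjI allI impI)
    fix F \<phi> assume F: "F \<in> sheaves U C J" and \<phi>: "natural_over P \<eta> E u F \<phi>"
    note FS = C.sheavesD(1)[OF F] and FP = C.sheavesD(2)[OF F]
    have \<phi>F: "\<phi> d x e \<in> val F (omap p d)" if "over P \<eta> E u d x e" for d x e
      using \<phi> that unfolding natural_over_def by blast
    have \<phi>r: "\<phi> (Dom D k) (res P k x) (res E (amap p k) e) = res F (amap p k) (\<phi> (Cod D k) x e)"
      if "k \<in> Arr D" "over P \<eta> E u (Cod D k) x e" for k x e
      using \<phi> that unfolding natural_over_def by blast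
    (* z is the amalgamation determined by e and the triple (d, x, f) *)
    define Zs where "Zs c e = (\<lambda>(d, x, f) z. z \<in> val F c \<and>
       (\<forall>d' v' f'. (d', v', f') \<in> fact_obs D C p f d \<longrightarrow> res F v' z = \<phi> d' (res P f' x) (res E v' e)))" for c e
    define lies where "lies c e = (\<lambda>(d, x, f). u c e = res Q f (\<eta> d x))" for c e
    have Zs_ex: "\<exists>z. Zs c e (d, x, f) z"
      if d: "d \<in> Ob D" "x \<in> val P d" "f \<in> Arr C" "Dom C f = c" "Cod C f = omap p d" and e: "e \<in> val E c"
        and ue: "u c e = res Q f (\<eta> d x)" for c e d x f
    proof -
      have "fact_family f d F (\<lambda>d' v' f'. \<phi> d' (res P f' x) (res E v' e))"
        unfolding fact_family_def
      proof (intro conjI allI impI)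
        show "\<phi> d' (res P f' x) (res E v' e) \<in> val F (omap p d')" if "(d', v', f') \<in> fact_obs D C p f d"
            for d' v' f'
          by (rule \<phi>F[OF ovr[OF d e ue that]])
        fix d' v' f' k assume i: "(d', v', f') \<in> fact_obs D C p f d" and k: "k \<in> Arr D" "Cod D k = d'"
        have a: "v' \<in> Arr C" "Dom C v' = omap p d'" "Cod C v' = c" "f' \<in> Arr D" "Dom D f' = d'" "Cod D f' = d"
          using i d(4) by (auto simp: fact_obs_iff)
        show "res F (amap p k) (\<phi> d' (res P f' x) (res E v' e)) =
            \<phi> (Dom D k) (res P (f' \<cdot>\<^bsub>D\<^esub> k) x) (res E (v' \<cdot>\<^bsub>C\<^esub> amap p k) e)"
          using \<phi>r[OF k(1), of "res P f' x" "res E v' e"] ovr[OF d e ue i] k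
            D.res_comp[OF PP a(4) k(1), of x] C.res_comp[OF EP a(1) p_Arr[OF k(1)], of e] a d e by simp
      qed
      then show ?thesis using am[OF d(1,3,5)] F d(4) unfolding unique_amalgamation_def Zs_def by fastforce
    qed
    have Zs_uniq: "z = z'" if "d \<in> Ob D" "f \<in> Arr C" "Dom C f = c" "Cod C f = omap p d" "Zs c e (d, x, f) z"
        "Zs c e (d, x, f) z'"
      for c e d x f z z'
      using am[OF that(1,2,4)] F that(3,5,6) unfolding unique_amalgamation_def Zs_def by fastforce
    have Zs_res: "Zs (Dom C w) (res E w e) (d, x, f \<cdot>\<^bsub>C\<^esub> w) (res F w z)"
      if d: "f \<in> Arr C" "Dom C f = c" "Cod C f = omap p d" and e: "e \<in> val E c" and z: "Zs c e (d, x, f) z"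
        and w: "w \<in> Arr C" "Cod C w = c" for c e d x f z w
      unfolding Zs_def prod.case
    proof (intro conjI allI impI)
      have zF: "z \<in> val F c" using z unfolding Zs_def by simp
      show "res F w z \<in> val F (Dom C w)" using C.res_val[OF FP w(1)] w zF by simp
      fix d' v' f' assume i: "(d', v', f') \<in> fact_obs D C p (f \<cdot>\<^bsub>C\<^esub> w) d"
      have a: "v' \<in> Arr C" "Cod C v' = Dom C w" using i d w by (auto simp: fact_obs_iff)
      have "(d', w \<cdot>\<^bsub>C\<^esub> v', f') \<in> fact_obs D C p f d"
        using i C.comp_assoc[OF d(1) w(1) a(1)] a d w by (simp add: fact_obs_iff del: C.comp_assoc)
      then have "res F (w \<cdot>\<^bsub>C\<^esub> v') z = \<phi> d' (res P f' x) (res E (w \<cdot>\<^bsub>C\<^esub> v') e)" using z unfolding Zs_def by simp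
      then show "res F v' (res F w z) = \<phi> d' (res P f' x) (res E v' (res E w e))"
        using C.res_comp[OF FP w(1) a] C.res_comp[OF EP w(1) a] zF e w by simp
    qed
    have Zs_step: "Zs c e t z" if st: "(t, t') \<in> step B P c" and z: "Zs c e t' z" for c e t t' z
      using st
    proof (rule stepE)
      fix k x f assume k: "t = (Dom D k, res P k x, f)" "t' = (Cod D k, x, amap p k \<cdot>\<^bsub>C\<^esub> f)"
        "k \<in> Arr D" "Dom D k \<in> B" "Cod D k \<in> B" "x \<in> val P (Cod D k)" "f \<in> hom C c (omap p (Dom D k))"
      have fA: "f \<in> Arr C" "Dom C f = c" "Cod C f = omap p (Dom D k)" using k(7) by (auto simp: hom_iff)
      show "Zs c e t z" unfolding k(1) Zs_def prod.case
      proof (intro conjI allI impI)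
        show "z \<in> val F c" using z unfolding k(2) Zs_def by simp
        fix d' v' f' assume i: "(d', v', f') \<in> fact_obs D C p f (Dom D k)"
        have "(d', v', k \<cdot>\<^bsub>D\<^esub> f') \<in> fact_obs D C p (amap p k \<cdot>\<^bsub>C\<^esub> f) (Cod D k)"
          using i k(3) fA by (simp add: fact_obs_iff)
        then have "res F v' z = \<phi> d' (res P (k \<cdot>\<^bsub>D\<^esub> f') x) (res E v' e)" using z unfolding k(2) Zs_def by simp
        then show "res F v' z = \<phi> d' (res P f' (res P k x)) (res E v' e)"
          using D.res_comp[OF PP k(3), of f' x] i k(6) by (simp add: fact_obs_iff)
      qed
    qed
    have lies_step: "res Q (snd (snd t)) (\<eta> (fst t) (fst (snd t))) = res Q (snd (snd t')) (\<eta> (fst t') (fst (snd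
        t')))"
      and step_sec: "t \<in> sections B P c \<and> t' \<in> sections B P c" if st: "(t, t') \<in> step B P c" for c t t'
      using st
    proof (atomize (full), rule stepE)
      fix k x f assume k: "t = (Dom D k, res P k x, f)" "t' = (Cod D k, x, amap p k \<cdot>\<^bsub>C\<^esub> f)"
        "k \<in> Arr D" "Dom D k \<in> B" "Cod D k \<in> B" "x \<in> val P (Cod D k)" "f \<in> hom C c (omap p (Dom D k))"
      have fA: "f \<in> Arr C" "Dom C f = c" "Cod C f = omap p (Dom D k)" using k(7) by (auto simp: hom_iff)
      show "res Q (snd (snd t)) (\<eta> (fst t) (fst (snd t))) = res Q (snd (snd t')) (\<eta> (fst t') (fst (snd t'))) \<and>
          t \<in> sections B P c \<and> t' \<in> sections B P c"
        unfolding k(1,2)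
        using k(3-6) fA naturalD_pre(2)[OF fr(3) k(3,6)] C.res_comp[OF QP p_Arr[OF k(3)] fA(1),
            of "\<eta> (Cod D k) x"] \<eta>Q[OF _ k(6)]
          D.res_val[OF PP k(3,6)] by (simp add: sections_iff hom_iff)
    qed
    have Zs_zigzag: "lies c e t' \<and> Zs c e t' z"
      if zz: "(t, t') \<in> zigzag B P c" and ze: "e \<in> val E c" and zl: "lies c e t \<and> Zs c e t z" for c e t t' z
      using zz unfolding zigzag_def
    proof (induction rule: rtrancl_induct)
      case base show ?case by (rule zl)
    next
      case (step s s')
      have lies': "lies c e s'"
        using step lies_step unfolding lies_def by (fastforce simp: case_prod_beta)
      from step(2) show ?case
      proof
        assume st: "(s, s') \<in> step B P c"
        obtain d x f where s': "s' = (d, x, f)" by (metis prod_cases3)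
        obtain d0 x0 f0 where s: "s = (d0, x0, f0)" by (metis prod_cases3)
        note sd = secD[OF step_sec[OF st, THEN conjunct2, unfolded s']]
        note sd0 = secD[OF step_sec[OF st, THEN conjunct1, unfolded s]]
        obtain z' where z': "Zs c e s' z'" using Zs_ex[OF sd(2-6) ze] lies' unfolding s' lies_def by auto
        have "z = z'"
          using Zs_uniq[OF sd0(2,4,5,6)] step.IH Zs_step[OF st z'] unfolding s by blast
        then show ?thesis using z' lies' by blast
      next
        assume "(s, s') \<in> (step B P c)\<inverse>"
        then have "Zs c e s' z" using Zs_step step.IH by blast
        then show ?thesis using lies' by blast
      qed
    qed
    have Zs_indep: "z = z'"
      if c: "c \<in> Ob C" and e: "e \<in> val E c" and t: "t \<in> sections B P c" "lies c e t" "Zs c e t z"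
        and t': "t' \<in> sections B P c" "lies c e t'" "Zs c e t' z'" for c e t t' z z'
    proof -
      obtain d x f where td: "t = (d, x, f)" by (metis prod_cases3)
      obtain d' x' f' where td': "t' = (d', x', f')" by (metis prod_cases3)
      note sd = secD[OF t(1)[unfolded td]] and sd' = secD[OF t'(1)[unfolded td']]
      have zF: "z \<in> val F c" "z' \<in> val F c" using t(3) t'(3) unfolding td td' Zs_def by auto
      have eq: "res Q f (\<eta> d x) = res Q f' (\<eta> d' x')" using t(2) t'(2) unfolding td td' lies_def by simp
      show ?thesis
      proof (rule C.sheaf_separated[OF FS c zF])
        show "locally C J c (\<lambda>w. res F w z = res F w z')"
        proof (rule C.locally_mono[OF c inj[OF c t(1)[unfolded td] t'(1)[unfolded td'] eq]])
          fix w assume w: "w \<in> Arr C" "Cod C w = c"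
              and zz: "(act w (d, x, f), act w (d', x', f')) \<in> zigzag B P (Dom C w)"
          have we: "res E w e \<in> val E (Dom C w)" using C.res_val[OF EP w(1)] w e by simp
          have z1: "Zs (Dom C w) (res E w e) (act w (d, x, f)) (res F w z)"
            unfolding act_def prod.case by (rule Zs_res[OF sd(4-6) e _ w]) (use t(3) td in simp)
          have z2: "Zs (Dom C w) (res E w e) (d', x', f' \<cdot>\<^bsub>C\<^esub> w) (res F w z')"
            by (rule Zs_res[OF sd'(4-6) e _ w]) (use t'(3) td' in simp)
          have "lies (Dom C w) (res E w e) (act w (d, x, f))"
            unfolding act_def lies_def prod.case
            using natural_res[OF u w(1), of e] C.res_comp[OF QP sd(4) w(1), of "\<eta> d x"] \<eta>Q[OF sd(2,3)] sd w e
                t(2)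
            unfolding td lies_def by simp
          then have z3: "Zs (Dom C w) (res E w e) (d', x', f' \<cdot>\<^bsub>C\<^esub> w) (res F w z)"
            using Zs_zigzag[OF zz we] z1 unfolding act_def by auto
          show "res F w z = res F w z'"
            by (rule Zs_uniq[OF sd'(2) _ _ _ z3 z2]) (use sd' w in simp_all)
        qed
      qed
    qed
    define Rel where "Rel e w z \<longleftrightarrow> (\<exists>t \<in> sections B P (Dom C w). lies (Dom C w) (res E w e) t \<and>
        Zs (Dom C w) (res E w e) t z)"
      for e w z
    have Rel_ex: "locally C J c (\<lambda>w. \<exists>z. Rel e w z)" if c: "c \<in> Ob C" and e: "e \<in> val E c" for c e
    proof (rule C.locally_mono[OF c surj[OF c natural_val[OF u c e]]])
      fix w assume w: "w \<in> Arr C" "Cod C w = c"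
          and "\<exists>d x f. (d, x, f) \<in> sections B P (Dom C w) \<and> res Q w (u c e) = res Q f (\<eta> d x)"
      then obtain d x f where t: "(d, x, f) \<in> sections B P (Dom C w)" "res Q w (u c e) = res Q f (\<eta> d x)"
          by blast
      have we: "res E w e \<in> val E (Dom C w)" using C.res_val[OF EP w(1)] w e by simp
      have l: "u (Dom C w) (res E w e) = res Q f (\<eta> d x)" using natural_res[OF u w(1)] w e t(2) by simp
      show "\<exists>z. Rel e w z" using Zs_ex[OF secD(2-6)[OF t(1)] we l] t(1) l unfolding Rel_def lies_def by blast
    qed
    have Rel_val: "z \<in> val F (Dom C w)" if "Rel e w z" for e w z using that unfolding Rel_def Zs_def by auto
    obtain \<psi> where \<psi>n: "natural C E F \<psi>"
      and \<psi>: "\<And>c e w z. c \<in> Ob C \<Longrightarrow> e \<in> val E c \<Longrightarrow> w \<in> Arr C \<Longrightarrow> Cod C w = c \<Longrightarrow> Rel e w z \<Longrightarrow> res F w (\<psi> c e) = z"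
    proof (rule C.glue_natural[OF FS EP, of "\<lambda>c. Rel"])
      show "locally C J c (\<lambda>w. \<exists>z. Rel e w z)" if "c \<in> Ob C" "e \<in> val E c" for c e by (rule Rel_ex[OF that])
      show "z \<in> val F (Dom C w)" if "Rel e w z" for e w z by (rule Rel_val[OF that])
        show "Rel e (w \<cdot>\<^bsub>C\<^esub> w') (res F w' z)"
          if e: "e \<in> val E c" and w: "w \<in> Arr C" "Cod C w = c" and w': "w' \<in> Arr C" "Cod C w' = Dom C w"
            and r: "Rel e w z" for c e w w' z
        proof -
          obtain d x f where t: "(d, x, f) \<in> sections B P (Dom C w)" "u (Dom C w) (res E w e) = res Q f (\<eta> d x)"
            "Zs (Dom C w) (res E w e) (d, x, f) z" using r unfolding Rel_def lies_def by auto
          note sd = secD[OF t(1)]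
          have we: "res E w e \<in> val E (Dom C w)" using C.res_val[OF EP w(1)] w e by simp
          have ec: "res E (w \<cdot>\<^bsub>C\<^esub> w') e = res E w' (res E w e)" using C.res_comp[OF EP w(1) w'] w e by simp
          have "(d, x, f \<cdot>\<^bsub>C\<^esub> w') \<in> sections B P (Dom C (w \<cdot>\<^bsub>C\<^esub> w'))" using sd w w'
              by (simp add: sections_iff hom_iff)
          moreover have "lies (Dom C (w \<cdot>\<^bsub>C\<^esub> w')) (res E (w \<cdot>\<^bsub>C\<^esub> w') e) (d, x, f \<cdot>\<^bsub>C\<^esub> w')"
            unfolding lies_def prod.case ec
            using natural_res[OF u w'(1), of "res E w e"] we w w' t(2) C.res_comp[OF QP sd(4) w'(1), of "\<eta> d x"]
                sd \<eta>Q[OF sd(2,3)] by simp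
          moreover have "Zs (Dom C (w \<cdot>\<^bsub>C\<^esub> w')) (res E (w \<cdot>\<^bsub>C\<^esub> w') e) (d, x, f \<cdot>\<^bsub>C\<^esub> w') (res F w' z)"
            using Zs_res[OF sd(4-6) we t(3) w'] w w' unfolding ec by simp
          ultimately show ?thesis unfolding Rel_def by blast
        qed
        show "z = z'" if "e \<in> val E c" "w \<in> Arr C" "Cod C w = c" "Rel e w z" "Rel e w z'" for c e w z z'
        proof -
          have we: "res E w e \<in> val E (Dom C w)" "Dom C w \<in> Ob C" using C.res_val[OF EP that(2)] that(1-3)
              by simp_all
          show ?thesis using that(4,5) Zs_indep[OF we(2,1)] unfolding Rel_def by blast
        qed
        show "Rel e (w \<cdot>\<^bsub>C\<^esub> w') z"
          if "w \<in> Arr C" "e \<in> val E (Cod C w)" "w' \<in> Arr C" "Cod C w' = Dom C w" "Rel (res E w e) w' z"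
              for w e w' z
          using that C.res_comp[OF EP] unfolding Rel_def by simp
    qed (rule that)
    show "\<exists>\<psi>. natural C E F \<psi> \<and> (\<forall>d x e. over P \<eta> E u d x e \<longrightarrow> \<psi> (omap p d) e = \<phi> d x e)"
    proof (intro exI conjI allI impI)
      show "natural C E F \<psi>" by (rule \<psi>n)
      fix d x e assume o: "over P \<eta> E u d x e"
      have d: "d \<in> Ob D" "x \<in> val P d" "e \<in> val E (omap p d)" "u (omap p d) e = \<eta> d x" using o
          unfolding over_def by auto
      have \<psi>e: "\<psi> (omap p d) e \<in> val F (omap p d)" by (rule natural_val[OF \<psi>n p_Ob[OF d(1)] d(3)])
      show "\<psi> (omap p d) e = \<phi> d x e"
      proof (rule D.sheaf_separated[OF D.sheavesD(1)[OF pre_sheaf[OF F]] d(1)])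
        show "\<psi> (omap p d) e \<in> val (pre F) d" "\<phi> d x e \<in> val (pre F) d" using \<psi>e \<phi>F[OF o] d(1) by simp_all
        show "locally D K d (\<lambda>k. res (pre F) k (\<psi> (omap p d) e) = res (pre F) k (\<phi> d x e))"
        proof (rule D.locally_mono[OF d(1) gen[OF d(1)]])
          fix k assume "\<exists>n m. m \<in> Arr D \<and> n \<in> Arr D \<and> Cod D m = Dom D n \<and> Dom D n \<in> B \<and> Cod D n = d \<and>
              k = n \<cdot>\<^bsub>D\<^esub> m"
          then obtain n m where nm: "m \<in> Arr D" "n \<in> Arr D" "Cod D m = Dom D n" "Dom D n \<in> B" "Cod D n = d"
              "k = n \<cdot>\<^bsub>D\<^esub> m" by blast
          define b where "b = Dom D n"
          have b: "b \<in> B" "b \<in> Ob D" using nm b_def by simp_all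
          let ?x = "res P n x" and ?e = "res E (amap p n) e"
          have x': "?x \<in> val P b" using D.res_val[OF PP nm(2), of x] nm d b_def by simp
          have e': "?e \<in> val E (omap p b)" using C.res_val[OF EP p_Arr[OF nm(2)], of e] nm d b_def by simp
          have ue': "u (omap p b) ?e = \<eta> b ?x"
            using natural_res[OF u p_Arr[OF nm(2)], of e] naturalD_pre(2)[OF fr(3) nm(2), of x] nm d b_def
                by simp
          have \<phi>b: "\<phi> b ?x ?e = res F (amap p n) (\<phi> d x e)" using \<phi>r[OF nm(2), of x e] o nm b_def by simp
          have ide: "Ide C (omap p b) \<in> Arr C" "Dom C (Ide C (omap p b)) = omap p b"
              "Cod C (Ide C (omap p b)) = omap p b" using b by simp_all
          have \<eta>b: "res Q (Ide C (omap p b)) (\<eta> b ?x) = \<eta> b ?x"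
              using C.res_Ide[OF QP p_Ob[OF b(2)] \<eta>Q[OF b(2) x']] .
          obtain z where z: "Zs (omap p b) ?e (b, ?x, Ide C (omap p b)) z"
            using Zs_ex[OF b(2) x' ide e'] ue' \<eta>b by auto
          have i: "(b, Ide C (omap p b), Ide D b) \<in> fact_obs D C p (Ide C (omap p b)) b" using b
              by (simp add: fact_obs_iff)
          have zF: "z \<in> val F (omap p b)" using z unfolding Zs_def by simp
          have zz: "z = \<phi> b ?x ?e"
            using z i C.res_Ide[OF FP p_Ob[OF b(2)] zF] D.res_Ide[OF PP b(2) x'] C.res_Ide[OF EP p_Ob[OF b(2)]
                e']
            unfolding Zs_def by auto
          have "Rel e (amap p n) z" unfolding Rel_def
          proof (rule bexI[of _ "(b, ?x, Ide C (omap p b))"])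
            show "(b, ?x, Ide C (omap p b)) \<in> sections B P (Dom C (amap p n))" using b x' nm b_def
                by (simp add: sections_iff hom_iff)
            show "lies (Dom C (amap p n)) ?e (b, ?x, Ide C (omap p b)) \<and>
                Zs (Dom C (amap p n)) ?e (b, ?x, Ide C (omap p b)) z"
              using z ue' \<eta>b nm(2) b_def unfolding lies_def by simp
          qed
          from \<psi>[OF _ d(3) _ _ this]
          have "res F (amap p n) (\<psi> (omap p d) e) = res F (amap p n) (\<phi> d x e)" using nm d zz \<phi>b by simp
          then show "res (pre F) k (\<psi> (omap p d) e) = res (pre F) k (\<phi> d x e)"
            using C.res_comp[OF FP p_Arr[OF nm(2)] p_Arr[OF nm(1)]] \<psi>e \<phi>F[OF o] nm by simp
        qed
      qed
    qed
  next
    fix F \<psi> \<psi>' c e assume F: "F \<in> sheaves U C J" and n: "natural C E F \<psi>" "natural C E F \<psi>'"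
      and eq: "\<forall>d x e. over P \<eta> E u d x e \<longrightarrow> \<psi> (omap p d) e = \<psi>' (omap p d) e" and c: "c \<in> Ob C"
          and e: "e \<in> val E c"
    show "\<psi> c e = \<psi>' c e"
    proof (rule C.sheaf_separated[OF C.sheavesD(1)[OF F] c natural_val[OF n(1) c e] natural_val[OF n(2) c e]])
      show "locally C J c (\<lambda>w. res F w (\<psi> c e) = res F w (\<psi>' c e))"
      proof (rule C.locally_mono[OF c surj[OF c natural_val[OF u c e]]])
        fix w assume w: "w \<in> Arr C" "Cod C w = c"
            and "\<exists>d x f. (d, x, f) \<in> sections B P (Dom C w) \<and> res Q w (u c e) = res Q f (\<eta> d x)"
        then obtain d x f where t: "(d, x, f) \<in> sections B P (Dom C w)" "res Q w (u c e) = res Q f (\<eta> d x)"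
            by blast
        note sd = secD[OF t(1)]
        let ?e = "res E w e"
        have we: "?e \<in> val E (Dom C w)" using C.res_val[OF EP w(1)] w e by simp
        have l: "u (Dom C w) ?e = res Q f (\<eta> d x)" using natural_res[OF u w(1)] w e t(2) by simp
        have "res F v' (\<psi> (Dom C w) ?e) = res F v' (\<psi>' (Dom C w) ?e)" if i: "(d', v', f') \<in> fact_obs D C p f d"
            for d' v' f'
        proof -
          have a: "v' \<in> Arr C" "Dom C v' = omap p d'" "Cod C v' = Dom C w" using i sd
              by (auto simp: fact_obs_iff)
          show ?thesis using natural_res[OF n(1) a(1), of ?e] natural_res[OF n(2) a(1), of ?e] a we
              eq ovr[OF sd(2-6) we l i] by simp
        qed
        then have "\<psi> (Dom C w) ?e = \<psi>' (Dom C w) ?e"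
          using am[OF sd(2,4,6)] F sd(5) natural_val[OF n(1) _ we] natural_val[OF n(2) _ we] w
          unfolding unique_amalgamation_def by fastforce
        then show "res F w (\<psi> c e) = res F w (\<psi>' c e)"
          using natural_res[OF n(1) w(1), of e] natural_res[OF n(2) w(1), of e] w e by simp
      qed
    qed
  qed
qed

end

lemma (in shriek) fibration_iff_cofinal:
  "street_fibration (Sh U D K) (Sh U C J) S \<longleftrightarrow>
    (\<forall>d \<in> Ob D. \<forall>c \<in> Ob C. \<forall>f \<in> hom C c (omap p d).
       J_cofinal U C J c (fact_cat D C p f d) (fact_proj p))"
proof
  assume fib: "street_fibration (Sh U D K) (Sh U C J) S"
  show "\<forall>d \<in> Ob D. \<forall>c \<in> Ob C. \<forall>f \<in> hom C c (omap p d).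
     J_cofinal U C J c (fact_cat D C p f d) (fact_proj p)"
  proof (intro ballI)
    fix d c f assume d: "d \<in> Ob D" and f: "f \<in> hom C c (omap p d)"
    have "unique_amalgamation f d"
    proof (rule unique_amalgamation_of_descent[OF d _ _ _ fr])
      have cO: "c \<in> Ob C" "c = Dom C f" using f by (auto simp: hom_iff)
      note P = D.representingD(2)[OF D.l_representing[OF d]]
          and E = C.representingD(2)[OF C.l_representing[OF cO(1)]]
      show "D.l_obj d \<in> sheaves U D K" by (rule P)
      show "descent (D.l_obj d) (\<eta> (D.l_obj d)) (C.l_obj c) u"
        if "nat_trans C (C.l_obj c) (omap S (D.l_obj d)) u" for u
        by (rule descent_of_fibration[OF fib P E that])
      show "c = Dom C f" by (rule cO(2))
    qed (use f in \<open>auto simp: hom_iff\<close>)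
    then show "J_cofinal U C J c (fact_cat D C p f d) (fact_proj p)"
      using J_cofinal_fact_iff[OF d f] by blast
  qed
next
  assume cof: "\<forall>d \<in> Ob D. \<forall>c \<in> Ob C. \<forall>f \<in> hom C c (omap p d).
     J_cofinal U C J c (fact_cat D C p f d) (fact_proj p)"
  have am: "unique_amalgamation f d" if "d \<in> Ob D" "f \<in> Arr C" "Cod C f = omap p d" for d f
  proof -
    have "f \<in> hom C (Dom C f) (omap p d)" "Dom C f \<in> Ob C" using that by (simp_all add: hom_iff)
    then show ?thesis using J_cofinal_fact_iff[OF that(1)] cof that(1) by blast
  qed
  show "street_fibration (Sh U D K) (Sh U C J) S"
    by (rule fibration_of_descent[OF descent_of_unique_amalgamation[OF fr _ nat_trans_natural am]])
qed

theorem proposition5p3p5: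
  fixes U :: "'u set set"
    and D :: "('d, 'b) cat" and K :: "'d \<Rightarrow> 'b set set"
    and C :: "('o, 'a) cat" and J :: "'o \<Rightarrow> 'a set set"
    and p :: "('d, 'b, 'o, 'a) funct"
    and S :: "(('d, 'b, 'u) psh, ('d, 'b, 'u) sh_arr, ('o, 'a, 'u) psh, ('o, 'a, 'u) sh_arr) funct"
  assumes "set_universe U"
    and "site U D K" and "site U C J"
    and "continuous_comorphism U D K C J p"
    and "is_C_shriek U D K C J p S"
  shows "street_fibration (Sh U D K) (Sh U C J) S \<longleftrightarrow>
    (\<forall>d \<in> Ob D. \<forall>c \<in> Ob C. \<forall>f \<in> hom C c (omap p d).
       J_cofinal U C J c (fact_cat D C p f d) (fact_proj p))"
proof -
  have "small_site D K U" "small_site C J U"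
    using assms(1-3) by (simp_all add: small_site_def small_site_axioms_def topology_def topology_axioms_def
        plain_cat_def site_def)
  then interpret cont_comorphism D K C J U p
    using assms(4) by (simp add: cont_comorphism_def cont_comorphism_axioms_def)
  obtain \<eta> where "shriek D K C J U p S \<eta>" by (rule ex_shriek[OF assms(5)])
  then interpret shriek D K C J U p S \<eta> .
  show ?thesis by (rule fibration_iff_cofinal)
qed

end
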